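(* Let $X$ be a compact metric space with metric $d$, let $T:X\to X$ be continuous, and let $\mathcal{F}=\{f_n\}_{n\ge1}$ be a subadditive potential on $X$. Then for every ergodic $T$-invariant Borel probability measure $\mu$ with $\mathcal{F}_*(\mu)\neq-\infty$, \[ P^*_\mu(T,\mathcal{F})=\underline{CP}^*_\mu(T,\mathcal{F})=\overline{CP}^*_\mu(T,\mathcal{F})=P_\mu(T,\mathcal{F})=h_\mu(T)+\mathcal{F}_*(\mu). \]
   Context: $h_\mu(T)$ is the measure-theoretic (Kolmogorov–Sinai) entropy. For $x,y\in X$ and $n\ge1$ let $d_n(x,y)=\max\{d(T^ix,T^iy):0\le i\le n-1\}$ and $B_n(x,\epsilon)=\{y\in X:d_n(x,y)<\epsilon\}$ (Bowen ball). A subadditive potential is a sequence $\{f_n\}_{n\ge1}$ of continuous real functions on $X$ with $f_{n+m}(x)\le f_n(x)+f_m(T^nx)$ for all $x\in X$, $n,m\ge1$. For an invariant measure $\mu$, $\mathcal{F}_*(\mu)=\lim_{n\to\infty}\frac1n\int f_n\,d\mu=\inf_{n\ge1}\frac1n\int f_n\,d\mu$. Spanning pressure: for $0<\delta<1$, $n\ge1$, $\epsilon>0$, a set $F\subseteq X$ is $(n,\epsilon,\delta)$-spanning if $\mu\big(\bigcup_{x\in F}B_n(x,\epsilon)\big)\ge1-\delta$. Put $P_\mu(T,\mathcal{F},n,\epsilon,\delta)=\inf\{\sum_{x\in F}\exp(\sup_{y\in B_n(x,\epsilon)}f_n(y)): F \text{ is } (n,\epsilon,\delta)\text{-spanning}\}$,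 $P_\mu(T,\mathcal{F},\epsilon,\delta)=\limsup_{n\to\infty}\frac1n\log P_\mu(T,\mathcal{F},n,\epsilon,\delta)$, $P_\mu(T,\mathcal{F},\delta)=\liminf_{\epsilon\to0}P_\mu(T,\mathcal{F},\epsilon,\delta)$, and $P_\mu(T,\mathcal{F})=\lim_{\delta\to0}P_\mu(T,\mathcal{F},\delta)$ (the limit exists by monotonicity in $\delta$). Carathéodory pressure: for $Z\subseteq X$ and $\epsilon>0$, a cover of $Z$ is a countable family $\Gamma=\{B_{n_i}(x_i,\epsilon)\}_i$ with $Z\subseteq\bigcup_iB_{n_i}(x_i,\epsilon)$; set $n(\Gamma)=\min_in_i$. For $s\ge0$, $M(Z,\mathcal{F},s,N,\epsilon)=\inf_\Gamma\sum_i\exp\big(-sn_i+\sup_{y\in B_{n_i}(x_i,\epsilon)}f_{n_i}(y)\big)$, infimum over covers $\Gamma$ of $Z$ with $n(\Gamma)\ge N$; $m(Z,\mathcal{F},s,\epsilon)=\lim_{N\to\infty}M(Z,\mathcal{F},s,N,\epsilon)$; $P_Z(T,\mathcal{F},\epsilon)=\inf\{s:m(Z,\mathcal{F},s,\epsilon)=0\}=\sup\{s:m(Z,\mathcal{F},s,\epsilon)=+\infty\}$; $P_Z(T,\mathcal{F})=\liminf_{\epsilon\to0}P_Z(T,\mathcal{F},\epsilon)$. Then $P^*_\mu(T,\mathcal{F},\epsilon)=\inf\{P_Z(T,\mathcal{F},\epsilon):\mu(Z)=1\}$ and $P^*_\mu(T,\mathcal{F})=\liminf_{\epsilon\to0}P^*_\mu(T,\mathcal{F},\epsilon)$.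 Capacity pressures: $\Lambda(Z,\mathcal{F},N,\epsilon)=\inf\sum_i\exp(\sup_{y\in B_N(x_i,\epsilon)}f_N(y))$, infimum over covers $\{B_N(x_i,\epsilon)\}_i$ of $Z$ (all $n_i=N$); $\underline{CP}_Z(T,\mathcal{F},\epsilon)=\liminf_{N\to\infty}\frac1N\log\Lambda(Z,\mathcal{F},N,\epsilon)$ and $\overline{CP}_Z(T,\mathcal{F},\epsilon)=\limsup_{N\to\infty}\frac1N\log\Lambda(Z,\mathcal{F},N,\epsilon)$. Then $\underline{CP}^*_\mu(T,\mathcal{F},\epsilon)=\lim_{\delta\to0}\inf\{\underline{CP}_Z(T,\mathcal{F},\epsilon):\mu(Z)\ge1-\delta\}$, $\overline{CP}^*_\mu(T,\mathcal{F},\epsilon)=\lim_{\delta\to0}\inf\{\overline{CP}_Z(T,\mathcal{F},\epsilon):\mu(Z)\ge1-\delta\}$, $\underline{CP}^*_\mu(T,\mathcal{F})=\liminf_{\epsilon\to0}\underline{CP}^*_\mu(T,\mathcal{F},\epsilon)$, $\overline{CP}^*_\mu(T,\mathcal{F})=\liminf_{\epsilon\to0}\overline{CP}^*_\mu(T,\mathcal{F},\epsilon)$.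
   Formalization: In the Carathéodory pressure, s ranges over all real numbers instead of s ≥ 0; with s ≥ 0 the equality fails when h_μ(T)+F_*(μ) is negative (e.g. a one-point X with f_n = -n), and for nonnegative values the two versions agree. *)

theory Defs
  imports "HOL-Probability.Probability"
begin

definition bowen_ball :: "'a set \<Rightarrow> ('a::metric_space \<Rightarrow> 'a) \<Rightarrow> nat \<Rightarrow> 'a \<Rightarrow> real \<Rightarrow> 'a set" where
  "bowen_ball X T n x eps = {y \<in> X. \<forall>i<n. dist ((T^^i) x) ((T^^i) y) < eps}"

definition subadditive_potential :: "'a set \<Rightarrow> ('a \<Rightarrow> 'a) \<Rightarrow> (nat \<Rightarrow> 'a::topological_space \<Rightarrow> real) \<Rightarrow> bool" where
  "subadditive_potential X T f \<longleftrightarrow>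
     (\<forall>n\<ge>1. continuous_on X (f n)) \<and>
     (\<forall>x\<in>X. \<forall>n\<ge>1. \<forall>m\<ge>1. f (n + m) x \<le> f n x + f m ((T^^n) x))"

definition sup_pot :: "'a set \<Rightarrow> ('a::metric_space \<Rightarrow> 'a) \<Rightarrow> (nat \<Rightarrow> 'a \<Rightarrow> real) \<Rightarrow> nat \<Rightarrow> 'a \<Rightarrow> real \<Rightarrow> real" where
  "sup_pot X T f n x eps = (SUP y\<in>bowen_ball X T n x eps. f n y)"

definition eln :: "ennreal \<Rightarrow> ereal" where
  "eln t = (if t = 0 then -\<infinity> else if t = \<infinity> then \<infinity> else ereal (ln (enn2real t)))"

definition invariant_measure :: "'a::topological_space set \<Rightarrow> ('a \<Rightarrow> 'a) \<Rightarrow> 'a measure \<Rightarrow> bool" where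
  "invariant_measure X T M \<longleftrightarrow>
     prob_space M \<and> sets M = sets (restrict_space borel X) \<and>
     T \<in> M \<rightarrow>\<^sub>M M \<and> distr M M T = M"

definition ergodic_measure :: "'a::topological_space set \<Rightarrow> ('a \<Rightarrow> 'a) \<Rightarrow> 'a measure \<Rightarrow> bool" where
  "ergodic_measure X T M \<longleftrightarrow> invariant_measure X T M \<and>
     (\<forall>A\<in>sets M. T -` A \<inter> space M = A \<longrightarrow> measure M A = 0 \<or> measure M A = 1)"

text \<open>F_*(mu) = lim (1/n) int f_n dmu = inf_n (1/n) int f_n dmu\<close>
definition Fstar :: "'a measure \<Rightarrow> (nat \<Rightarrow> 'a \<Rightarrow> real) \<Rightarrow> ereal" where
  "Fstar M f = Inf {ereal (integral\<^sup>L M (f n) / real n) | n. n \<ge> 1}"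

definition meas_partition :: "'a measure \<Rightarrow> 'a set set \<Rightarrow> bool" where
  "meas_partition M P \<longleftrightarrow> finite P \<and> P \<subseteq> sets M \<and> disjoint P \<and> \<Union>P = space M"

definition join_partition :: "'a measure \<Rightarrow> ('a \<Rightarrow> 'a) \<Rightarrow> 'a set set \<Rightarrow> nat \<Rightarrow> 'a set set" where
  "join_partition M T P n =
     {space M \<inter> (\<Inter>i\<in>{..<n}. (T^^i) -` c i) | c. \<forall>i<n. c i \<in> P}"

definition part_entropy :: "'a measure \<Rightarrow> 'a set set \<Rightarrow> real" where
  "part_entropy M P = - (\<Sum>A\<in>P. measure M A * ln (measure M A))"

definition entropy_wrt :: "'a measure \<Rightarrow> ('a \<Rightarrow> 'a) \<Rightarrow> 'a set set \<Rightarrow> real" where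
  "entropy_wrt M T P = lim (\<lambda>n. part_entropy M (join_partition M T P n) / real n)"

definition ks_entropy :: "'a measure \<Rightarrow> ('a \<Rightarrow> 'a) \<Rightarrow> ereal" where
  "ks_entropy M T = (SUP P\<in>{P. meas_partition M P}. ereal (entropy_wrt M T P))"

definition span_count :: "'a set \<Rightarrow> ('a::metric_space \<Rightarrow> 'a) \<Rightarrow> (nat \<Rightarrow> 'a \<Rightarrow> real) \<Rightarrow> 'a measure
    \<Rightarrow> nat \<Rightarrow> real \<Rightarrow> real \<Rightarrow> ennreal" where
  "span_count X T f M n eps delta =
     (INF F\<in>{F. F \<subseteq> X \<and> measure M (\<Union>x\<in>F. bowen_ball X T n x eps) \<ge> 1 - delta}.
        \<integral>\<^sup>+ x. ennreal (exp (sup_pot X T f n x eps)) \<partial>count_space F)"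

definition span_press_eps :: "'a set \<Rightarrow> ('a::metric_space \<Rightarrow> 'a) \<Rightarrow> (nat \<Rightarrow> 'a \<Rightarrow> real) \<Rightarrow> 'a measure
    \<Rightarrow> real \<Rightarrow> real \<Rightarrow> ereal" where
  "span_press_eps X T f M eps delta =
     limsup (\<lambda>n. eln (span_count X T f M n eps delta) / ereal (real n))"

definition span_press_delta :: "'a set \<Rightarrow> ('a::metric_space \<Rightarrow> 'a) \<Rightarrow> (nat \<Rightarrow> 'a \<Rightarrow> real) \<Rightarrow> 'a measure
    \<Rightarrow> real \<Rightarrow> ereal" where
  "span_press_delta X T f M delta = Liminf (at_right 0) (\<lambda>eps. span_press_eps X T f M eps delta)"

definition span_pressure :: "'a set \<Rightarrow> ('a::metric_space \<Rightarrow> 'a) \<Rightarrow> (nat \<Rightarrow> 'a \<Rightarrow> real) \<Rightarrow> 'a measure \<Rightarrow> ereal" where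
  "span_pressure X T f M = Lim (at_right 0) (\<lambda>delta. span_press_delta X T f M delta)"

definition car_cover :: "'a set \<Rightarrow> ('a::metric_space \<Rightarrow> 'a) \<Rightarrow> real \<Rightarrow> nat \<Rightarrow> 'a set \<Rightarrow> (nat \<times> 'a) set \<Rightarrow> bool" where
  "car_cover X T eps N Z \<Gamma> \<longleftrightarrow> countable \<Gamma> \<and> \<Gamma> \<subseteq> {N..} \<times> X \<and>
     Z \<subseteq> (\<Union>p\<in>\<Gamma>. bowen_ball X T (fst p) (snd p) eps)"

definition car_M :: "'a set \<Rightarrow> ('a::metric_space \<Rightarrow> 'a) \<Rightarrow> (nat \<Rightarrow> 'a \<Rightarrow> real) \<Rightarrow> 'a set
    \<Rightarrow> real \<Rightarrow> nat \<Rightarrow> real \<Rightarrow> ennreal" where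
  "car_M X T f Z s N eps =
     (INF \<Gamma>\<in>{\<Gamma>. car_cover X T eps N Z \<Gamma>}.
        \<integral>\<^sup>+ p. ennreal (exp (- s * real (fst p) + sup_pot X T f (fst p) (snd p) eps)) \<partial>count_space \<Gamma>)"

definition car_m :: "'a set \<Rightarrow> ('a::metric_space \<Rightarrow> 'a) \<Rightarrow> (nat \<Rightarrow> 'a \<Rightarrow> real) \<Rightarrow> 'a set
    \<Rightarrow> real \<Rightarrow> real \<Rightarrow> ennreal" where
  "car_m X T f Z s eps = lim (\<lambda>N. car_M X T f Z s N eps)"

definition car_P_eps :: "'a set \<Rightarrow> ('a::metric_space \<Rightarrow> 'a) \<Rightarrow> (nat \<Rightarrow> 'a \<Rightarrow> real) \<Rightarrow> 'a set
    \<Rightarrow> real \<Rightarrow> ereal" where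
  "car_P_eps X T f Z eps = Inf {ereal s | s. car_m X T f Z s eps = 0}"

definition car_Pstar_eps :: "'a set \<Rightarrow> ('a::metric_space \<Rightarrow> 'a) \<Rightarrow> (nat \<Rightarrow> 'a \<Rightarrow> real) \<Rightarrow> 'a measure
    \<Rightarrow> real \<Rightarrow> ereal" where
  "car_Pstar_eps X T f M eps = (INF Z\<in>{Z\<in>sets M. measure M Z = 1}. car_P_eps X T f Z eps)"

definition car_Pstar :: "'a set \<Rightarrow> ('a::metric_space \<Rightarrow> 'a) \<Rightarrow> (nat \<Rightarrow> 'a \<Rightarrow> real) \<Rightarrow> 'a measure \<Rightarrow> ereal" where
  "car_Pstar X T f M = Liminf (at_right 0) (\<lambda>eps. car_Pstar_eps X T f M eps)"

definition cap_Lambda :: "'a set \<Rightarrow> ('a::metric_space \<Rightarrow> 'a) \<Rightarrow> (nat \<Rightarrow> 'a \<Rightarrow> real) \<Rightarrow> 'a set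
    \<Rightarrow> nat \<Rightarrow> real \<Rightarrow> ennreal" where
  "cap_Lambda X T f Z N eps =
     (INF C\<in>{C. countable C \<and> C \<subseteq> X \<and> Z \<subseteq> (\<Union>x\<in>C. bowen_ball X T N x eps)}.
        \<integral>\<^sup>+ x. ennreal (exp (sup_pot X T f N x eps)) \<partial>count_space C)"

definition lower_cap_Z :: "'a set \<Rightarrow> ('a::metric_space \<Rightarrow> 'a) \<Rightarrow> (nat \<Rightarrow> 'a \<Rightarrow> real) \<Rightarrow> 'a set
    \<Rightarrow> real \<Rightarrow> ereal" where
  "lower_cap_Z X T f Z eps = liminf (\<lambda>N. eln (cap_Lambda X T f Z N eps) / ereal (real N))"

definition upper_cap_Z :: "'a set \<Rightarrow> ('a::metric_space \<Rightarrow> 'a) \<Rightarrow> (nat \<Rightarrow> 'a \<Rightarrow> real) \<Rightarrow> 'a set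
    \<Rightarrow> real \<Rightarrow> ereal" where
  "upper_cap_Z X T f Z eps = limsup (\<lambda>N. eln (cap_Lambda X T f Z N eps) / ereal (real N))"

definition lower_cap_star_eps :: "'a set \<Rightarrow> ('a::metric_space \<Rightarrow> 'a) \<Rightarrow> (nat \<Rightarrow> 'a \<Rightarrow> real) \<Rightarrow> 'a measure
    \<Rightarrow> real \<Rightarrow> ereal" where
  "lower_cap_star_eps X T f M eps = Lim (at_right 0)
     (\<lambda>delta. INF Z\<in>{Z\<in>sets M. measure M Z \<ge> 1 - delta}. lower_cap_Z X T f Z eps)"

definition upper_cap_star_eps :: "'a set \<Rightarrow> ('a::metric_space \<Rightarrow> 'a) \<Rightarrow> (nat \<Rightarrow> 'a \<Rightarrow> real) \<Rightarrow> 'a measure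
    \<Rightarrow> real \<Rightarrow> ereal" where
  "upper_cap_star_eps X T f M eps = Lim (at_right 0)
     (\<lambda>delta. INF Z\<in>{Z\<in>sets M. measure M Z \<ge> 1 - delta}. upper_cap_Z X T f Z eps)"

definition lower_cap_star :: "'a set \<Rightarrow> ('a::metric_space \<Rightarrow> 'a) \<Rightarrow> (nat \<Rightarrow> 'a \<Rightarrow> real) \<Rightarrow> 'a measure \<Rightarrow> ereal" where
  "lower_cap_star X T f M = Liminf (at_right 0) (\<lambda>eps. lower_cap_star_eps X T f M eps)"

definition upper_cap_star :: "'a set \<Rightarrow> ('a::metric_space \<Rightarrow> 'a) \<Rightarrow> (nat \<Rightarrow> 'a \<Rightarrow> real) \<Rightarrow> 'a measure \<Rightarrow> ereal" where
  "upper_cap_star X T f M = Liminf (at_right 0) (\<lambda>eps. upper_cap_star_eps X T f M eps)"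

end

theory Submission
  imports Defs
begin

text \<open>
Everything reduces to one greedy estimate: if a subadditive process \<open>g\<close> satisfies
\<open>g n x \<le> n a\<close> for some \<open>n \<ge> 1\<close> at almost every point, then covering orbits by such stretches
and integrating gives \<open>inf (\<integral> g n / n) \<le> a\<close>. Together with ergodicity this yields Birkhoff's and
Kingman's theorems. Entropy enters through random-block codes of itineraries, whose code length is
itself a subadditive process and dominates the entropy of the joins by Gibbs' inequality.

For the upper bound, a code made of the cylinder probabilities shows that typical points have at
most \<open>exp (n (h + \<eta>))\<close> itineraries with respect to a partition of small diameter, and on a Bowen
ball around a typical point the potential is at most \<open>n (F + \<eta>)\<close>.

For the lower bound no Shannon-McMillan-Breiman theorem is needed: if almost every Bowen ball had
measure above \<open>exp (- n h')\<close> for some large \<open>n\<close>, a maximal disjoint family of such heavy balls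
would give a code that is too short for \<open>h' < h\<close>. Hence
\<open>\<mu> (B n x) \<le> exp (- n h')\<close> for all large \<open>n\<close> on a set \<open>G\<close> of positive measure, and the mass
distribution principle on \<open>G\<close> bounds all the pressures from below.
\<close>

section \<open>Subadditive processes over a measure-preserving map\<close>

text \<open>Orbits that stay close to each other may still visit different cells of a partition, so
  a heavy Bowen ball does not determine an itinerary, it only predicts one. The code behind the
  lower bound follows the orbit of the centre of the ball and pays a price \<open>b\<close> for a
  wrong letter. Wrong letters occur only at visits to a set \<open>A0\<close> outside compact pieces
  of the cells. The order of choices makes this affordable: \<open>b\<close> depends only on the
  entropy gap and the number of cells, so \<open>A0\<close> can be chosen afterwards with
  \<open>b * prob A0\<close> small. The greedy estimate is applied to the code length minus
  \<open>b\<close> times the number of visits, again a subadditive process, and the mean number of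
  visits is known exactly.

  The potential stays outside the codes. A lower bound at one point of a ball passes to the supremum
  over the ball at once. For the upper bound the functions \<open>f n\<close> share no modulus of
  continuity, so \<open>f n\<close> is compared with the Birkhoff sum of one fixed
  \<open>f k\<close>.\<close>

locale mpt = prob_space M for M :: "'a measure" +
  fixes T :: "'a \<Rightarrow> 'a"
  assumes T_measurable [measurable]: "T \<in> M \<rightarrow>\<^sub>M M"
    and T_invariant: "distr M M T = M"
begin

lemma funpow_measurable [measurable]: "T ^^ n \<in> M \<rightarrow>\<^sub>M M"
proof (induction n)
  case (Suc n)
  then show ?case
    using measurable_comp[OF Suc T_measurable] by (simp add: comp_def)
qed (simp add: id_def)

lemma funpow_space: "x \<in> space M \<Longrightarrow> (T ^^ n) x \<in> space M"
  using measurable_space[OF funpow_measurable] .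

lemma distr_funpow: "distr M M (T ^^ n) = M"
proof (induction n)
  case 0
  show ?case by (simp add: id_def distr_id)
next
  case (Suc n)
  have "distr M M (T ^^ Suc n) = distr (distr M M (T ^^ n)) M T"
    by (subst distr_distr) (auto simp: comp_def)
  also have "\<dots> = M" unfolding Suc by (rule T_invariant)
  finally show ?case .
qed

lemma integral_funpow:
  fixes u :: "'a \<Rightarrow> real"
  assumes [measurable]: "u \<in> borel_measurable M"
  shows "(\<integral>x. u ((T ^^ n) x) \<partial>M) = (\<integral>x. u x \<partial>M)"
  using integral_distr[of "T ^^ n" M M u] by (simp add: distr_funpow)

lemma prob_funpow:
  assumes [measurable]: "A \<in> sets M"
  shows "prob ((T ^^ n) -` A \<inter> space M) = prob A"
  using measure_distr[of "T ^^ n" M M A] by (simp add: distr_funpow)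

text \<open>Each \<open>g n\<close> is bounded, with a bound that may depend on \<open>n\<close>, so
  all integrals below are finite. The value 0 at index 0 lets the inequality hold for all
  \<open>n\<close> and \<open>m\<close>.\<close>

definition subadd_process :: "(nat \<Rightarrow> 'a \<Rightarrow> real) \<Rightarrow> bool" where
  "subadd_process g \<longleftrightarrow> (\<forall>x. g 0 x = 0) \<and> (\<forall>n. g n \<in> borel_measurable M) \<and>
     (\<forall>n. \<exists>C. \<forall>x\<in>space M. \<bar>g n x\<bar> \<le> C) \<and>
     (\<forall>x\<in>space M. \<forall>n m. g (n + m) x \<le> g n x + g m ((T ^^ n) x))"

lemma subadd_processD:
  assumes "subadd_process g"
  shows "g 0 x = 0" "g n \<in> borel_measurable M" "\<exists>C. \<forall>x\<in>space M. \<bar>g n x\<bar> \<le> C"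
    "x \<in> space M \<Longrightarrow> g (n + m) x \<le> g n x + g m ((T ^^ n) x)"
  using assms unfolding subadd_process_def by auto

lemma subadd_process_bound:
  assumes "subadd_process g"
  obtains C where "C \<ge> 0" "\<And>j x. j \<le> k \<Longrightarrow> x \<in> space M \<Longrightarrow> \<bar>g j x\<bar> \<le> C"
proof -
  obtain B where B: "\<And>n x. x \<in> space M \<Longrightarrow> \<bar>g n x\<bar> \<le> B n"
    using subadd_processD(3)[OF assms] by metis
  show ?thesis
  proof (rule that[of "\<Sum>j\<le>k. \<bar>B j\<bar>"])
    fix j x assume "j \<le> k" "x \<in> space M"
    then have "\<bar>g j x\<bar> \<le> \<bar>B j\<bar>" using B[of x j] by linarith
    also have "\<dots> \<le> (\<Sum>j\<le>k. \<bar>B j\<bar>)"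
      by (rule member_le_sum) (use \<open>j \<le> k\<close> in auto)
    finally show "\<bar>g j x\<bar> \<le> (\<Sum>j\<le>k. \<bar>B j\<bar>)" .
  qed (simp add: sum_nonneg)
qed

lemma bounded_integrable:
  fixes u :: "'a \<Rightarrow> real"
  assumes "u \<in> borel_measurable M" "\<And>x. x \<in> space M \<Longrightarrow> \<bar>u x\<bar> \<le> C"
  shows "integrable M u"
  by (rule integrable_const_bound[of _ C]) (use assms in auto)

lemma subadd_process_integrable: "subadd_process g \<Longrightarrow> integrable M (g n)"
  using subadd_processD(2,3)[of g n] bounded_integrable by blast

lemma orbit_sum_add:
  "(\<Sum>i<n+m. u ((T ^^ i) x)) = (\<Sum>i<n. u ((T ^^ i) x)) + (\<Sum>i<m. u ((T ^^ i) ((T ^^ n) x)))"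
  for u :: "'a \<Rightarrow> real"
proof (induction m)
  case (Suc m)
  have "(T ^^ (n + m)) x = (T ^^ m) ((T ^^ n) x)" by (subst add.commute) (simp add: funpow_add)
  with Suc show ?case by simp
qed simp

lemma subadd_process_birkhoff_sum:
  fixes u :: "'a \<Rightarrow> real"
  assumes [measurable]: "u \<in> borel_measurable M" and "\<And>x. x \<in> space M \<Longrightarrow> \<bar>u x\<bar> \<le> C"
  shows "subadd_process (\<lambda>n x. \<Sum>i<n. u ((T ^^ i) x))"
proof -
  have "\<bar>\<Sum>i<n. u ((T ^^ i) x)\<bar> \<le> real n * C" if "x \<in> space M" for n x
  proof -
    have "\<bar>\<Sum>i<n. u ((T ^^ i) x)\<bar> \<le> (\<Sum>i<n. \<bar>u ((T ^^ i) x)\<bar>)" by (rule sum_abs)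
    also have "\<dots> \<le> (\<Sum>i<n. C)" by (intro sum_mono assms(2) funpow_space that)
    finally show ?thesis by simp
  qed
  then show ?thesis
    unfolding subadd_process_def using orbit_sum_add[of u] by (auto simp del: sum.lessThan_Suc)
qed

lemma subadd_process_add:
  assumes "subadd_process g" "subadd_process h"
  shows "subadd_process (\<lambda>n x. g n x + h n x)"
proof -
  have "\<exists>C. \<forall>x\<in>space M. \<bar>g n x + h n x\<bar> \<le> C" for n
  proof -
    obtain C D where "\<forall>x\<in>space M. \<bar>g n x\<bar> \<le> C" "\<forall>x\<in>space M. \<bar>h n x\<bar> \<le> D"
      using assms[THEN subadd_processD(3), of n] by auto
    then show ?thesis by (intro exI[of _ "C + D"]) (auto intro: order_trans[OF abs_triangle_ineq] add_mono)
  qed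
  then show ?thesis
    using assms unfolding subadd_process_def
    by (auto intro!: borel_measurable_add) (smt (verit, best))
qed

lemma integral_birkhoff_sum:
  fixes u :: "'a \<Rightarrow> real"
  assumes [measurable]: "u \<in> borel_measurable M" and "\<And>x. x \<in> space M \<Longrightarrow> \<bar>u x\<bar> \<le> C"
  shows "(\<integral>x. (\<Sum>i<n. u ((T ^^ i) x)) \<partial>M) = real n * (\<integral>x. u x \<partial>M)"
proof -
  have "integrable M (\<lambda>x. u ((T ^^ i) x))" for i
    by (rule bounded_integrable[where C=C]) (auto intro: assms(2) funpow_space)
  then show ?thesis by (simp add: integral_funpow)
qed

text \<open>Cut the orbit segment of length \<open>N\<close> greedily into stretches on which \<open>g\<close> is small;
  single steps are taken only at visits to \<open>B\<close> and during the last \<open>L\<close> steps.\<close>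

lemma subadd_process_greedy:
  assumes g: "subadd_process g"
    and C: "\<And>x. x \<in> space M \<Longrightarrow> \<bar>g 1 x\<bar> \<le> C" "C \<ge> 0"
    and good: "\<And>x. x \<in> space M \<Longrightarrow> x \<notin> (B :: 'a set) \<Longrightarrow> \<exists>n\<in>{1..L}. g n x \<le> real n * a"
    and x: "x \<in> space M"
  shows "g N x \<le> real N * a + (C + \<bar>a\<bar>) * ((\<Sum>i<N. indicat_real B ((T ^^ i) x)) + real L)"
  using x
proof (induction N arbitrary: x rule: less_induct)
  case (less N)
  have step: "g (Suc n) x \<le> C + g n (T x)" if "x \<in> space M" for n x
    using subadd_processD(4)[OF g that, of 1 n] C(1)[OF that] by simp
  have short: "g n x \<le> real n * C" if "x \<in> space M" for n x
    using that
  proof (induction n arbitrary: x)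
    case (Suc n)
    have "T x \<in> space M" using funpow_space[OF Suc.prems, of 1] by simp
    from Suc.IH[OF this] step[OF Suc.prems, of n] show ?case by (simp add: algebra_simps)
  qed (simp add: subadd_processD(1)[OF g])
  have ind0: "(\<Sum>i<(n::nat). indicat_real B ((T ^^ i) x)) \<ge> 0" for n and x :: 'a by (simp add: sum_nonneg)
  show ?case
  proof (cases "N < Suc L")
    case True
    \<comment> \<open>With at most \<open>L\<close> steps left, each costs at most \<open>C\<close>,
      which exceeds \<open>a\<close> by at most \<open>C + \<bar>a\<bar>\<close>; the summand
      \<open>real L\<close> of the bound pays for them.\<close>
    have "real N * C - real N * a \<le> real N * (C + \<bar>a\<bar>)" by (simp add: algebra_simps abs_if)
    also have "\<dots> \<le> real L * (C + \<bar>a\<bar>)" using True C(2) by (intro mult_right_mono) auto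
    also have "\<dots> \<le> (C + \<bar>a\<bar>) * ((\<Sum>i<N. indicat_real B ((T ^^ i) x)) + real L)"
      using ind0[of x N] C(2) by (simp add: algebra_simps)
    finally show ?thesis using short[OF less.prems, of N] by simp
  next
    case False
    have cut: "(\<Sum>i<N. indicat_real B ((T ^^ i) x)) =
       (\<Sum>i<n. indicat_real B ((T ^^ i) x)) + (\<Sum>i<N-n. indicat_real B ((T ^^ i) ((T ^^ n) x)))"
      if "n \<le> N" for n
      using orbit_sum_add[where u="indicat_real B" and n=n and m="N - n" and x=x] that by simp
    show ?thesis
    proof (cases "x \<in> B")
      case True
      let ?S = "(\<Sum>i<N-1. indicat_real B ((T ^^ i) (T x)))"
      have TX: "T x \<in> space M" using funpow_space[OF less.prems, of 1] by simp
      have "g (N - 1) (T x) \<le> real (N - 1) * a + (C + \<bar>a\<bar>) * (?S + real L)"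
        using False TX by (intro less.IH) auto
      moreover have "(\<Sum>i<N. indicat_real B ((T ^^ i) x)) = 1 + ?S"
        using cut[of 1] True False by (simp add: lessThan_Suc)
      moreover have "g N x \<le> C + g (N - 1) (T x)" using step[OF less.prems, of "N - 1"] False by simp
      moreover have "real (N - 1) = real N - 1" using False by simp
      ultimately show ?thesis by (simp add: algebra_simps abs_if split: if_splits)
    next
      case xB: False
      obtain n where n: "n \<in> {1..L}" "g n x \<le> real n * a" using good[OF less.prems xB] by blast
      let ?y = "(T ^^ n) x"
      let ?S = "(\<Sum>i<N-n. indicat_real B ((T ^^ i) ?y))"
      have "g (N - n) ?y \<le> real (N - n) * a + (C + \<bar>a\<bar>) * (?S + real L)"
        using n False funpow_space[OF less.prems] by (intro less.IH) auto
      moreover have "(\<Sum>i<N. indicat_real B ((T ^^ i) x)) \<ge> ?S"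
        using cut[of n] ind0[of x n] n False by simp
      then have "(C + \<bar>a\<bar>) * (?S + real L) \<le> (C + \<bar>a\<bar>) * ((\<Sum>i<N. indicat_real B ((T ^^ i) x)) + real L)"
        using C(2) by (intro mult_left_mono) auto
      moreover have "g N x \<le> g n x + g (N - n) ?y"
        using subadd_processD(4)[OF g less.prems, of n "N - n"] n False by simp
      moreover have "real (N - n) * a = real N * a - real n * a" using n False by (simp add: of_nat_diff algebra_simps)
      ultimately show ?thesis using n(2) by linarith
    qed
  qed
qed

text \<open>The points without a good stretch of length at most \<open>L\<close> decrease to a null
  set as \<open>L\<close> grows. So \<open>L\<close> can be fixed first such that visits to them
  cost less than \<open>e / 2\<close> per step; a long horizon then absorbs the boundary term of the
  greedy bound, which depends on \<open>L\<close> only.\<close>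

lemma subadd_process_integral_le:
  assumes g: "subadd_process g"
    and ev: "AE x in M. \<exists>n\<ge>1. g n x \<le> real n * a" and e: "e > 0"
  shows "\<exists>N\<ge>1. (\<integral>x. g N x \<partial>M) \<le> real N * (a + e)"
proof -
  note [measurable] = subadd_processD(2)[OF g]
  obtain C where C: "C \<ge> 0" "\<And>j x. j \<le> 1 \<Longrightarrow> x \<in> space M \<Longrightarrow> \<bar>g j x\<bar> \<le> C"
    using subadd_process_bound[OF g, of 1] by blast
  define B where "B L = {x\<in>space M. \<forall>n\<in>{1..L}. \<not> g n x \<le> real n * a}" for L
  have Bm [measurable]: "B L \<in> sets M" for L unfolding B_def by measurable
  have "(\<lambda>L. prob (B L)) \<longlonglongrightarrow> prob (\<Inter>L. B L)"
    by (rule finite_Lim_measure_decseq) (auto simp: decseq_def B_def)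
  moreover have "prob (\<Inter>L. B L) = 0"
  proof -
    have "AE x in M. x \<notin> (\<Inter>L. B L)"
      using ev by eventually_elim (auto simp: B_def, metis atLeastAtMost_iff order_refl)
    then show ?thesis by (subst prob_eq_0) auto
  qed
  ultimately have "(\<lambda>L. (C + \<bar>a\<bar>) * prob (B L)) \<longlonglongrightarrow> (C + \<bar>a\<bar>) * 0" by (intro tendsto_intros) auto
  then have "\<forall>\<^sub>F L in sequentially. (C + \<bar>a\<bar>) * prob (B L) < e / 2" 
    using e by (intro order_tendstoD) auto
  then obtain L where L: "(C + \<bar>a\<bar>) * prob (B L) < e / 2" by (auto simp: eventually_sequentially)
  obtain N :: nat where N: "real N > 2 * (C + \<bar>a\<bar>) * real L / e" using reals_Archimedean2 by blast
  define K where "K = Suc N"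
  have K: "(C + \<bar>a\<bar>) * real L \<le> real K * (e / 2)"
    using N e unfolding K_def by (simp add: field_simps)
  have I: "(\<integral>x. (\<Sum>i<K. indicat_real (B L) ((T ^^ i) x)) \<partial>M) = real K * prob (B L)"
    by (subst integral_birkhoff_sum[where C=1]) (auto simp: indicator_def)
  have ii: "integrable M (\<lambda>x. \<Sum>i<K. indicat_real (B L) ((T ^^ i) x))"
    by (rule subadd_process_integrable[OF subadd_process_birkhoff_sum[where C=1]]) (auto simp: indicator_def)
  have "(\<integral>x. g K x \<partial>M) \<le> (\<integral>x. real K * a + (C + \<bar>a\<bar>) * ((\<Sum>i<K. indicat_real (B L) ((T ^^ i) x)) + real L) \<partial>M)"
  proof (rule integral_mono)
    show "integrable M (g K)" by (rule subadd_process_integrable[OF g])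
    show "integrable M (\<lambda>x. real K * a + (C + \<bar>a\<bar>) * ((\<Sum>i<K. indicat_real (B L) ((T ^^ i) x)) + real L))"
      using ii by (intro Bochner_Integration.integrable_add integrable_mult_right) auto
    fix x assume "x \<in> space M"
    then show "g K x \<le> real K * a + (C + \<bar>a\<bar>) * ((\<Sum>i<K. indicat_real (B L) ((T ^^ i) x)) + real L)"
      by (rule subadd_process_greedy[OF g _ _ _, rotated 3]) (use C in \<open>auto simp: B_def\<close>)
  qed
  also have "\<dots> = real K * a + (C + \<bar>a\<bar>) * (real K * prob (B L) + real L)"
    using ii by (simp add: prob_space I[symmetric])
  also have "\<dots> = real K * (a + (C + \<bar>a\<bar>) * prob (B L)) + (C + \<bar>a\<bar>) * real L" by (simp add: algebra_simps)
  also have "\<dots> \<le> real K * (a + e / 2) + real K * (e / 2)"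
    using L by (intro add_mono K mult_left_mono) auto
  also have "\<dots> = real K * (a + e)" by (simp add: algebra_simps)
  finally show ?thesis by (intro exI[of _ K]) (auto simp: K_def)
qed

text \<open>Cut the orbit at \<open>r\<close>, \<open>r + k\<close>, \<open>r + 2 * k\<close> and so
  on, and sum over the offsets \<open>r < k\<close>: together the blocks start exactly once at each
  time below \<open>q * k\<close>. Head and tail are shorter than \<open>2 * k\<close>, so they cost
  a constant independent of \<open>n\<close> and \<open>x\<close>.\<close>

lemma subadd_process_sum_le:
  assumes g: "subadd_process g" and k: "k \<ge> 1"
  shows "\<exists>C. \<forall>n. \<forall>x\<in>space M. real k * g n x \<le> (\<Sum>j<n. g k ((T ^^ j) x)) + C"
proof -
  obtain D where D: "D \<ge> 0" "\<And>j x. j \<le> 2 * k \<Longrightarrow> x \<in> space M \<Longrightarrow> \<bar>g j x\<bar> \<le> D"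
    using subadd_process_bound[OF g, of "2 * k"] by blast
  note sub = subadd_processD(4)[OF g]
  have mult: "g (p * k) y \<le> (\<Sum>i<p. g k ((T ^^ (i * k)) y))" if "y \<in> space M" for p y
  proof (induction p)
    case 0
    show ?case by (simp add: subadd_processD(1)[OF g])
  next
    case (Suc p)
    have "g (Suc p * k) y \<le> g (p * k) y + g k ((T ^^ (p * k)) y)"
      using sub[OF that, of "p * k" k] by (simp add: add.commute)
    with Suc show ?case by simp
  qed
  have "real k * g n x \<le> (\<Sum>j<n. g k ((T ^^ j) x)) + 4 * real k * D" if x: "x \<in> space M" for n x
  proof (cases "n < k")
    case True
    have "g n x \<le> D" using D(2)[of n x] x True by auto
    then have "real k * g n x \<le> real k * D" by (intro mult_left_mono) auto
    moreover have "(\<Sum>j<n. g k ((T ^^ j) x)) \<ge> - (real k * D)"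
    proof -
      have "(\<Sum>j<n. g k ((T ^^ j) x)) \<ge> (\<Sum>j<n. - D)"
        using D(2)[of k] funpow_space[OF x] by (intro sum_mono) (auto simp: abs_le_iff minus_le_iff)
      moreover have "real n * D \<le> real k * D" using True D(1) by (intro mult_right_mono) auto
      ultimately show ?thesis by simp
    qed
    moreover have "real k * D \<ge> 0" using D(1) by simp
    ultimately show ?thesis by linarith
  next
    case False
    \<comment> \<open>One full block is given up so that every offset \<open>r < k\<close> leaves
      room for the same number \<open>q\<close> of blocks, followed by a tail of length
      \<open>k - r + s\<close>.\<close>
    define q where "q = n div k - 1"
    define s where "s = n mod k"
    have n: "n = q * k + k + s"
    proof -
      have "n div k \<ge> 1" using False k by (simp add: div_greater_zero_iff Suc_le_eq)
      then have "n = Suc q * k + s" using div_mult_mod_eq[of n k] by (simp add: q_def s_def)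
      then show ?thesis by simp
    qed
    have s: "s < k" using k by (simp add: s_def)
    have "g n x \<le> 2 * D + (\<Sum>i<q. g k ((T ^^ (i * k + r)) x))" if r: "r < k" for r
    proof -
      let ?y = "(T ^^ r) x"
      let ?z = "(T ^^ (q * k)) ?y"
      have y: "?y \<in> space M" "?z \<in> space M" by (auto intro: funpow_space x)
      have "g n x \<le> g r x + g (q * k + (k - r + s)) ?y"
        using sub[OF x, of r "q * k + (k - r + s)"] r unfolding n by (simp add: algebra_simps)
      moreover have "g (q * k + (k - r + s)) ?y \<le> g (q * k) ?y + g (k - r + s) ?z"
        by (rule sub[OF y(1)])
      moreover have "\<bar>g r x\<bar> \<le> D" "\<bar>g (k - r + s) ?z\<bar> \<le> D"
        using r s by (intro D(2) x y; linarith)+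
      moreover have "g (q * k) ?y \<le> (\<Sum>i<q. g k ((T ^^ (i * k + r)) x))"
        using mult[OF y(1), of q] by (simp add: funpow_add)
      ultimately show ?thesis by linarith
    qed
    then have "(\<Sum>r<k. g n x) \<le> (\<Sum>r<k. 2 * D + (\<Sum>i<q. g k ((T ^^ (i * k + r)) x)))"
      by (intro sum_mono) auto
    also have "\<dots> = 2 * real k * D + (\<Sum>i<q. \<Sum>r<k. g k ((T ^^ (i * k + r)) x))"
      using sum.swap[of "\<lambda>r i. g k ((T ^^ (i * k + r)) x)" "{..<q}" "{..<k}"] by (simp add: sum.distrib)
    also have "(\<Sum>i<q. \<Sum>r<k. g k ((T ^^ (i * k + r)) x)) = (\<Sum>j<q * k. g k ((T ^^ j) x))"
    proof -
      have "(\<Sum>r<k. g k ((T ^^ (i * k + r)) x)) = sum (\<lambda>j. g k ((T ^^ j) x)) {i * k..<i * k + k}" for i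
        using sum.shift_bounds_nat_ivl[of "\<lambda>j. g k ((T ^^ j) x)" 0 "i * k" k]
        by (simp add: atLeast0LessThan add.commute)
      then show ?thesis by (simp add: sum.nat_group)
    qed
    finally have 1: "real k * g n x \<le> 2 * real k * D + (\<Sum>j<q * k. g k ((T ^^ j) x))" by simp
    have "(\<Sum>j<n. g k ((T ^^ j) x)) = (\<Sum>j<q * k. g k ((T ^^ j) x)) +
        (\<Sum>j<k + s. g k ((T ^^ j) ((T ^^ (q * k)) x)))"
      using orbit_sum_add[where u="g k" and n="q * k" and m="k + s" and x=x] by (simp add: n add.assoc)
    moreover have "(\<Sum>j<k + s. g k ((T ^^ j) ((T ^^ (q * k)) x))) \<ge> (\<Sum>j<k + s. - D)"
      using D(2)[of k] funpow_space[OF funpow_space[OF x]]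
      by (intro sum_mono) (auto simp: abs_le_iff minus_le_iff)
    moreover have "real (k + s) * D \<le> (2 * real k) * D"
      using D(1) s by (intro mult_right_mono) auto
    ultimately show ?thesis using 1 by simp
  qed
  then show ?thesis by blast
qed

lemma subadd_process_integral_sum_le:
  assumes g: "subadd_process g" and k: "k \<ge> 1"
  shows "\<exists>C. \<forall>n. real k * (\<integral>x. g n x \<partial>M) \<le> real n * (\<integral>x. g k x \<partial>M) + C"
proof -
  note [measurable] = subadd_processD(2)[OF g]
  obtain C where C: "\<And>n x. x \<in> space M \<Longrightarrow> real k * g n x \<le> (\<Sum>j<n. g k ((T ^^ j) x)) + C"
    using subadd_process_sum_le[OF assms] by blast
  obtain D where D: "\<And>x. x \<in> space M \<Longrightarrow> \<bar>g k x\<bar> \<le> D" using subadd_processD(3)[OF g] by blast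
  have "real k * (\<integral>x. g n x \<partial>M) \<le> real n * (\<integral>x. g k x \<partial>M) + C" for n
  proof -
    have i: "integrable M (\<lambda>x. \<Sum>j<n. g k ((T ^^ j) x))"
      by (rule subadd_process_integrable[OF subadd_process_birkhoff_sum[where C=D]]) (auto intro: D)
    have "(\<integral>x. real k * g n x \<partial>M) \<le> (\<integral>x. (\<Sum>j<n. g k ((T ^^ j) x)) + C \<partial>M)"
      by (rule integral_mono) (use i C in \<open>auto intro!: integrable_mult_right subadd_process_integrable[OF g]\<close>)
    also have "\<dots> = (\<integral>x. (\<Sum>j<n. g k ((T ^^ j) x)) \<partial>M) + C"
      using i by (simp add: prob_space)
    also have "(\<integral>x. (\<Sum>j<n. g k ((T ^^ j) x)) \<partial>M) = real n * (\<integral>x. g k x \<partial>M)"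
      by (rule integral_birkhoff_sum[where C=D]) (auto intro: D)
    finally show ?thesis by simp
  qed
  then show ?thesis by blast
qed

end

section \<open>Ergodic maps: the theorems of Birkhoff and Kingman\<close>

locale ergodic_mpt = mpt +
  assumes ergodic: "\<And>A. A \<in> sets M \<Longrightarrow> T -` A \<inter> space M = A \<Longrightarrow> prob A = 0 \<or> prob A = 1"
begin

text \<open>The preimages of \<open>A\<close> under the iterates decrease and all have the measure
  of \<open>A\<close>, so their intersection is strictly invariant and has the same measure.\<close>

lemma ergodic_sub_invariant:
  assumes A [measurable]: "A \<in> sets M" and sub: "T -` A \<inter> space M \<subseteq> A"
  shows "prob A = 0 \<or> prob A = 1"
proof -
  define B where "B n = (T ^^ n) -` A \<inter> space M" for n
  have [measurable]: "B n \<in> sets M" for n unfolding B_def by measurable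
  have dec: "B (Suc n) \<subseteq> B n" for n
    using sub funpow_space unfolding B_def by fastforce
  have Tspace: "T x \<in> space M" if "x \<in> space M" for x using funpow_space[OF that, of 1] by simp
  have shift: "T -` B n \<inter> space M = B (Suc n)" for n
    unfolding B_def using Tspace by (auto simp: funpow_swap1)
  have "T -` (\<Inter>n. B n) \<inter> space M = (\<Inter>n. B (Suc n))"
    using shift by blast
  also have "\<dots> = (\<Inter>n. B n)"
  proof
    show "(\<Inter>n. B (Suc n)) \<subseteq> (\<Inter>n. B n)" using dec by blast
  qed blast
  finally have "prob (\<Inter>n. B n) = 0 \<or> prob (\<Inter>n. B n) = 1"
    by (intro ergodic) auto
  moreover have "(\<lambda>n. prob (B n)) \<longlonglongrightarrow> prob (\<Inter>n. B n)"
    by (rule finite_Lim_measure_decseq) (auto intro!: decseq_SucI dec)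
  then have "prob (\<Inter>n. B n) = prob A"
    by (simp add: B_def prob_funpow LIMSEQ_const_iff)
  ultimately show ?thesis by simp
qed

text \<open>If the lower growth rate were too small on a set of positive measure, it would be so
  almost everywhere, and the greedy estimate would produce an integral below the assumed bound.
  Subadditivity yields only one inclusion between the exceptional set and its preimage, hence the
  one-sided form of ergodicity above.\<close>

lemma eventually_subadd_process_ge:
  assumes g: "subadd_process g" and c: "\<And>n. n \<ge> 1 \<Longrightarrow> real n * c \<le> (\<integral>x. g n x \<partial>M)" and a: "a < c"
  shows "AE x in M. \<forall>\<^sub>F n in sequentially. real n * a \<le> g n x"
proof -
  note [measurable] = subadd_processD(2)[OF g]
  define c' where "c' = (a + c) / 2"
  have c': "a < c'" "c' < c" using a by (auto simp: c'_def)
  \<comment> \<open>\<open>A\<close> is the set where the lower limit of \<open>g n x / n\<close> is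
    below \<open>c'\<close>, with the strict inequality spelled out by the thresholds
    \<open>c' - 1 / (j + 1)\<close>.\<close>
  define A where "A = {x\<in>space M. \<exists>j::nat. \<forall>m. \<exists>n\<ge>m. g n x < real n * (c' - 1 / real (Suc j))}"
  have [measurable]: "A \<in> sets M" unfolding A_def by measurable
  obtain C where C: "C \<ge> 0" "\<And>j x. j \<le> 1 \<Longrightarrow> x \<in> space M \<Longrightarrow> \<bar>g j x\<bar> \<le> C"
    using subadd_process_bound[OF g, of 1] by blast
  have sub: "T -` A \<inter> space M \<subseteq> A"
  proof
    fix x assume "x \<in> T -` A \<inter> space M"
    then have x: "x \<in> space M" "T x \<in> A" by auto
    obtain j :: nat where j: "\<And>m. \<exists>n\<ge>m. g n (T x) < real n * (c' - 1 / real (Suc j))"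
      using x(2) by (auto simp: A_def)
    \<comment> \<open>Prepending one step costs at most \<open>C\<close>; the gap between
      consecutive thresholds absorbs it for large \<open>n\<close>.\<close>
    let ?e = "c' - 1 / real (Suc j)" and ?e' = "c' - 1 / real (Suc (Suc j))"
    have e: "?e < ?e'" by (simp add: field_simps)
    have "\<exists>n\<ge>m. g n x < real n * ?e'" for m
    proof -
      obtain K :: nat where K: "real K > (C + \<bar>?e'\<bar>) / (?e' - ?e)" using reals_Archimedean2 by blast
      obtain n where n: "n \<ge> max m K" "g n (T x) < real n * ?e" using j[of "max m K"] by blast
      have "(C + \<bar>?e'\<bar>) < real K * (?e' - ?e)" using K e by (simp add: pos_divide_less_eq)
      also have "\<dots> \<le> real n * (?e' - ?e)" using n e by (intro mult_right_mono) auto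
      finally have "C + \<bar>?e'\<bar> < real n * ?e' - real n * ?e" by (simp add: algebra_simps)
      moreover have "g (Suc n) x \<le> C + g n (T x)"
        using subadd_processD(4)[OF g x(1), of 1 n] C(2)[of 1 x] x by simp
      moreover have "real (Suc n) * ?e' = real n * ?e' + ?e'"
        unfolding of_nat_Suc[of n] distrib_right[of 1] mult_1_left by (rule add.commute)
      ultimately have "g (Suc n) x < real (Suc n) * ?e'" using n(2) by linarith
      then show ?thesis using n by (intro exI[of _ "Suc n"]) auto
    qed
    then show "x \<in> A" using x unfolding A_def by blast
  qed
  then consider "prob A = 0" | "prob A = 1" using ergodic_sub_invariant[OF _ sub] by auto
  then show ?thesis
  proof cases
    case 1
    obtain j :: nat where j: "1 / (c' - a) < real j" using reals_Archimedean2 by blast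
    then have "1 / (c' - a) < real (Suc j)" using of_nat_Suc[of j, where ?'a=real] by linarith
    then have "1 < (c' - a) * real (Suc j)" using c' pos_divide_less_eq[of "c' - a" 1 "real (Suc j)"] by (simp only: diff_gt_0_iff_gt mult.commute)
    then have "1 / real (Suc j) \<le> c' - a" by (subst pos_divide_le_eq) auto
    then have j: "a \<le> c' - 1 / real (Suc j)" by linarith
    have "AE x in M. x \<notin> A" using 1 prob_eq_0[of A] by simp
    with AE_space show ?thesis
    proof eventually_elim
      fix x assume "x \<in> space M" "x \<notin> A"
      then obtain m where m: "\<And>n. n \<ge> m \<Longrightarrow> real n * (c' - 1 / real (Suc j)) \<le> g n x"
        unfolding A_def by (auto simp: not_less)
      have "real n * a \<le> g n x" if "n \<ge> m" for n
        using m[OF that] mult_left_mono[OF j, of "real n"] by linarith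
      then show "\<forall>\<^sub>F n in sequentially. real n * a \<le> g n x" by (auto simp: eventually_sequentially)
    qed
  next
    case 2
    have "AE x in M. x \<in> A" using 2 prob_eq_1[of A] by simp
    then have "AE x in M. \<exists>n\<ge>1. g n x \<le> real n * c'"
    proof eventually_elim
      fix x assume "x \<in> A"
      then obtain j n where n: "n \<ge> 1" "g n x < real n * (c' - 1 / real (Suc j))"
        unfolding A_def by blast
      have "real n * (c' - 1 / real (Suc j)) \<le> real n * c'" by (intro mult_left_mono) auto
      then have "g n x \<le> real n * c'" using n(2) by linarith
      then show "\<exists>n\<ge>1. g n x \<le> real n * c'" using n(1) by blast
    qed
    \<comment> \<open>The greedy estimate gives a mean rate of at most \<open>(c' + c) / 2\<close>,
      which is below \<open>c\<close>.\<close>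
    from subadd_process_integral_le[OF g this, of "(c - c') / 2"] c'
    obtain N where N: "N \<ge> 1" "(\<integral>x. g N x \<partial>M) \<le> real N * (c' + (c - c') / 2)" by auto
    then have "real N * c \<le> real N * (c' + (c - c') / 2)" using c[OF N(1)] by linarith
    then have "c \<le> c' + (c - c') / 2" using N(1) by simp
    then show ?thesis using c' by (simp add: field_simps)
  qed
qed

text \<open>This is the preceding lower bound for \<open>- u\<close>: its Birkhoff sums are
  additive, so their means are exactly \<open>n\<close> times the mean of
  \<open>- u\<close>.\<close>

lemma eventually_birkhoff_sum_le:
  assumes [measurable]: "u \<in> borel_measurable M" and C: "\<And>x. x \<in> space M \<Longrightarrow> \<bar>u x\<bar> \<le> C"
    and b: "(\<integral>x. u x \<partial>M) < b"
  shows "AE x in M. \<forall>\<^sub>F n in sequentially. (\<Sum>i<n. u ((T ^^ i) x)) \<le> real n * b"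
proof -
  have "AE x in M. \<forall>\<^sub>F n in sequentially. real n * (-b) \<le> (\<Sum>i<n. - u ((T ^^ i) x))"
  proof (rule eventually_subadd_process_ge)
    show "subadd_process (\<lambda>n x. \<Sum>i<n. - u ((T ^^ i) x))"
      by (rule subadd_process_birkhoff_sum[where C=C]) (auto intro: C)
    show "- b < - (\<integral>x. u x \<partial>M)" using b by simp
    show "real n * - (\<integral>x. u x \<partial>M) \<le> (\<integral>x. (\<Sum>i<n. - u ((T ^^ i) x)) \<partial>M)" for n
      using integral_birkhoff_sum[of "\<lambda>x. - u x" C n] C by simp
  qed
  then show ?thesis by (simp add: sum_negf)
qed

text \<open>One length \<open>k\<close> with a small mean suffices: up to a constant,
  \<open>k * g n\<close> lies below the Birkhoff sum of \<open>g k\<close>.\<close>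

lemma eventually_subadd_process_le:
  assumes g: "subadd_process g" and k: "k \<ge> 1" and b: "(\<integral>x. g k x \<partial>M) < real k * b"
  shows "AE x in M. \<forall>\<^sub>F n in sequentially. g n x \<le> real n * b"
proof -
  note [measurable] = subadd_processD(2)[OF g]
  obtain C where C: "\<And>n x. x \<in> space M \<Longrightarrow> real k * g n x \<le> (\<Sum>j<n. g k ((T ^^ j) x)) + C"
    using subadd_process_sum_le[OF g k] by blast
  obtain D where D: "\<And>x. x \<in> space M \<Longrightarrow> \<bar>g k x\<bar> \<le> D" using subadd_processD(3)[OF g] by blast
  obtain b' where b': "(\<integral>x. g k x \<partial>M) < b'" "b' < real k * b" using dense[OF b] by blast
  obtain K :: nat where K: "real K > C / (real k * b - b')" using reals_Archimedean2 by blast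
  have "AE x in M. \<forall>\<^sub>F n in sequentially. (\<Sum>i<n. g k ((T ^^ i) x)) \<le> real n * b'"
    by (rule eventually_birkhoff_sum_le[where C=D]) (use b' D in auto)
  with AE_space show ?thesis
  proof eventually_elim
    fix x assume x: "x \<in> space M"
      and ev: "\<forall>\<^sub>F n in sequentially. (\<Sum>i<n. g k ((T ^^ i) x)) \<le> real n * b'"
    show "\<forall>\<^sub>F n in sequentially. g n x \<le> real n * b"
      using ev eventually_ge_at_top[of K]
    proof eventually_elim
      case (elim n)
      have "C \<le> real K * (real k * b - b')" using K b'(2) by (simp add: field_simps)
      also have "\<dots> \<le> real n * (real k * b - b')" using elim(2) b'(2) by (intro mult_right_mono) auto
      finally have "C + real n * b' \<le> real k * (real n * b)" by (simp add: algebra_simps)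
      then have "real k * g n x \<le> real k * (real n * b)" using C[OF x, of n] elim(1) by linarith
      then show ?case using k by simp
    qed
  qed
qed

end

section \<open>Codes for itineraries and entropy\<close>

definition words :: "'b set \<Rightarrow> nat \<Rightarrow> 'b list set" where
  "words P n = {w. set w \<subseteq> P \<and> length w = n}"

lemma finite_words: "finite P \<Longrightarrow> finite (words P n)"
  unfolding words_def by (rule finite_lists_length_eq)

lemma words_0 [simp]: "words P 0 = {[]}"
  by (auto simp: words_def)

lemma sum_words_append:
  "(\<Sum>w\<in>words P (n + m). F (take n w) (drop n w)) = (\<Sum>u\<in>words P n. \<Sum>v\<in>words P m. F u v)"
  unfolding sum.cartesian_product
  by (rule sum.reindex_bij_witness[of _ "\<lambda>(u, v). u @ v" "\<lambda>w. (take n w, drop n w)"])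
    (auto simp: words_def dest: in_set_takeD in_set_dropD)

lemma sum_words_1: "(\<Sum>u\<in>words P (Suc 0). F u) = (\<Sum>a\<in>P. F [a])"
  by (rule sum.reindex_bij_witness[of _ "\<lambda>a. [a]" hd]) (auto simp: words_def length_Suc_conv)

text \<open>Independent letters with position-dependent laws. The dependence on the position is
  there because the laws will be predictions read off along the orbit of a ball's centre.\<close>

lemma sum_words_prod_le_1:
  fixes v :: "nat \<Rightarrow> 'b \<Rightarrow> real"
  assumes "\<And>t a. 0 \<le> v t a" "\<And>t. (\<Sum>a\<in>P. v t a) \<le> 1"
  shows "(\<Sum>u\<in>words P n. \<Prod>t<n. v t (u ! t)) \<le> 1"
  using assms
proof (induction n arbitrary: v)
  case (Suc n)
  have "(\<Sum>u\<in>words P (1 + n). \<Prod>t<Suc n. v t (u ! t)) =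
      (\<Sum>u\<in>words P (1 + n). v 0 (take 1 u ! 0) * (\<Prod>t<n. v (Suc t) (drop 1 u ! t)))"
    by (intro sum.cong refl) (simp add: prod.lessThan_Suc_shift words_def del: prod.lessThan_Suc)
  also have "\<dots> = (\<Sum>a\<in>P. v 0 a * (\<Sum>u\<in>words P n. \<Prod>t<n. v (Suc t) (u ! t)))"
    by (subst sum_words_append) (simp add: sum_words_1 sum_distrib_left)
  also have "\<dots> \<le> (\<Sum>a\<in>P. v 0 a * 1)"
    by (intro sum_mono mult_left_mono Suc.IH Suc.prems)
  also have "\<dots> \<le> 1" using Suc.prems(2) by simp
  finally show ?case by simp
qed simp

text \<open>The probability that a word arises as a concatenation of independent random blocks with
  law \<open>g\<close>. It is supermultiplicative, hence its negative logarithm along names of orbits is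
  subadditive, and it satisfies Kraft's inequality.\<close>

function renew :: "('b list \<Rightarrow> real) \<Rightarrow> 'b list \<Rightarrow> real" where
  "renew g w = (if w = [] then 1 else \<Sum>n\<in>{1..length w}. g (take n w) * renew g (drop n w))"
  by auto
termination by (relation "Wellfounded.measure (length \<circ> snd)") auto

declare renew.simps [simp del]

lemma renew_Nil [simp]: "renew g [] = 1"
  by (simp add: renew.simps)

lemma renew_nonneg: "(\<And>u. 0 \<le> g u) \<Longrightarrow> 0 \<le> renew g w"
proof (induction w rule: length_induct)
  case (1 w)
  then show ?case by (subst renew.simps) (auto intro!: sum_nonneg mult_nonneg_nonneg)
qed

text \<open>A way to cut \<open>u\<close> into blocks followed by a way to cut \<open>v\<close> is a
  way to cut \<open>u @ v\<close>.\<close>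

lemma renew_append:
  assumes g: "\<And>u. 0 \<le> g u"
  shows "renew g u * renew g v \<le> renew g (u @ v)"
proof (induction u rule: length_induct)
  case (1 u)
  show ?case
  proof (cases "u = []")
    case False
    have "renew g u * renew g v = (\<Sum>n\<in>{1..length u}. g (take n u) * (renew g (drop n u) * renew g v))"
      using False by (subst renew.simps) (simp add: sum_distrib_right mult.assoc)
    also have "\<dots> \<le> (\<Sum>n\<in>{1..length u}. g (take n (u @ v)) * renew g (drop n (u @ v)))"
      using 1 False g by (intro sum_mono) (auto intro!: mult_left_mono)
    also have "\<dots> \<le> (\<Sum>n\<in>{1..length (u @ v)}. g (take n (u @ v)) * renew g (drop n (u @ v)))"
      by (intro sum_mono2) (auto intro!: mult_nonneg_nonneg g renew_nonneg)
    also have "\<dots> = renew g (u @ v)" using False by (subst (2) renew.simps) simp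
    finally show ?thesis .
  qed simp
qed

lemma renew_ge:
  assumes g: "\<And>u. 0 \<le> g u" and w: "w \<noteq> []"
  shows "g w \<le> renew g w"
proof -
  have "g (take (length w) w) * renew g (drop (length w) w) \<le>
      (\<Sum>n\<in>{1..length w}. g (take n w) * renew g (drop n w))"
    by (rule member_le_sum[of "length w" _ "\<lambda>n. g (take n w) * renew g (drop n w)"])
      (use w in \<open>auto intro!: mult_nonneg_nonneg g renew_nonneg simp: Suc_le_eq\<close>)
  then show ?thesis using w by (subst renew.simps) simp
qed

text \<open>The left side is the probability that \<open>N\<close> is a renewal time when block
  lengths are drawn according to \<open>g\<close>. The proof conditions on the first block.\<close>

lemma sum_renew_le_1:
  assumes g: "\<And>u. 0 \<le> g u" and sum: "\<And>N. (\<Sum>n\<in>{1..N}. \<Sum>u\<in>words P n. g u) \<le> 1"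
  shows "(\<Sum>w\<in>words P N. renew g w) \<le> 1"
proof (induction N rule: less_induct)
  case (less N)
  show ?case
  proof (cases "N = 0")
    case False
    have "(\<Sum>w\<in>words P N. renew g w) =
        (\<Sum>w\<in>words P N. \<Sum>n\<in>{1..N}. g (take n w) * renew g (drop n w))"
      using False by (intro sum.cong refl) (subst renew.simps, auto simp: words_def)
    also have "\<dots> = (\<Sum>n\<in>{1..N}. \<Sum>w\<in>words P (n + (N - n)). g (take n w) * renew g (drop n w))"
      by (subst sum.swap) simp
    also have "\<dots> = (\<Sum>n\<in>{1..N}. \<Sum>u\<in>words P n. g u * (\<Sum>v\<in>words P (N - n). renew g v))"
      by (subst sum_words_append) (simp add: sum_distrib_left)
    also have "\<dots> \<le> (\<Sum>n\<in>{1..N}. \<Sum>u\<in>words P n. g u * 1)"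
      using less by (intro sum_mono mult_left_mono g) auto
    also have "\<dots> \<le> 1" using sum by simp
    finally show ?thesis .
  qed simp
qed

text \<open>Positive mass on single letters gives every word over \<open>P\<close> positive
  probability, so that all code lengths are finite.\<close>

definition block_law :: "'b set \<Rightarrow> ('b list \<Rightarrow> real) \<Rightarrow> bool" where
  "block_law P g \<longleftrightarrow> (\<forall>u. 0 \<le> g u) \<and> (\<forall>N. (\<Sum>n\<in>{1..N}. \<Sum>u\<in>words P n. g u) \<le> 1) \<and>
     (\<forall>a\<in>P. 0 < g [a])"

lemma block_law_renew_pos:
  assumes "block_law P g" "set w \<subseteq> P"
  shows "0 < renew g w"
  using assms(2)
proof (induction w)
  case (Cons a w)
  have g: "\<And>u. 0 \<le> g u" "0 < g [a]" using assms(1) Cons.prems by (auto simp: block_law_def)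
  have "0 < g [a] * renew g w" using g(2) Cons by simp
  also have "\<dots> \<le> renew g [a] * renew g w"
    by (intro mult_right_mono renew_ge renew_nonneg g(1)) simp
  also have "\<dots> \<le> renew g (a # w)" using renew_append[of g "[a]" w] g(1) by simp
  finally show ?case .
qed simp

text \<open>This is \<open>ln t \<le> t - 1\<close> at \<open>t = q / p\<close>. Summed over a
  probability vector \<open>p\<close> and weights \<open>q\<close> of total mass at most 1, it says
  that relative entropy is nonnegative.\<close>

lemma gibbs_term: "p - q \<le> p * (ln p - ln q)" if "p \<ge> 0" "q > 0" for p q :: real
proof (cases "p = 0")
  case False
  then have p: "p > 0" using that by simp
  have "ln q - ln p \<le> q / p - 1" using ln_le_minus_one[of "q / p"] p that by (simp add: ln_div)
  then have "p * (ln q - ln p) \<le> p * (q / p - 1)" using p by (intro mult_left_mono) auto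
  then show ?thesis using p by (simp add: algebra_simps)
qed (use that in simp)

section \<open>Itineraries, cylinders and the entropy of a partition\<close>

locale mpt_partition = mpt +
  fixes P :: "'a set set"
  assumes partition: "meas_partition M P"
begin

lemma finite_P [simp]: "finite P" and P_sets: "A \<in> P \<Longrightarrow> A \<in> sets M"
  and P_disjoint: "A \<in> P \<Longrightarrow> B \<in> P \<Longrightarrow> x \<in> A \<Longrightarrow> x \<in> B \<Longrightarrow> A = B"
  and P_cover: "\<Union>P = space M"
  using partition unfolding meas_partition_def disjoint_def by auto

lemma P_nonempty: "P \<noteq> {}"
  using P_cover not_empty by auto

definition cell :: "'a \<Rightarrow> 'a set" where
  "cell x = (THE A. A \<in> P \<and> x \<in> A)"

lemma cell_eq: "A \<in> P \<Longrightarrow> x \<in> A \<Longrightarrow> cell x = A"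
  unfolding cell_def using P_disjoint by (intro the_equality) auto

lemma cell_in: "x \<in> space M \<Longrightarrow> cell x \<in> P" and in_cell: "x \<in> space M \<Longrightarrow> x \<in> cell x"
  using P_cover cell_eq by (metis UnionE)+

definition itin :: "nat \<Rightarrow> 'a \<Rightarrow> 'a set list" where
  "itin n x = map (\<lambda>i. cell ((T ^^ i) x)) [0..<n]"

lemma length_itin [simp]: "length (itin n x) = n"
  by (simp add: itin_def)

lemma itin_nth: "i < n \<Longrightarrow> itin n x ! i = cell ((T ^^ i) x)"
  by (simp add: itin_def)

lemma itin_words: "x \<in> space M \<Longrightarrow> itin n x \<in> words P n"
  by (auto simp: itin_def words_def intro!: cell_in funpow_space)

lemma itin_add: "itin (n + m) x = itin n x @ itin m ((T ^^ n) x)"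
proof (rule nth_equalityI)
  fix i assume "i < length (itin (n + m) x)"
  then show "itin (n + m) x ! i = (itin n x @ itin m ((T ^^ n) x)) ! i"
    using funpow_add[of "i - n" n T] by (auto simp: nth_append itin_nth not_less)
qed simp

definition cyl :: "'a set list \<Rightarrow> 'a set" where
  "cyl w = {x \<in> space M. itin (length w) x = w}"

lemma cyl_eq:
  assumes "w \<in> words P n"
  shows "cyl w = space M \<inter> (\<Inter>i\<in>{..<n}. (T ^^ i) -` (w ! i))"
proof -
  have w: "length w = n" "\<And>i. i < n \<Longrightarrow> w ! i \<in> P" using assms by (auto simp: words_def)
  have "cell ((T ^^ i) x) = w ! i \<longleftrightarrow> (T ^^ i) x \<in> w ! i" if "x \<in> space M" "i < n" for x i
    using cell_eq[OF w(2)[OF that(2)]] in_cell[OF funpow_space[OF that(1)], of i] by metis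
  then have "itin n x = w \<longleftrightarrow> (\<forall>i<n. (T ^^ i) x \<in> w ! i)" if "x \<in> space M" for x
    unfolding list_eq_iff_nth_eq using w(1) that by (auto simp: itin_nth)
  then show ?thesis using w by (auto simp: cyl_def)
qed

lemma cyl_sets: 
  assumes "w \<in> words P n"
  shows "cyl w \<in> sets M"
proof -
  have "cyl w = {x \<in> space M. \<forall>i\<in>{..<n}. (T ^^ i) x \<in> w ! i}" unfolding cyl_eq[OF assms] by auto
  also have "\<dots> \<in> sets M"
  proof (rule sets.sets_Collect_finite_All)
    fix i assume "i \<in> {..<n}"
    then have "w ! i \<in> sets M" using assms by (intro P_sets) (auto simp: words_def)
    then show "{x \<in> space M. (T ^^ i) x \<in> w ! i} \<in> sets M" by measurable
  qed auto
  finally show ?thesis .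
qed

lemma itin_measurable: "itin n \<in> M \<rightarrow>\<^sub>M count_space (words P n)"
proof (subst measurable_count_space_eq2)
  show "finite (words P n)" by (simp add: finite_words)
  have "itin n -` {w} \<inter> space M = cyl w" if "w \<in> words P n" for w
    using that by (auto simp: cyl_def words_def)
  then show "itin n \<in> space M \<rightarrow> words P n \<and> (\<forall>w\<in>words P n. itin n -` {w} \<inter> space M \<in> sets M)"
    using cyl_sets by (auto intro: itin_words)
qed

lemma itin_function_measurable: "(\<lambda>x. F (itin n x)) \<in> borel_measurable M" for F :: "_ \<Rightarrow> real"
  by (rule measurable_compose[OF itin_measurable]) simp

lemma integral_itin:
  fixes F :: "'a set list \<Rightarrow> real"
  shows "(\<integral>x. F (itin n x) \<partial>M) = (\<Sum>w\<in>words P n. prob (cyl w) * F w)"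
proof -
  have "(\<integral>x. F (itin n x) \<partial>M) = (\<integral>x. (\<Sum>w\<in>words P n. indicat_real (cyl w) x * F w) \<partial>M)"
  proof (rule Bochner_Integration.integral_cong[OF refl])
    fix x assume x: "x \<in> space M"
    have "(\<Sum>w\<in>words P n. indicat_real (cyl w) x * F w) = (\<Sum>w\<in>words P n. if w = itin n x then F w else 0)"
      using x by (intro sum.cong refl) (auto simp: cyl_def words_def)
    then show "F (itin n x) = (\<Sum>w\<in>words P n. indicat_real (cyl w) x * F w)"
      using itin_words[OF x, of n] by (simp add: finite_words)
  qed
  also have "\<dots> = (\<Sum>w\<in>words P n. prob (cyl w) * F w)"
  proof (subst Bochner_Integration.integral_sum)
    fix w assume "w \<in> words P n"
    from cyl_sets[OF this] show "integrable M (\<lambda>x. indicat_real (cyl w) x * F w)"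
      by (intro integrable_mult_left) (simp add: integrable_indicator_iff emeasure_eq_measure)
  qed (auto simp: cyl_sets)
  finally show ?thesis .
qed

lemma sum_prob_cyl: "(\<Sum>w\<in>words P n. prob (cyl w)) = 1"
  using integral_itin[of "\<lambda>_. 1" n] by (simp add: prob_space)

definition Hn :: "nat \<Rightarrow> real" where
  "Hn n = part_entropy M (join_partition M T P n)"

text \<open>Distinct words share a cylinder only if it is empty, and an empty cylinder contributes
  0; so summing over words instead of atoms changes nothing.\<close>

lemma Hn_eq: "Hn n = - (\<Sum>w\<in>words P n. prob (cyl w) * ln (prob (cyl w)))"
proof -
  have "join_partition M T P n = cyl ` words P n"
  proof
    show "join_partition M T P n \<subseteq> cyl ` words P n"
    proof
      fix A assume "A \<in> join_partition M T P n"
      then obtain c where c: "A = space M \<inter> (\<Inter>i\<in>{..<n}. (T ^^ i) -` c i)" "\<forall>i<n. c i \<in> P"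
        by (auto simp: join_partition_def)
      have w: "map c [0..<n] \<in> words P n" using c(2) by (auto simp: words_def)
      have "A = cyl (map c [0..<n])" unfolding cyl_eq[OF w] c(1) by auto
      then show "A \<in> cyl ` words P n" using w by blast
    qed
    show "cyl ` words P n \<subseteq> join_partition M T P n"
    proof
      fix A assume "A \<in> cyl ` words P n"
      then obtain w where w: "w \<in> words P n" "A = cyl w" by auto
      then have "\<forall>i<n. w ! i \<in> P" by (auto simp: words_def)
      then show "A \<in> join_partition M T P n"
        unfolding w(2) cyl_eq[OF w(1)] join_partition_def by blast
    qed
  qed
  moreover have "(\<Sum>A\<in>cyl ` words P n. prob A * ln (prob A)) = (\<Sum>w\<in>words P n. prob (cyl w) * ln (prob (cyl w)))"
  proof (subst sum.reindex_nontrivial)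
    fix v w assume "v \<in> words P n" "w \<in> words P n" "v \<noteq> w" "cyl v = cyl w"
    then have "cyl v = {}" by (auto simp: cyl_def words_def)
    then show "prob (cyl v) * ln (prob (cyl v)) = 0" by simp
  qed (auto simp: finite_words)
  ultimately show ?thesis by (simp add: Hn_def part_entropy_def)
qed

lemma Hn_gibbs:
  assumes "\<And>w. w \<in> words P n \<Longrightarrow> 0 < q w" "(\<Sum>w\<in>words P n. q w) \<le> 1"
  shows "Hn n \<le> (\<integral>x. - ln (q (itin n x)) \<partial>M)"
proof -
  have "0 \<le> (\<Sum>w\<in>words P n. prob (cyl w) - q w)"
    using assms(2) by (simp add: sum_subtractf sum_prob_cyl)
  also have "\<dots> \<le> (\<Sum>w\<in>words P n. prob (cyl w) * (ln (prob (cyl w)) - ln (q w)))"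
    by (intro sum_mono gibbs_term assms(1)) auto
  finally show ?thesis
    unfolding integral_itin[of "\<lambda>w. - ln (q w)"] Hn_eq
    by (simp add: right_diff_distrib sum_subtractf sum_negf)
qed

lemma Hn_nonneg: "0 \<le> Hn n"
proof -
  have "prob (cyl w) * ln (prob (cyl w)) \<le> 0" for w
  proof (cases "prob (cyl w) = 0")
    case False
    then have "0 < prob (cyl w)" by (simp add: zero_less_measure_iff)
    then have "ln (prob (cyl w)) \<le> 0" using ln_mono[of "prob (cyl w)" 1] prob_le_1 by simp
    then show ?thesis by (intro mult_nonneg_nonpos) auto
  qed simp
  then show ?thesis unfolding Hn_eq by (simp add: sum_nonpos)
qed

definition code_length :: "('a set list \<Rightarrow> real) \<Rightarrow> nat \<Rightarrow> 'a \<Rightarrow> real" where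
  "code_length g n x = - ln (renew g (itin n x))"

lemma code_length_process:
  assumes g: "block_law P g"
  shows "subadd_process (code_length g)"
  unfolding subadd_process_def
proof (intro conjI allI ballI)
  show "code_length g 0 x = 0" for x by (simp add: code_length_def itin_def)
  show "code_length g n \<in> borel_measurable M" for n
    unfolding code_length_def[abs_def] by (rule itin_function_measurable)
  show "\<exists>C. \<forall>x\<in>space M. \<bar>code_length g n x\<bar> \<le> C" for n
  proof (intro exI ballI)
    fix x assume "x \<in> space M"
    then show "\<bar>code_length g n x\<bar> \<le> (\<Sum>w\<in>words P n. \<bar>ln (renew g w)\<bar>)"
      unfolding code_length_def abs_minus_cancel
      by (intro member_le_sum itin_words) (auto simp: finite_words)
  qed
  fix x n m assume x: "x \<in> space M"
  have pos: "0 < renew g (itin n x)" "0 < renew g (itin m ((T ^^ n) x))"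
    using itin_words[OF x, of n] itin_words[OF funpow_space[OF x], of m n]
    by (auto intro!: block_law_renew_pos[OF g] simp: words_def)
  have "ln (renew g (itin n x) * renew g (itin m ((T ^^ n) x))) \<le> ln (renew g (itin (n + m) x))"
    using pos g by (intro ln_mono) (auto simp: itin_add block_law_def intro!: renew_append)
  then show "code_length g (n + m) x \<le> code_length g n x + code_length g m ((T ^^ n) x)"
    unfolding code_length_def using pos by (simp add: ln_mult)
qed

lemma Hn_le_code_length:
  assumes g: "block_law P g"
  shows "Hn n \<le> (\<integral>x. code_length g n x \<partial>M)"
  unfolding code_length_def
  by (intro Hn_gibbs sum_renew_le_1 block_law_renew_pos[OF g]) (use g in \<open>auto simp: block_law_def words_def\<close>)

text \<open>A good code at the single length \<open>k\<close> is good at all large lengths: code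
  lengths are subadditive, and \<open>Hn n\<close> lies below their mean.\<close>

lemma Hn_upper:
  assumes g: "block_law P g" and k: "k \<ge> 1" and b: "(\<integral>x. code_length g k x \<partial>M) < real k * b"
  shows "\<forall>\<^sub>F n in sequentially. Hn n / real n \<le> b"
proof -
  obtain C where C: "\<And>n. real k * (\<integral>x. code_length g n x \<partial>M) \<le> real n * (\<integral>x. code_length g k x \<partial>M) + C"
    using subadd_process_integral_sum_le[OF code_length_process[OF g] k] by blast
  let ?d = "real k * b - (\<integral>x. code_length g k x \<partial>M)"
  have d: "?d > 0" using b by simp
  obtain K :: nat where K: "real K > C / ?d" using reals_Archimedean2 by blast
  have "Hn n / real n \<le> b" if "n \<ge> Suc K" for n
  proof -
    have "C \<le> real K * ?d" using K d by (simp add: pos_divide_less_eq)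
    also have "\<dots> \<le> real n * ?d" using that d by (intro mult_right_mono) auto
    finally have "real n * (\<integral>x. code_length g k x \<partial>M) + C \<le> real k * (real n * b)"
      by (simp add: algebra_simps)
    moreover have "real k * Hn n \<le> real k * (\<integral>x. code_length g n x \<partial>M)"
      by (intro mult_left_mono Hn_le_code_length g) auto
    ultimately have "real k * Hn n \<le> real k * (real n * b)" using C[of n] by linarith
    then have "Hn n \<le> b * real n" using k by (simp add: mult.commute)
    then show ?thesis using that by (subst pos_divide_le_eq) auto
  qed
  then show ?thesis by (auto simp: eventually_sequentially)
qed

text \<open>A mixture: with probability \<open>r\<close> a block is one uniformly chosen letter,
  with probability \<open>1 - r\<close> a word of length \<open>k\<close> drawn with the cylinder
  probabilities. The first part secures positivity; for \<open>k = 1\<close> both summands act on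
  the same words.\<close>

definition cyl_law :: "nat \<Rightarrow> real \<Rightarrow> 'a set list \<Rightarrow> real" where
  "cyl_law k r u = (if length u = 1 then r / real (card P) else 0) +
     (if length u = k then (1 - r) * prob (cyl u) else 0)"

lemma cyl_law_block_law:
  assumes k: "k \<ge> 1" and r: "0 < r" "r < 1"
  shows "block_law P (cyl_law k r)"
  unfolding block_law_def
proof (intro conjI allI ballI)
  have cP: "card P > 0" using P_nonempty by (simp add: card_gt_0_iff)
  show "0 \<le> cyl_law k r u" for u using r by (simp add: cyl_law_def)
  show "0 < cyl_law k r [a]" for a using r cP by (auto simp: cyl_law_def intro!: add_pos_nonneg)
  fix N
  have "(\<Sum>u\<in>words P n. cyl_law k r u) = (if n = 1 then r else 0) + (if n = k then 1 - r else 0)" for n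
  proof -
    have "(\<Sum>u\<in>words P n. cyl_law k r u) = (\<Sum>u\<in>words P n. if n = 1 then r / real (card P) else 0) +
       (\<Sum>u\<in>words P n. if n = k then (1 - r) * prob (cyl u) else 0)"
      unfolding sum.distrib[symmetric] by (intro sum.cong refl) (auto simp: cyl_law_def words_def)
    moreover have "(\<Sum>u\<in>words P n. if n = 1 then r / real (card P) else 0) = (if n = 1 then r else 0)"
      using cP sum_words_1[of "\<lambda>_. r / real (card P)" P] by auto
    moreover have "(\<Sum>u\<in>words P n. if n = k then (1 - r) * prob (cyl u) else 0) = (if n = k then 1 - r else 0)"
      by (auto simp: sum_distrib_left[symmetric] sum_prob_cyl)
    ultimately show ?thesis by simp
  qed
  then have "(\<Sum>n\<in>{1..N}. \<Sum>u\<in>words P n. cyl_law k r u) =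
      (\<Sum>n\<in>{1..N}. if n = 1 then r else 0) + (\<Sum>n\<in>{1..N}. if n = k then 1 - r else 0)"
    by (simp add: sum.distrib)
  also have "\<dots> \<le> 1" using r by simp
  finally show "(\<Sum>n\<in>{1..N}. \<Sum>u\<in>words P n. cyl_law k r u) \<le> 1" .
qed

text \<open>An itinerary of length \<open>k\<close> sent as one block costs at most
  \<open>- ln\<close> of its cylinder probability plus the constant
  \<open>- ln (1 - r)\<close>.\<close>

lemma cyl_law_code_length:
  assumes k: "k \<ge> 1" and r: "0 < r" "r < 1"
  shows "(\<integral>x. code_length (cyl_law k r) k x \<partial>M) \<le> Hn k - ln (1 - r)"
proof -
  let ?g = "cyl_law k r"
  have term_le: "prob (cyl w) * - ln (renew ?g w) \<le> prob (cyl w) * (- ln (prob (cyl w)) - ln (1 - r))"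
    if w: "w \<in> words P k" for w
  proof (cases "prob (cyl w) = 0")
    case False
    then have p: "prob (cyl w) > 0" by (simp add: zero_less_measure_iff)
    have "(1 - r) * prob (cyl w) \<le> ?g w" using w r by (simp add: cyl_law_def words_def)
    also have "\<dots> \<le> renew ?g w"
      using cyl_law_block_law[OF assms] w k by (intro renew_ge) (auto simp: block_law_def words_def)
    finally have "ln ((1 - r) * prob (cyl w)) \<le> ln (renew ?g w)"
      using p r by (intro ln_mono) auto
    then have "- ln (renew ?g w) \<le> - ln (prob (cyl w)) - ln (1 - r)" using p r by (simp add: ln_mult)
    then show ?thesis using p by (intro mult_left_mono) auto
  qed simp
  have "(\<integral>x. code_length ?g k x \<partial>M) = (\<Sum>w\<in>words P k. prob (cyl w) * - ln (renew ?g w))"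
    unfolding code_length_def by (rule integral_itin)
  also have "\<dots> \<le> (\<Sum>w\<in>words P k. prob (cyl w) * (- ln (prob (cyl w)) - ln (1 - r)))"
    by (intro sum_mono term_le)
  also have "\<dots> = Hn k - (\<Sum>w\<in>words P k. prob (cyl w)) * ln (1 - r)"
    unfolding Hn_eq by (simp add: right_diff_distrib sum_subtractf sum_negf sum_distrib_right)
  finally show ?thesis by (simp add: sum_prob_cyl)
qed

lemma exists_code:
  assumes k: "k \<ge> 1" and b: "Hn k / real k < b"
  shows "\<exists>g. block_law P g \<and> (\<integral>x. code_length g k x \<partial>M) < real k * b"
proof -
  define e where "e = real k * b - Hn k"
  have e: "e > 0" using b k by (simp add: e_def field_simps)
  \<comment> \<open>The constant \<open>- ln (1 - r)\<close> becomes \<open>e / 2\<close>, half of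
    the available gap.\<close>
  define r where "r = 1 - exp (- e / 2)"
  have r: "0 < r" "r < 1" using e by (auto simp: r_def)
  have "Hn k - ln (1 - r) = Hn k + e / 2" by (simp add: r_def)
  then have "Hn k - ln (1 - r) < real k * b" using e unfolding e_def by argo
  then show ?thesis using cyl_law_block_law[OF k r] cyl_law_code_length[OF k r] by fastforce
qed

text \<open>The limit is the infimum: a nearly optimal code for one \<open>k\<close> bounds
  \<open>Hn n / n\<close> from above for all large \<open>n\<close>. This also shows that the
  \<open>lim\<close> in \<open>entropy_wrt\<close> is a genuine limit.\<close>

lemma Hn_tendsto: "(\<lambda>n. Hn n / real n) \<longlonglongrightarrow> entropy_wrt M T P"
  and entropy_le_Hn: "k \<ge> 1 \<Longrightarrow> entropy_wrt M T P \<le> Hn k / real k"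
proof -
  define L where "L = (INF k\<in>{1..}. Hn k / real k)"
  have bdd: "bdd_below ((\<lambda>k. Hn k / real k) ` {1..})"
    by (rule bdd_belowI2[of _ 0]) (simp add: Hn_nonneg)
  have L: "L \<le> Hn k / real k" if "k \<ge> 1" for k
    unfolding L_def by (rule cINF_lower[OF bdd]) (use that in simp)
  have lim: "(\<lambda>n. Hn n / real n) \<longlonglongrightarrow> L"
  proof (rule order_tendstoI)
    fix a assume "a < L"
    then show "\<forall>\<^sub>F n in sequentially. a < Hn n / real n"
      by (intro eventually_sequentiallyI[of 1] less_le_trans[OF _ L])
  next
    fix b assume "L < b"
    then obtain b' where b': "L < b'" "b' < b" using dense by blast
    then obtain k where k: "k \<ge> 1" "Hn k / real k < b'"
      unfolding L_def using cINF_less_iff[OF _ bdd, of b'] by auto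
    obtain g where "block_law P g" "(\<integral>x. code_length g k x \<partial>M) < real k * b'"
      using exists_code[OF k] by blast
    from Hn_upper[OF this(1) k(1) this(2)]
    show "\<forall>\<^sub>F n in sequentially. Hn n / real n < b"
      by eventually_elim (use b' in simp)
  qed
  then have "entropy_wrt M T P = L" unfolding entropy_wrt_def Hn_def by (rule limI)
  then show "(\<lambda>n. Hn n / real n) \<longlonglongrightarrow> entropy_wrt M T P" "k \<ge> 1 \<Longrightarrow> entropy_wrt M T P \<le> Hn k / real k"
    using lim L by auto
qed

lemma exists_code_entropy:
  assumes b: "entropy_wrt M T P < b"
  shows "\<exists>g k. block_law P g \<and> k \<ge> 1 \<and> (\<integral>x. code_length g k x \<partial>M) < real k * b"
proof -
  have "\<forall>\<^sub>F n in sequentially. Hn n / real n < b \<and> n \<ge> 1"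
    using order_tendstoD(2)[OF Hn_tendsto b] eventually_ge_at_top[of 1] by eventually_elim auto
  then obtain k where "Hn k / real k < b" "k \<ge> 1" by (auto simp: eventually_sequentially)
  then show ?thesis using exists_code by blast
qed

lemma entropy_le_code_length:
  assumes g: "block_law P g" and k: "k \<ge> 1"
  shows "real k * entropy_wrt M T P \<le> (\<integral>x. code_length g k x \<partial>M)"
proof -
  have "real k * entropy_wrt M T P \<le> Hn k"
    using entropy_le_Hn[OF k] k by (simp add: field_simps)
  then show ?thesis using Hn_le_code_length[OF g, of k] by linarith
qed

end

section \<open>Bowen balls in a compact system\<close>

text \<open>Regularity of finite Borel measures, by induction over the sigma-algebra generated by
  the open sets; complements swap the roles of \<open>C\<close> and \<open>U\<close>.\<close>

lemma borel_approx_closed_open: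
  fixes N :: "'a::metric_space measure"
  assumes N: "finite_measure N" and sN: "sets N = sets borel" and B: "B \<in> sets borel" and e: "e > 0"
  shows "\<exists>C U. closed C \<and> open U \<and> C \<subseteq> B \<and> B \<subseteq> U \<and> measure N (U - C) < e"
proof -
  interpret finite_measure N by fact
  have "B \<in> sigma_sets UNIV {S. open S}" using B by (simp add: borel_def)
  then show ?thesis using e
  proof (induction B arbitrary: e)
    case (Basic A)
    then have A: "open A" by simp
    show ?case
    proof (cases "A = UNIV")
      \<comment> \<open>\<open>infdist\<close> to the empty set is 0 by convention, so the whole
        space is treated apart from the exhaustion by distance to the complement.\<close>
      case True
      then show ?thesis using Basic by (intro exI[of _ UNIV]) auto
    next
      case False
      define E where "E n = {x. 1 / real (Suc n) \<le> infdist x (- A)}" for n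
      have sub: "E n \<subseteq> A" for n
      proof
        fix x assume "x \<in> E n"
        then have "infdist x (- A) \<noteq> 0" by (auto simp: E_def)
        then show "x \<in> A" by (meson ComplI infdist_zero)
      qed
      have cl: "closed (E n)" for n unfolding E_def
        by (intro closed_Collect_le continuous_intros)
      have "(\<lambda>n. measure N (A - E n)) \<longlonglongrightarrow> measure N (\<Inter>n. A - E n)"
      proof (rule finite_Lim_measure_decseq)
        show "range (\<lambda>n. A - E n) \<subseteq> sets N" using sN A cl by auto
        show "decseq (\<lambda>n. A - E n)"
          unfolding decseq_def E_def
        proof (intro allI impI subsetI)
          fix m n :: nat and x assume "m \<le> n" "x \<in> A - {x. 1 / real (Suc n) \<le> infdist x (- A)}"
          moreover have "1 / real (Suc n) \<le> 1 / real (Suc m)" using \<open>m \<le> n\<close> by (simp add: frac_le)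
          ultimately show "x \<in> A - {x. 1 / real (Suc m) \<le> infdist x (- A)}" by auto
        qed
      qed
      moreover have empty: "(\<Inter>n. A - E n) = {}"
      proof safe
        fix x assume x: "x \<in> (\<Inter>n. A - E n)"
        then have "x \<in> A" by blast
        then have "infdist x (- A) > 0"
          using in_closed_iff_infdist_zero[of "- A" x] A False infdist_nonneg[of x "- A"]
          by (auto simp: less_le)
        then obtain n where "inverse (real (Suc n)) < infdist x (- A)" using reals_Archimedean by blast
        then have "x \<in> E n" by (simp add: E_def inverse_eq_divide)
        then show "x \<in> {}" using x by blast
      qed
      ultimately have "\<forall>\<^sub>F n in sequentially. measure N (A - E n) < e"
        using Basic.prems unfolding empty by (intro order_tendstoD(2)) auto
      then obtain n where "measure N (A - E n) < e" by (auto simp: eventually_sequentially)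
      then show ?thesis using cl sub A by blast
    qed
  next
    case Empty
    then show ?case by (intro exI[of _ "{}"]) auto
  next
    case (Compl A)
    from Compl.IH[OF Compl.prems] obtain C U
      where "closed C" "open U" "C \<subseteq> A" "A \<subseteq> U" "measure N (U - C) < e" by blast
    moreover have "(- C) - (- U) = U - C" by auto
    ultimately have "closed (- U)" "open (- C)" "- U \<subseteq> UNIV - A" "UNIV - A \<subseteq> - C" "measure N ((- C) - (- U)) < e"
      by auto
    then show ?case by blast
  next
    case (Union A)
    \<comment> \<open>The errors add up to \<open>e / 2\<close>. The union of all \<open>C i\<close>
      need not be closed; the remaining gap to \<open>e\<close> allows stopping after finitely many
      of them.\<close>
    have "\<exists>C U. closed C \<and> open U \<and> C \<subseteq> A i \<and> A i \<subseteq> U \<and> measure N (U - C) < e / 2 * (1/2) ^ Suc i" for i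
      by (rule Union.IH) (use Union.prems in simp)
    then obtain C U where CU: "\<And>i. closed (C i)" "\<And>i. open (U i)" "\<And>i. C i \<subseteq> A i" "\<And>i. A i \<subseteq> U i"
        "\<And>i. measure N (U i - C i) < e / 2 * (1/2) ^ Suc i" by metis
    have [measurable]: "C i \<in> sets N" "U i \<in> sets N" for i using CU sN by auto
    let ?U = "\<Union>i. U i"
    have sums: "(\<lambda>i. e / 2 * (1/2) ^ Suc i) sums (e / 2 * 1)"
      by (intro sums_mult power_half_series)
    have le: "measure N (U i - C i) \<le> e / 2 * (1/2) ^ Suc i" for i
      using CU(5)[of i] by (rule less_imp_le)
    have summ: "summable (\<lambda>i. measure N (U i - C i))"
      by (rule summable_comparison_test'[OF sums_summable[OF sums], of 0])
        (simp only: real_norm_def abs_of_nonneg measure_nonneg le)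
    have "measure N (?U - (\<Union>i. C i)) \<le> measure N (\<Union>i. U i - C i)"
      by (intro finite_measure_mono) auto
    also have "\<dots> \<le> (\<Sum>i. measure N (U i - C i))"
      by (rule finite_measure_subadditive_countably) (use summ in auto)
    also have "\<dots> \<le> (\<Sum>i. e / 2 * (1/2) ^ Suc i)"
      by (rule suminf_le[OF le summ sums_summable[OF sums]])
    also have "\<dots> = e / 2" using sums_unique[OF sums] by simp
    finally have small: "measure N (?U - (\<Union>i. C i)) < e" using Union.prems by simp
    have "(\<lambda>n. measure N (?U - (\<Union>i<n. C i))) \<longlonglongrightarrow> measure N (\<Inter>n. ?U - (\<Union>i<n. C i))"
      by (rule finite_Lim_measure_decseq) (auto simp: decseq_def)
    moreover have "(\<Inter>n. ?U - (\<Union>i<n. C i)) = ?U - (\<Union>i. C i)" by auto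
    ultimately have "\<forall>\<^sub>F n in sequentially. measure N (?U - (\<Union>i<n. C i)) < e"
      using small by (intro order_tendstoD) auto
    then obtain n where n: "measure N (?U - (\<Union>i<n. C i)) < e" by (auto simp: eventually_sequentially)
    show ?case
    proof (intro exI conjI)
      show "closed (\<Union>i<n. C i)" "open ?U" using CU(1,2) by auto
      show "(\<Union>i<n. C i) \<subseteq> \<Union> (range A)" using CU(3) by fast
      show "\<Union> (range A) \<subseteq> ?U" using CU(4) by fast
    qed (rule n)
  qed
qed

section \<open>Invariant measures on a compact metric space\<close>

locale compact_mpt = mpt M T for M :: "'a::metric_space measure" and T +
  fixes X :: "'a set"
  assumes compact_X: "compact X" and T_cont: "continuous_on X T" and T_maps: "T ` X \<subseteq> X"
    and sets_M: "sets M = sets (restrict_space borel X)"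
begin

lemma space_M: "space M = X"
  using sets_eq_imp_space_eq[OF sets_M] by (simp add: space_restrict_space)

lemma X_Int_borel: "B \<in> sets borel \<Longrightarrow> X \<inter> B \<in> sets M"
  unfolding sets_M sets_restrict_space by blast

lemma openin_sets: "openin (top_of_set X) V \<Longrightarrow> V \<in> sets M"
  unfolding openin_open using X_Int_borel by auto

lemma continuous_on_measurable: "continuous_on X u \<Longrightarrow> u \<in> borel_measurable M" for u :: "'a \<Rightarrow> real"
  using borel_measurable_continuous_on_restrict[of X u] unfolding measurable_cong_sets[OF sets_M refl] .

lemma funpow_cont: "continuous_on X (T ^^ n)" and funpow_maps: "x \<in> X \<Longrightarrow> (T ^^ n) x \<in> X"
proof -
  have "continuous_on X (T ^^ n) \<and> (T ^^ n) ` X \<subseteq> X"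
  proof (induction n)
    case (Suc n)
    have "continuous_on X (T \<circ> (T ^^ n))"
      using Suc T_cont by (intro continuous_on_compose) (auto intro: continuous_on_subset)
    then show ?case using Suc T_maps by auto
  qed (auto simp: id_def continuous_on_id)
  then show "continuous_on X (T ^^ n)" "x \<in> X \<Longrightarrow> (T ^^ n) x \<in> X" by auto
qed

lemma inner_regular_compact:
  assumes A: "A \<in> sets M" and e: "e > 0"
  shows "\<exists>C. compact C \<and> C \<subseteq> A \<and> prob (A - C) < e"
proof -
  have id: "(\<lambda>x. x) \<in> M \<rightarrow>\<^sub>M borel"
    unfolding measurable_def using X_Int_borel by (auto simp: space_M Int_commute)
  \<comment> \<open>\<open>M\<close> lives on the subspace \<open>X\<close>; its image under the
    inclusion is a Borel measure on the whole type, to which the approximation applies.\<close>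
  define N where "N = distr M borel (\<lambda>x. x)"
  interpret N: prob_space N unfolding N_def by (rule prob_space_distr[OF id])
  obtain B where B: "B \<in> sets borel" "A = X \<inter> B" using A unfolding sets_M sets_restrict_space by blast
  obtain C U where CU: "closed C" "open U" "C \<subseteq> A" "A \<subseteq> U" "measure N (U - C) < e"
  proof -
    have "A \<in> sets borel" using B compact_imp_closed[OF compact_X] by auto
    then show ?thesis using borel_approx_closed_open[OF N.finite_measure_axioms _ _ e, of A] that
      by (auto simp: N_def)
  qed
  have "prob (A - C) \<le> prob (X \<inter> (U - C))"
    using CU B by (intro finite_measure_mono X_Int_borel) auto
  also have "\<dots> = measure N (U - C)"
    unfolding N_def using CU id by (subst measure_distr) (auto simp: space_M Int_commute)
  finally have "prob (A - C) < e" using CU by simp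
  moreover have "compact C"
  proof -
    have "C = X \<inter> C" using CU B by auto
    then show ?thesis using compact_Int_closed[OF compact_X CU(1)] by simp
  qed
  ultimately show ?thesis using CU by blast
qed

section \<open>Bowen balls and their measures\<close>

abbreviation ball_B :: "nat \<Rightarrow> 'a \<Rightarrow> real \<Rightarrow> 'a set" where
  "ball_B \<equiv> bowen_ball X T"

lemma bowen_ball_openin: "openin (top_of_set X) (ball_B n x e)"
proof (induction n)
  case 0
  show ?case by (simp add: bowen_ball_def)
next
  case (Suc n)
  have "openin (top_of_set X) (X \<inter> (T ^^ n) -` ball ((T ^^ n) x) e)"
    by (rule continuous_openin_preimage_gen[OF funpow_cont]) simp
  with Suc have "openin (top_of_set X) (ball_B n x e \<inter> (X \<inter> (T ^^ n) -` ball ((T ^^ n) x) e))"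
    by (rule openin_Int)
  also have "ball_B n x e \<inter> (X \<inter> (T ^^ n) -` ball ((T ^^ n) x) e) = ball_B (Suc n) x e"
    by (auto simp: bowen_ball_def less_Suc_eq)
  finally show ?case .
qed

lemma bowen_ball_sets [measurable]: "ball_B n x e \<in> sets M"
  by (rule openin_sets[OF bowen_ball_openin])

lemma bowen_ball_self: "x \<in> X \<Longrightarrow> e > 0 \<Longrightarrow> x \<in> ball_B n x e"
  by (simp add: bowen_ball_def)

lemma bowen_ball_triangle: "y \<in> ball_B n x a \<Longrightarrow> z \<in> ball_B n x b \<Longrightarrow> z \<in> ball_B n y (a + b)"
proof -
  assume y: "y \<in> ball_B n x a" and z: "z \<in> ball_B n x b"
  have "dist ((T ^^ i) y) ((T ^^ i) z) < a + b" if "i < n" for i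
  proof -
    have "dist ((T ^^ i) y) ((T ^^ i) z) \<le> dist ((T ^^ i) x) ((T ^^ i) y) + dist ((T ^^ i) x) ((T ^^ i) z)"
      by (metis dist_commute dist_triangle)
    then show ?thesis using y z that by (fastforce simp: bowen_ball_def)
  qed
  then show "z \<in> ball_B n y (a + b)" using z by (simp add: bowen_ball_def)
qed

lemma bowen_ball_mono: "a \<le> b \<Longrightarrow> ball_B n x a \<subseteq> ball_B n x b"
  by (auto simp: bowen_ball_def intro: less_le_trans)

text \<open>A slightly smaller ball around \<open>x\<close> has nearly the same mass and lies inside
  the ball of radius \<open>e\<close> around every point that is Bowen-close to \<open>x\<close>.
  Openness serves to make the set of heavy centres measurable.\<close>

lemma prob_bowen_ball_lsc: "openin (top_of_set X) {x\<in>X. c < prob (ball_B n x e)}"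
proof (subst openin_subopen, intro ballI)
  fix x assume "x \<in> {x\<in>X. c < prob (ball_B n x e)}"
  then have x: "x \<in> X" "c < prob (ball_B n x e)" by auto
  have lim0: "(\<lambda>k. e - 1 / real (Suc k)) \<longlonglongrightarrow> e"
    using tendsto_diff[OF tendsto_const[of e] LIMSEQ_inverse_real_of_nat] by (simp add: inverse_eq_divide)
  have un: "(\<Union>k. ball_B n x (e - 1 / real (Suc k))) = ball_B n x e"
  proof
    show "(\<Union>k. ball_B n x (e - 1 / real (Suc k))) \<subseteq> ball_B n x e"
      by (intro UN_least bowen_ball_mono) simp
    show "ball_B n x e \<subseteq> (\<Union>k. ball_B n x (e - 1 / real (Suc k)))"
    proof
      fix y assume y: "y \<in> ball_B n x e"
      have "\<forall>\<^sub>F k in sequentially. \<forall>i\<in>{..<n}. dist ((T ^^ i) x) ((T ^^ i) y) < e - 1 / real (Suc k)"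
        using y by (intro eventually_ball_finite ballI order_tendstoD(1)[OF lim0]) (auto simp: bowen_ball_def)
      then obtain k where "\<forall>i\<in>{..<n}. dist ((T ^^ i) x) ((T ^^ i) y) < e - 1 / real (Suc k)"
        by (auto simp: eventually_sequentially)
      then show "y \<in> (\<Union>k. ball_B n x (e - 1 / real (Suc k)))" using y by (auto simp: bowen_ball_def)
    qed
  qed
  have "(\<lambda>k. prob (ball_B n x (e - 1 / real (Suc k)))) \<longlonglongrightarrow> prob (\<Union>k. ball_B n x (e - 1 / real (Suc k)))"
  proof (rule finite_Lim_measure_incseq)
    show "incseq (\<lambda>k. ball_B n x (e - 1 / real (Suc k)))"
      unfolding incseq_def by (intro allI impI bowen_ball_mono diff_left_mono frac_le) auto
  qed auto
  then have "\<forall>\<^sub>F k in sequentially. c < prob (ball_B n x (e - 1 / real (Suc k)))"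
    unfolding un using x(2) by (intro order_tendstoD(1))
  then obtain k where k: "c < prob (ball_B n x (e - 1 / real (Suc k)))" by (auto simp: eventually_sequentially)
  show "\<exists>V. openin (top_of_set X) V \<and> x \<in> V \<and> V \<subseteq> {x\<in>X. c < prob (ball_B n x e)}"
  proof (intro exI conjI subsetI)
    show "openin (top_of_set X) (ball_B n x (1 / real (Suc k)))" by (rule bowen_ball_openin)
    show "x \<in> ball_B n x (1 / real (Suc k))" using x by (intro bowen_ball_self) auto
    fix y assume y: "y \<in> ball_B n x (1 / real (Suc k))"
    have "ball_B n x (e - 1 / real (Suc k)) \<subseteq> ball_B n y e"
      using bowen_ball_triangle[OF y] by fastforce
    then have "prob (ball_B n x (e - 1 / real (Suc k))) \<le> prob (ball_B n y e)"
      by (intro finite_measure_mono) auto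
    then show "y \<in> {x\<in>X. c < prob (ball_B n x e)}" using k y by (auto simp: bowen_ball_def)
  qed
qed

text \<open>Disjoint balls of mass above \<open>c\<close> number at most \<open>1 / c\<close>, so a
  family of largest cardinality exists. Any further heavy ball meets one of its members, which puts
  the centre within \<open>2 * e\<close>.\<close>

lemma heavy_ball_separated_cover:
  assumes e: "e > 0" and c: "c > 0"
  shows "\<exists>Y. finite Y \<and> Y \<subseteq> X \<and> real (card Y) * c \<le> 1 \<and>
    (\<forall>x\<in>X. c < prob (ball_B n x e) \<longrightarrow> (\<exists>y\<in>Y. x \<in> ball_B n y (2 * e)))"
proof -
  define S where "S Y \<longleftrightarrow> finite Y \<and> Y \<subseteq> {x\<in>X. c < prob (ball_B n x e)} \<and>
      disjoint_family_on (\<lambda>y. ball_B n y e) Y" for Y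
  have card: "real (card Y) * c \<le> 1" if "S Y" for Y
  proof -
    have "real (card Y) * c = (\<Sum>y\<in>Y. c)" by simp
    also have "\<dots> \<le> (\<Sum>y\<in>Y. prob (ball_B n y e))" using that by (intro sum_mono) (auto simp: S_def)
    also have "\<dots> = prob (\<Union>y\<in>Y. ball_B n y e)"
      using that by (subst finite_measure_finite_Union) (auto simp: S_def)
    also have "\<dots> \<le> 1" by (rule prob_le_1)
    finally show ?thesis .
  qed
  have "S {}" by (simp add: S_def disjoint_family_on_def)
  moreover have "\<forall>Y. S Y \<longrightarrow> card Y < Suc (nat \<lceil>1 / c\<rceil>)"
  proof (intro allI impI)
    fix Y assume "S Y"
    then have "real (card Y) \<le> 1 / c" using card c by (simp add: pos_le_divide_eq)
    then show "card Y < Suc (nat \<lceil>1 / c\<rceil>)" by linarith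
  qed
  ultimately obtain Y where Y: "S Y" and max: "\<And>Z. S Z \<Longrightarrow> card Z \<le> card Y"
    using ex_has_greatest_nat[of S "{}" card] by blast
  have "\<exists>y\<in>Y. x \<in> ball_B n y (2 * e)" if x: "x \<in> X" "c < prob (ball_B n x e)" for x
  proof (rule ccontr)
    assume no: "\<not> ?thesis"
    have disj: "ball_B n x e \<inter> ball_B n y e = {}" if "y \<in> Y" for y
    proof (rule ccontr)
      assume "ball_B n x e \<inter> ball_B n y e \<noteq> {}"
      then obtain z where z: "z \<in> ball_B n x e" "z \<in> ball_B n y e" by auto
      then have "dist ((T ^^ i) y) ((T ^^ i) x) < 2 * e" if "i < n" for i
        using that dist_triangle[of "(T ^^ i) y" "(T ^^ i) x" "(T ^^ i) z"]
        by (fastforce simp: bowen_ball_def dist_commute)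
      then have "x \<in> ball_B n y (2 * e)" using x by (simp add: bowen_ball_def)
      then show False using no that by blast
    qed
    have "x \<notin> Y" using disj[of x] bowen_ball_self[OF x(1) e, of n] by auto
    moreover have "S (insert x Y)"
      using Y x disj unfolding S_def disjoint_family_on_def by (auto simp: Int_commute)
    ultimately show False using max[of "insert x Y"] Y by (simp add: S_def)
  qed
  then show ?thesis using Y card by (intro exI[of _ Y]) (auto simp: S_def)
qed

end

section \<open>A lower bound for the local entropy\<close>

lemma compact_closed_dist_pos:
  fixes S T :: "'a::metric_space set"
  assumes "compact S" "closed T" "S \<inter> T = {}"
  shows "\<exists>d>0. \<forall>x\<in>S. \<forall>y\<in>T. d \<le> dist x y"
proof (cases "S = {} \<or> T = {}")
  case True
  then show ?thesis by (auto intro: exI[of _ 1])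
next
  case False
  moreover have "continuous_on S (\<lambda>x. infdist x T)" by (intro continuous_intros)
  ultimately obtain x0 where x0: "x0 \<in> S" "\<And>x. x \<in> S \<Longrightarrow> infdist x0 T \<le> infdist x T"
    using continuous_attains_inf[OF assms(1), of "\<lambda>x. infdist x T"] by blast
  have "infdist x0 T > 0"
    using in_closed_iff_infdist_zero[OF assms(2), of x0] False x0(1) assms(3) infdist_nonneg[of x0 T]
    by (auto simp: less_le)
  moreover have "infdist x0 T \<le> dist x y" if "x \<in> S" "y \<in> T" for x y
    using x0(2)[OF that(1)] infdist_le[OF that(2), of x] by simp
  ultimately show ?thesis by blast
qed

context compact_mpt
begin

text \<open>Otherwise almost every itinerary has a long initial block that can be described by its
  length \<open>n\<close>, one of at most \<open>exp (n * h')\<close> centres, and the deviations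
  from the cells predicted by that centre. This costs about \<open>n * h'\<close>, and the greedy
  estimate turns such stretches into a code with mean below the entropy.\<close>

lemma local_entropy_lower:
  assumes P: "meas_partition M P" and h: "h' < entropy_wrt M T P"
  shows "\<exists>e>0. \<exists>N. {x\<in>X. \<forall>n\<ge>N. prob (ball_B n x e) \<le> exp (- real n * h')} \<in> sets M \<and>
    prob {x\<in>X. \<forall>n\<ge>N. prob (ball_B n x e) \<le> exp (- real n * h')} > 0"
proof -
  interpret mpt_partition M T P by standard (rule P)
  \<comment> \<open>Of six shares, three pay for the two factors \<open>q ^ n\<close> and the factor
    \<open>cc\<close> in the weight of a block, one for the greedy estimate and one for the visits
    to \<open>A0\<close>; the sixth gives the contradiction.\<close>
  define d where "d = (entropy_wrt M T P - h') / 6"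
  have d: "d > 0" using h by (simp add: d_def)
  define q where "q = exp (- d)"
  have q: "0 < q" "q < 1" using d by (auto simp: q_def)
  define m where "m = real (card P)"
  have m: "m \<ge> 1" using P_nonempty by (simp add: m_def Suc_le_eq card_gt_0_iff)
  \<comment> \<open>\<open>b\<close> is the cost of a mispredicted letter, which gets weight
    \<open>(1 - q) / m\<close>.\<close>
  define b where "b = - ln ((1 - q) / m)"
  have b_exp: "exp (- b) = (1 - q) / m" using q m by (simp add: b_def)
  have b: "b \<ge> 0" unfolding b_def using q m by (auto intro!: ln_le_zero_iff[THEN iffD2] simp: divide_le_eq)

  \<comment> \<open>The allowed loss is spread evenly over the cells so that \<open>b\<close> times
    the total loss is at most \<open>d\<close>.\<close>
  have "\<exists>C. compact C \<and> C \<subseteq> A \<and> prob (A - C) < d / ((b + 1) * m)" if "A \<in> P" for A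
    using inner_regular_compact[OF P_sets[OF that]] d b m by auto
  then obtain K where K: "\<And>A. A \<in> P \<Longrightarrow> compact (K A)" "\<And>A. A \<in> P \<Longrightarrow> K A \<subseteq> A"
      "\<And>A. A \<in> P \<Longrightarrow> prob (A - K A) < d / ((b + 1) * m)" by metis
  have KX: "A \<in> P \<Longrightarrow> K A \<subseteq> X" for A using K(2) P_cover space_M by blast
  have K_sets: "A \<in> P \<Longrightarrow> K A \<in> sets M" for A
    using X_Int_borel[of "K A"] K(1)[of A] KX[of A] by (auto simp: Int_absorb1 borel_compact)
  define A0 where "A0 = X - (\<Union>A\<in>P. K A)"
  have A0 [measurable]: "A0 \<in> sets M"
    unfolding A0_def space_M[symmetric] using K_sets by (intro sets.Diff sets.finite_UN) auto
  have cell_K: "x \<in> K (cell x)" if x: "x \<in> X" "x \<notin> A0" for x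
  proof -
    obtain A where "A \<in> P" "x \<in> K A" using x by (auto simp: A0_def)
    moreover then have "cell x = A" using K(2) by (intro cell_eq) auto
    ultimately show ?thesis by simp
  qed
  have prob_A0: "b * prob A0 \<le> d"
  proof -
    have "A0 \<subseteq> (\<Union>A\<in>P. A - K A)" using P_cover space_M by (fastforce simp: A0_def)
    then have "prob A0 \<le> prob (\<Union>A\<in>P. A - K A)"
      using P_sets K_sets by (intro finite_measure_mono sets.finite_UN) auto
    also have "\<dots> \<le> (\<Sum>A\<in>P. prob (A - K A))"
      using P_sets K_sets by (intro measure_UNION_le) auto
    also have "\<dots> \<le> (\<Sum>A\<in>P. d / ((b + 1) * m))" using K(3) by (intro sum_mono less_imp_le) auto
    also have "\<dots> = d / (b + 1)" using m b by (simp add: m_def[symmetric])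
    finally have "b * prob A0 \<le> b * (d / (b + 1))" using b by (intro mult_left_mono)
    also have "\<dots> \<le> d" using b d by (simp add: field_simps)
    finally show ?thesis .
  qed

  have "\<forall>\<^sub>F r in at_right 0. fst p \<noteq> snd p \<longrightarrow> (\<forall>x\<in>K (fst p). \<forall>y\<in>K (snd p). r \<le> dist x y)"
    if p: "p \<in> P \<times> P" for p
  proof (cases "fst p = snd p")
    case False
    have "K (fst p) \<inter> K (snd p) = {}"
    proof safe
      fix x assume "x \<in> K (fst p)" "x \<in> K (snd p)"
      then show "x \<in> {}" using K(2) p False P_disjoint[of "fst p" "snd p" x] by fastforce
    qed
    moreover have "compact (K (fst p))" "closed (K (snd p))" using K(1) p by (auto intro: compact_imp_closed)
    ultimately obtain r0 where r0: "r0 > 0" "\<And>x y. x \<in> K (fst p) \<Longrightarrow> y \<in> K (snd p) \<Longrightarrow> r0 \<le> dist x y"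
      using compact_closed_dist_pos by metis
    have "\<forall>\<^sub>F r in at_right 0. r \<in> {0<..<r0}" using r0(1) by (rule eventually_at_right_real)
    then show ?thesis
    proof eventually_elim
      case (elim r)
      then show ?case using r0(2) by (auto intro: less_imp_le[THEN order_trans])
    qed
  qed simp
  then have "\<forall>\<^sub>F r in at_right 0. \<forall>p\<in>P \<times> P. fst p \<noteq> snd p \<longrightarrow> (\<forall>x\<in>K (fst p). \<forall>y\<in>K (snd p). r \<le> dist x y)"
    by (intro eventually_ball_finite) auto
  with eventually_at_right_less[of "0::real"]
  have "\<forall>\<^sub>F r in at_right 0. 0 < r \<and> (\<forall>p\<in>P \<times> P. fst p \<noteq> snd p \<longrightarrow> (\<forall>x\<in>K (fst p). \<forall>y\<in>K (snd p). r \<le> dist x y))"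
    by (rule eventually_conj)
  then obtain r where r: "r > 0" "\<forall>p\<in>P \<times> P. fst p \<noteq> snd p \<longrightarrow> (\<forall>x\<in>K (fst p). \<forall>y\<in>K (snd p). r \<le> dist x y)"
    using eventually_happens'[OF trivial_limit_at_right_real] by blast
  \<comment> \<open>Two points of the compact pieces that are within \<open>2 * e\<close> of a
    common point are less than \<open>4 * e = r\<close> apart, hence belong to the same
    cell.\<close>
  define e where "e = r / 4"
  have e: "e > 0" using r(1) by (simp add: e_def)
  have sep: "A = B" if "A \<in> P" "B \<in> P" "x \<in> K A" "y \<in> K B" "dist x y < 4 * e" for A B x y
    using bspec[OF r(2), of "(A, B)"] that by (fastforce simp: e_def)
  \<comment> \<open>\<open>J z\<close> is the cell predicted at \<open>z\<close>: the only one whose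
    compact piece comes within \<open>2 * e\<close> of \<open>z\<close>. If there is none the value
    is arbitrary, which is harmless because \<open>W A\<close> has total mass at most 1 on
    \<open>P\<close> for every \<open>A\<close>.\<close>
  define J where "J z = (SOME A. A \<in> P \<and> (\<exists>z'\<in>K A. dist z z' < 2 * e))" for z
  have J: "J z = A" if A: "A \<in> P" "z' \<in> K A" "dist z z' < 2 * e" for z A z'
  proof -
    have "J z \<in> P \<and> (\<exists>z'\<in>K (J z). dist z z' < 2 * e)"
      unfolding J_def by (rule someI[of _ A]) (use A in blast)
    then obtain z'' where z'': "J z \<in> P" "z'' \<in> K (J z)" "dist z z'' < 2 * e" by blast
    then have "dist z'' z' < 4 * e" using A(3) dist_triangle3[of z'' z' z] by simp
    then show ?thesis using sep z'' A by blast
  qed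

  obtain Y where Y: "\<And>n. finite (Y n)" "\<And>n. real (card (Y n)) * exp (- real n * h') \<le> 1"
      "\<And>n x. x \<in> X \<Longrightarrow> exp (- real n * h') < prob (ball_B n x e) \<Longrightarrow> \<exists>y\<in>Y n. x \<in> ball_B n y (2 * e)"
  proof -
    have "\<forall>n. \<exists>Y. finite Y \<and> Y \<subseteq> X \<and> real (card Y) * exp (- real n * h') \<le> 1 \<and>
        (\<forall>x\<in>X. exp (- real n * h') < prob (ball_B n x e) \<longrightarrow> (\<exists>y\<in>Y. x \<in> ball_B n y (2 * e)))"
      by (intro allI heavy_ball_separated_cover e) simp
    then show ?thesis using that by metis
  qed

  \<comment> \<open>Weight \<open>q\<close> goes to the prediction \<open>A\<close> and the rest is
    spread evenly: a correct letter costs at most \<open>d\<close>, a wrong one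
    \<open>b\<close>.\<close>
  define W where "W A B = (if A = B then q else 0) + (1 - q) / m" for A B :: "'a set"
  have W0: "0 \<le> W A B" for A B using q m by (simp add: W_def)
  have W1: "(\<Sum>B\<in>P. W A B) \<le> 1" for A
  proof -
    have "(\<Sum>B\<in>P. W A B) = (if A \<in> P then q else 0) + (1 - q)"
      using m by (simp add: W_def sum.distrib m_def[symmetric])
    then show ?thesis using q by simp
  qed
  \<comment> \<open>The length weights \<open>cc * q ^ n\<close> sum to at most 1/2; the other half
    goes to single letters.\<close>
  define cc where "cc = (1 - q) / 2"
  have cc: "cc > 0" using q by (simp add: cc_def)
  \<comment> \<open>Apart from the share of single letters, a block is drawn by choosing its length
    \<open>n\<close> with weight \<open>cc * q ^ n\<close>, a centre \<open>y\<close> in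
    \<open>Y n\<close> with weight \<open>exp (- n * h')\<close>, and independent letters around the
    predictions along the orbit of \<open>y\<close>.\<close>
  define g :: "'a set list \<Rightarrow> real" where
    "g u = (if length u = 1 then 1 / (2 * m) else 0) +
       cc * q ^ length u * (exp (- real (length u) * h') * (\<Sum>y\<in>Y (length u). \<Prod>t<length u. W (J ((T ^^ t) y)) (u ! t)))"
    for u
  have g0: "0 \<le> g u" for u
    unfolding g_def using m cc q W0 by (intro add_nonneg_nonneg mult_nonneg_nonneg sum_nonneg prod_nonneg) auto
  have block: "block_law P g"
    unfolding block_law_def
  proof (intro conjI allI ballI g0)
    show "0 < g [a]" for a
      unfolding g_def using m cc q W0
      by (intro add_pos_nonneg mult_nonneg_nonneg sum_nonneg prod_nonneg) auto
    fix N
    have "(\<Sum>u\<in>words P n. g u) \<le> (if n = 1 then 1 / 2 else 0) + cc * q ^ n" for n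
    proof -
      have "(\<Sum>u\<in>words P n. g u) = (\<Sum>u\<in>words P n. if n = 1 then 1 / (2 * m) else 0) +
         (\<Sum>u\<in>words P n. cc * q ^ n * (exp (- real n * h') * (\<Sum>y\<in>Y n. \<Prod>t<n. W (J ((T ^^ t) y)) (u ! t))))"
        unfolding sum.distrib[symmetric] by (intro sum.cong refl) (auto simp: g_def words_def)
      also have "(\<Sum>u\<in>words P n. if n = 1 then 1 / (2 * m) else 0) = (if n = 1 then 1 / 2 else 0)"
        using m sum_words_1[of "\<lambda>_. 1 / (2 * m)" P] by (auto simp: m_def)
      also have "(\<Sum>u\<in>words P n. cc * q ^ n * (exp (- real n * h') * (\<Sum>y\<in>Y n. \<Prod>t<n. W (J ((T ^^ t) y)) (u ! t))))
          = cc * q ^ n * (exp (- real n * h') * (\<Sum>y\<in>Y n. \<Sum>u\<in>words P n. \<Prod>t<n. W (J ((T ^^ t) y)) (u ! t)))"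
        by (subst sum.swap) (simp only: sum_distrib_left)
      also have "\<dots> \<le> cc * q ^ n * (exp (- real n * h') * (\<Sum>y\<in>Y n. 1))"
        using cc q by (intro mult_left_mono sum_mono sum_words_prod_le_1 W0 W1) auto
      also have "\<dots> \<le> cc * q ^ n * 1"
        using Y(2)[of n] cc q by (intro mult_left_mono) (auto simp: mult.commute)
      finally show ?thesis by simp
    qed
    then have "(\<Sum>n\<in>{1..N}. \<Sum>u\<in>words P n. g u) \<le> (\<Sum>n\<in>{1..N}. (if n = 1 then 1 / 2 else 0) + cc * q ^ n)"
      by (intro sum_mono)
    also have "\<dots> = (\<Sum>n\<in>{1..N}. if n = 1 then 1 / 2 else 0) + cc * (\<Sum>n\<in>{1..N}. q ^ n)"
      by (simp add: sum.distrib sum_distrib_left)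
    also have "\<dots> \<le> 1 / 2 + cc * (1 / (1 - q))"
    proof (intro add_mono mult_left_mono)
      show "(\<Sum>n\<in>{1..N}. q ^ n) \<le> 1 / (1 - q)"
        using sum_le_suminf[OF summable_geometric[of q], of "{1..N}"] suminf_geometric[of q] q by simp
    qed (use cc in auto)
    also have "\<dots> = 1" using q by (simp add: cc_def divide_simps)
    finally show "(\<Sum>n\<in>{1..N}. \<Sum>u\<in>words P n. g u) \<le> 1" .
  qed

  \<comment> \<open>For \<open>n \<ge> n0\<close> the constant cost \<open>- ln cc\<close> is at
    most \<open>n * d\<close>.\<close>
  obtain n0 :: nat where n0: "- ln cc / d < real n0" using reals_Archimedean2 by blast
  define N where "N = max 1 n0"
  define Bc where "Bc n = {x\<in>X. exp (- real n * h') < prob (ball_B n x e)}" for n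
  have Bc: "Bc n \<in> sets M" for n unfolding Bc_def by (rule openin_sets[OF prob_bowen_ball_lsc])
  have eq: "{x\<in>X. \<forall>n\<ge>N. prob (ball_B n x e) \<le> exp (- real n * h')} = space M - (\<Union>n\<in>{N..}. Bc n)"
    by (auto simp: Bc_def space_M not_less)
  have meas: "{x\<in>X. \<forall>n\<ge>N. prob (ball_B n x e) \<le> exp (- real n * h')} \<in> sets M"
    unfolding eq using Bc by (intro sets.Diff sets.top sets.countable_UN) auto
  moreover have "prob {x\<in>X. \<forall>n\<ge>N. prob (ball_B n x e) \<le> exp (- real n * h')} \<noteq> 0"
  proof
    assume "prob {x\<in>X. \<forall>n\<ge>N. prob (ball_B n x e) \<le> exp (- real n * h')} = 0"
    then have AE: "AE x in M. \<not> (\<forall>n\<ge>N. prob (ball_B n x e) \<le> exp (- real n * h'))"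
      using prob_eq_0[OF meas] by (auto simp: space_M)
    \<comment> \<open>The price of visits to \<open>A0\<close> is refunded. The refund is not
      controlled along an individual stretch, but its mean over \<open>n\<close> steps is exactly
      \<open>n * b * prob A0\<close>.\<close>
    define f where "f n x = code_length g n x + (\<Sum>i<n. - b * indicat_real A0 ((T ^^ i) x))" for n x
    have bs: "subadd_process (\<lambda>n x. \<Sum>i<n. - b * indicat_real A0 ((T ^^ i) x))"
      by (rule subadd_process_birkhoff_sum[where C=b]) (use b in \<open>auto simp: indicator_def\<close>)
    have f: "subadd_process f"
      unfolding f_def[abs_def] by (intro subadd_process_add code_length_process block bs)
    have "AE x in M. \<exists>n\<ge>1. f n x \<le> real n * (h' + 3 * d)"
      using AE AE_space
    proof eventually_elim
      fix x assume "\<not> (\<forall>n\<ge>N. prob (ball_B n x e) \<le> exp (- real n * h'))" and "x \<in> space M"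
      then obtain n where n: "n \<ge> N" "exp (- real n * h') < prob (ball_B n x e)" and x: "x \<in> X"
        by (auto simp: not_le space_M)
      obtain y where y: "y \<in> Y n" "x \<in> ball_B n y (2 * e)" using Y(3)[OF x n(2)] by blast
      have n1: "n \<ge> 1" using n by (simp add: N_def)
      define s where "s = (\<Sum>t<n. indicat_real A0 ((T ^^ t) x))"
      \<comment> \<open>Off \<open>A0\<close> the prediction from the centre is correct; on
        \<open>A0\<close> at most \<open>b\<close> more is paid.\<close>
      have w: "q * exp (- b * indicat_real A0 ((T ^^ t) x)) \<le> W (J ((T ^^ t) y)) (itin n x ! t)" if t: "t < n" for t
      proof (cases "(T ^^ t) x \<in> A0")
        case True
        have "q * exp (- b) \<le> 1 * exp (- b)" using q by (intro mult_right_mono) auto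
        then show ?thesis using True q by (simp add: W_def b_exp)
      next
        case False
        have TX: "(T ^^ t) x \<in> X" using funpow_maps[OF x] .
        have "J ((T ^^ t) y) = cell ((T ^^ t) x)"
          by (rule J[of _ "(T ^^ t) x"])
            (use cell_in TX cell_K[OF TX False] y(2) t in \<open>auto simp: space_M bowen_ball_def\<close>)
        then show ?thesis using False q m t by (simp add: W_def itin_nth)
      qed
      have "q ^ n * exp (- b * s) = (\<Prod>t<n. q * exp (- b * indicat_real A0 ((T ^^ t) x)))"
        by (simp only: s_def sum_distrib_left exp_sum[OF finite_lessThan] prod.distrib prod_constant card_lessThan)
      also have "\<dots> \<le> (\<Prod>t<n. W (J ((T ^^ t) y)) (itin n x ! t))"
        using w q by (intro prod_mono) auto
      also have "\<dots> \<le> (\<Sum>y\<in>Y n. \<Prod>t<n. W (J ((T ^^ t) y)) (itin n x ! t))"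
        using Y(1) y(1) W0 by (intro member_le_sum[of y _ "\<lambda>y. \<Prod>t<n. W (J ((T ^^ t) y)) (itin n x ! t)"] prod_nonneg) auto
      finally have "cc * q ^ n * (exp (- real n * h') * (q ^ n * exp (- b * s))) \<le>
          cc * q ^ n * (exp (- real n * h') * (\<Sum>y\<in>Y n. \<Prod>t<n. W (J ((T ^^ t) y)) (itin n x ! t)))"
        using cc q by (intro mult_left_mono) auto
      also have "\<dots> \<le> g (itin n x)" using m by (simp add: g_def)
      also have "\<dots> \<le> renew g (itin n x)"
        using n1 by (intro renew_ge g0) (auto simp flip: length_greater_0_conv)
      finally have "ln (cc * q ^ n * (exp (- real n * h') * (q ^ n * exp (- b * s)))) \<le> ln (renew g (itin n x))"
        using cc q by (intro ln_mono) auto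
      moreover have "ln (cc * q ^ n * (exp (- real n * h') * (q ^ n * exp (- b * s)))) =
          ln cc - 2 * (real n * d) - real n * h' - b * s"
        using cc q by (simp add: ln_mult ln_realpow q_def)
      moreover have "- ln cc \<le> real n * d"
      proof -
        have "real n \<ge> real n0" using n(1) by (simp add: N_def)
        then have "- ln cc / d \<le> real n" using n0 by linarith
        then show ?thesis by (rule iffD1[OF pos_divide_le_eq[OF d]])
      qed
      ultimately have "code_length g n x - b * s \<le> real n * (h' + 3 * d)"
        unfolding code_length_def distrib_left by linarith
      moreover have "f n x = code_length g n x - b * s" by (simp add: f_def s_def sum_negf flip: sum_distrib_left)
      ultimately show "\<exists>n\<ge>1. f n x \<le> real n * (h' + 3 * d)" using n1 by auto
    qed
    from subadd_process_integral_le[OF f this d] obtain k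
      where k: "k \<ge> 1" "(\<integral>x. f k x \<partial>M) \<le> real k * (h' + 3 * d + d)" by blast
    have "(\<integral>x. f k x \<partial>M) = (\<integral>x. code_length g k x \<partial>M) + (\<integral>x. (\<Sum>i<k. - b * indicat_real A0 ((T ^^ i) x)) \<partial>M)"
      unfolding f_def
      by (intro Bochner_Integration.integral_add subadd_process_integrable[OF bs]
          subadd_process_integrable[OF code_length_process[OF block]])
    also have "(\<integral>x. (\<Sum>i<k. - b * indicat_real A0 ((T ^^ i) x)) \<partial>M) = real k * (\<integral>x. - b * indicat_real A0 x \<partial>M)"
      by (rule integral_birkhoff_sum[where C=b]) (use b in \<open>auto simp: indicator_def\<close>)
    also have "(\<integral>x. - b * indicat_real A0 x \<partial>M) = - (b * prob A0)" by simp
    finally have "(\<integral>x. f k x \<partial>M) \<ge> real k * entropy_wrt M T P - real k * (b * prob A0)"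
      using entropy_le_code_length[OF block k(1)] by simp
    moreover have "real k * (b * prob A0) \<le> real k * d" using prob_A0 by (intro mult_left_mono) auto
    ultimately have "real k * entropy_wrt M T P \<le> real k * (h' + 5 * d)"
      using k(2) by (simp add: algebra_simps)
    then have "entropy_wrt M T P \<le> h' + 5 * d" using k(1) by simp
    moreover have "6 * d = entropy_wrt M T P - h'" by (simp add: d_def)
    ultimately show False using d by linarith
  qed
  ultimately show ?thesis using e unfolding zero_less_measure_iff by blast
qed

end

section \<open>Pressure estimates\<close>

lemma disjoint_refinement:
  assumes "finite \<U>" "\<U> \<subseteq> sets M"
  shows "\<exists>P. finite P \<and> P \<subseteq> sets M \<and> disjoint P \<and> \<Union>P = \<Union>\<U> \<and> (\<forall>A\<in>P. \<exists>U\<in>\<U>. A \<subseteq> U)"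
  using assms
proof (induction rule: finite_induct)
  case empty
  show ?case by (intro exI[of _ "{}"]) (auto simp: disjoint_def)
next
  case (insert U \<U>)
  then obtain P where P: "finite P" "P \<subseteq> sets M" "disjoint P" "\<Union>P = \<Union>\<U>" "\<forall>A\<in>P. \<exists>U\<in>\<U>. A \<subseteq> U"
    by auto
  show ?case
  proof (intro exI[of _ "insert (U - \<Union>P) P"] conjI)
    have "\<Union>P \<in> sets M" using P by (intro sets.finite_Union) auto
    then show "insert (U - \<Union>P) P \<subseteq> sets M" using P insert.prems by auto
    show "disjoint (insert (U - \<Union>P) P)" using P(3) unfolding disjoint_def by auto
  qed (use P in auto)
qed

context compact_mpt
begin

lemma small_partition:
  assumes e: "e > 0"
  shows "\<exists>P. meas_partition M P \<and> (\<forall>A\<in>P. \<forall>x\<in>A. \<forall>y\<in>A. dist x y < e)"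
proof -
  have "\<exists>K. finite K \<and> K \<subseteq> X \<and> X \<subseteq> (\<Union>x\<in>K. ball x (e / 2))"
    using compactE_image[OF compact_X, of X "\<lambda>x. ball x (e / 2)"] e
    by (metis (no_types, lifting) UN_I centre_in_ball half_gt_zero open_ball subsetI)
  then obtain K where K: "finite K" "X \<subseteq> (\<Union>x\<in>K. ball x (e / 2))" by blast
  let ?U = "(\<lambda>x. X \<inter> ball x (e / 2)) ` K"
  have "?U \<subseteq> sets M" by (auto intro!: X_Int_borel)
  then obtain P where P: "finite P" "P \<subseteq> sets M" "disjoint P" "\<Union>P = \<Union>?U" "\<forall>A\<in>P. \<exists>U\<in>?U. A \<subseteq> U"
    using disjoint_refinement[of ?U M] K(1) by blast
  have "\<Union>?U = X" using K(2) by auto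
  moreover have "dist x y < e" if A: "A \<in> P" "x \<in> A" "y \<in> A" for A x y
  proof -
    obtain z where "A \<subseteq> ball z (e / 2)" using P(5) A(1) by blast
    then have "dist z x < e / 2" "dist z y < e / 2" using A by auto
    then show ?thesis using dist_triangle_half_r by blast
  qed
  ultimately show ?thesis
    using P unfolding meas_partition_def by (intro exI[of _ P]) (auto simp: space_M)
qed

end

section \<open>The growth of the potential and covers of typical points\<close>

locale potential_mpt = compact_mpt M T X + ergodic_mpt M T
  for M :: "'a::metric_space measure" and T X +
  fixes f :: "nat \<Rightarrow> 'a \<Rightarrow> real"
  assumes potential: "subadditive_potential X T f"
    and Fstar_finite: "Fstar M f \<noteq> -\<infinity>"
begin

lemma f_cont: "n \<ge> 1 \<Longrightarrow> continuous_on X (f n)"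
  using potential by (simp add: subadditive_potential_def)

lemma f_bound: "n \<ge> 1 \<Longrightarrow> \<exists>C. \<forall>x\<in>X. \<bar>f n x\<bar> \<le> C"
  using compact_imp_bounded[OF compact_continuous_image[OF f_cont compact_X]]
  by (auto simp: bounded_iff)

text \<open>The potential is constrained only from index 1 on, whereas a subadditive process must
  vanish at index 0.\<close>

definition f0 :: "nat \<Rightarrow> 'a \<Rightarrow> real" where
  "f0 n x = (if n = 0 then 0 else f n x)"

lemma f0_eq: "n \<ge> 1 \<Longrightarrow> f0 n = f n"
  by (auto simp: f0_def fun_eq_iff)

lemma f0_process: "subadd_process f0"
  unfolding subadd_process_def
proof (intro conjI allI ballI)
  show "f0 n \<in> borel_measurable M" for n
    using continuous_on_measurable[OF f_cont, of n] by (cases "n = 0") (auto simp: f0_def[abs_def])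
  show "\<exists>C. \<forall>x\<in>space M. \<bar>f0 n x\<bar> \<le> C" for n
    using f_bound[of n] by (cases "n = 0") (auto simp: f0_def space_M)
  show "f0 (n + m) x \<le> f0 n x + f0 m ((T ^^ n) x)" if "x \<in> space M" for x n m
    using potential that by (auto simp: f0_def subadditive_potential_def space_M)
qed (simp add: f0_def)

definition Fr :: real where "Fr = real_of_ereal (Fstar M f)"

lemma Fstar_eq: "Fstar M f = ereal Fr"
proof -
  have "Fstar M f \<le> ereal (integral\<^sup>L M (f 1) / real 1)"
    unfolding Fstar_def by (intro Inf_lower) blast
  then have "Fstar M f \<noteq> \<infinity>" by auto
  then show ?thesis using Fstar_finite by (cases "Fstar M f") (auto simp: Fr_def)
qed

lemma Fr_le: "n \<ge> 1 \<Longrightarrow> real n * Fr \<le> integral\<^sup>L M (f n)"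
proof -
  assume n: "n \<ge> 1"
  have "Fstar M f \<le> ereal (integral\<^sup>L M (f n) / real n)"
    unfolding Fstar_def by (intro Inf_lower) (use n in blast)
  then show ?thesis using n unfolding Fstar_eq by (simp add: field_simps)
qed

lemma Fr_less:
  assumes "Fr < c"
  shows "\<exists>k\<ge>1. integral\<^sup>L M (f k) < real k * c"
proof -
  have "Fstar M f < ereal c" using assms by (simp add: Fstar_eq)
  then obtain k where "k \<ge> 1" "integral\<^sup>L M (f k) / real k < c"
    unfolding Fstar_def Inf_less_iff by auto
  then show ?thesis by (intro exI[of _ k]) (simp add: field_simps)
qed

lemma bdd_above_f: "n \<ge> 1 \<Longrightarrow> bdd_above (f n ` ball_B n x e)"
proof -
  assume "n \<ge> 1"
  then obtain C where "\<And>y. y \<in> X \<Longrightarrow> \<bar>f n y\<bar> \<le> C" using f_bound by blast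
  then show ?thesis by (intro bdd_aboveI2[of _ _ C]) (auto simp: bowen_ball_def abs_le_iff)
qed

lemma sup_pot_upper: "n \<ge> 1 \<Longrightarrow> y \<in> ball_B n x e \<Longrightarrow> f n y \<le> sup_pot X T f n x e"
  unfolding sup_pot_def by (intro cSUP_upper bdd_above_f)

text \<open>Up to a constant, \<open>k * f n\<close> lies below the Birkhoff sum of the single
  function \<open>f k\<close>. Uniform continuity of \<open>f k\<close> controls this sum along all
  orbits in a Bowen ball, with a radius \<open>e0\<close> independent of \<open>n\<close>.\<close>

lemma sup_pot_eventually_le:
  assumes c: "Fr < c"
  shows "\<exists>e0>0. \<exists>S. (\<forall>n. S n \<in> sets M) \<and> (AE x in M. \<forall>\<^sub>F n in sequentially. x \<in> S n) \<and>
    (\<forall>\<^sub>F n in sequentially. \<forall>x\<in>S n. \<forall>e. 0 < e \<longrightarrow> e \<le> e0 \<longrightarrow> sup_pot X T f n x e \<le> real n * c)"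
proof -
  obtain c1 where c1: "Fr < c1" "c1 < c" using dense[OF c] by blast
  \<comment> \<open>One half of the gap pays for the variation of \<open>f k\<close> over the ball,
    the other for the constant \<open>C\<close>.\<close>
  define d where "d = (c - c1) / 2"
  have d: "d > 0" using c1 by (simp add: d_def)
  obtain k where k: "k \<ge> 1" "integral\<^sup>L M (f k) < real k * c1" using Fr_less[OF c1(1)] by blast
  have [measurable]: "f k \<in> borel_measurable M" by (rule continuous_on_measurable[OF f_cont[OF k(1)]])
  obtain B where B: "\<And>x. x \<in> X \<Longrightarrow> \<bar>f k x\<bar> \<le> B" using f_bound[OF k(1)] by blast
  obtain C where C: "\<And>n x. x \<in> X \<Longrightarrow> real k * f0 n x \<le> (\<Sum>j<n. f k ((T ^^ j) x)) + C"
    using subadd_process_sum_le[OF f0_process k(1)] unfolding space_M f0_eq[OF k(1)] by blast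
  have "uniformly_continuous_on X (f k)"
    by (rule compact_uniformly_continuous[OF f_cont[OF k(1)] compact_X])
  moreover have "real k * d > 0" using d k(1) by simp
  ultimately obtain e0 where e0: "e0 > 0" "\<And>x y. x \<in> X \<Longrightarrow> y \<in> X \<Longrightarrow> dist x y < e0 \<Longrightarrow> dist (f k x) (f k y) < real k * d"
    unfolding uniformly_continuous_on_def by (metis dist_commute)
  define S where "S n = {x\<in>space M. (\<Sum>j<n. f k ((T ^^ j) x)) \<le> real n * (real k * c1)}" for n
  obtain N0 :: nat where N0: "C / (real k * d) < real N0" using reals_Archimedean2 by blast
  show ?thesis
  proof (intro exI[of _ e0] exI[of _ S] conjI allI e0(1))
    show "S n \<in> sets M" for n unfolding S_def by measurable
    have "AE x in M. \<forall>\<^sub>F n in sequentially. (\<Sum>j<n. f k ((T ^^ j) x)) \<le> real n * (real k * c1)"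
      by (rule eventually_birkhoff_sum_le[where C=B]) (use B k in \<open>auto simp: space_M\<close>)
    with AE_space show "AE x in M. \<forall>\<^sub>F n in sequentially. x \<in> S n"
      by eventually_elim (simp add: S_def)
    have "sup_pot X T f n x e \<le> real n * c"
      if n: "n \<ge> max 1 N0" and x: "x \<in> S n" and e: "0 < e" "e \<le> e0" for n x e
      unfolding sup_pot_def
    proof (rule cSUP_least)
      have X: "x \<in> X" using x by (simp add: S_def space_M)
      then show "ball_B n x e \<noteq> {}" using bowen_ball_self e(1) by blast
      fix y assume y: "y \<in> ball_B n x e"
      then have Y: "y \<in> X" by (simp add: bowen_ball_def)
      have "f k ((T ^^ j) y) \<le> f k ((T ^^ j) x) + real k * d" if "j < n" for j
      proof -
        have "dist ((T ^^ j) x) ((T ^^ j) y) < e0" using y that e by (auto simp: bowen_ball_def)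
        from e0(2)[OF funpow_maps[OF X] funpow_maps[OF Y] this] show ?thesis by (simp add: dist_real_def)
      qed
      then have "(\<Sum>j<n. f k ((T ^^ j) y)) \<le> (\<Sum>j<n. f k ((T ^^ j) x) + real k * d)"
        by (intro sum_mono) auto
      also have "\<dots> = (\<Sum>j<n. f k ((T ^^ j) x)) + real n * (real k * d)" by (simp add: sum.distrib)
      also have "\<dots> \<le> real n * (real k * c1) + real n * (real k * d)" using x by (simp add: S_def)
      finally have "real k * f n y \<le> real n * (real k * c1) + real n * (real k * d) + C"
        using C[OF Y, of n] n by (simp add: f0_eq)
      moreover have "C \<le> real n * (real k * d)"
      proof -
        have "C / (real k * d) \<le> real n" using N0 n by simp
        then show ?thesis using k(1) d by (simp add: pos_divide_le_eq)
      qed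
      ultimately have "real k * f n y \<le> real k * (real n * (c1 + 2 * d))" by (simp add: algebra_simps)
      moreover have "c1 + 2 * d = c" unfolding d_def by argo
      ultimately show "f n y \<le> real n * c" using k(1) by simp
    qed
    then show "\<forall>\<^sub>F n in sequentially. \<forall>x\<in>S n. \<forall>e. 0 < e \<longrightarrow> e \<le> e0 \<longrightarrow> sup_pot X T f n x e \<le> real n * c"
      unfolding eventually_sequentially by blast
  qed
qed

text \<open>Points with the same itinerary in a partition into cells of small diameter share a Bowen
  ball, so one centre per word suffices.\<close>

lemma pressure_upper_cover:
  assumes h: "\<And>P. meas_partition M P \<Longrightarrow> entropy_wrt M T P \<le> h" and s: "h + Fr < s"
  shows "\<exists>e0>0. \<forall>e. 0 < e \<longrightarrow> e \<le> e0 \<longrightarrow> (\<exists>D. (\<forall>n. D n \<in> sets M) \<and>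
    (AE x in M. \<forall>\<^sub>F n in sequentially. x \<in> D n) \<and>
    (\<forall>\<^sub>F n in sequentially. \<exists>E. finite E \<and> E \<subseteq> X \<and> D n \<subseteq> (\<Union>x\<in>E. ball_B n x e) \<and>
       (\<Sum>x\<in>E. exp (sup_pot X T f n x e)) \<le> exp (real n * s)))"
proof -
  \<comment> \<open>One margin is for the number of words, one for the potential:
    \<open>h + t + (Fr + t) = s\<close>.\<close>
  define t where "t = (s - h - Fr) / 2"
  have t: "t > 0" using s by (simp add: t_def)
  obtain e0 S where e0: "e0 > 0" and S: "\<And>n. S n \<in> sets M" "AE x in M. \<forall>\<^sub>F n in sequentially. x \<in> S n"
      "\<forall>\<^sub>F n in sequentially. \<forall>x\<in>S n. \<forall>e. 0 < e \<longrightarrow> e \<le> e0 \<longrightarrow> sup_pot X T f n x e \<le> real n * (Fr + t)"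
    using sup_pot_eventually_le[of "Fr + t"] t by auto
  show ?thesis
  proof (intro exI[of _ e0] conjI allI impI e0)
    fix e assume e: "0 < e" "e \<le> e0"
    obtain P where P: "meas_partition M P" "\<And>A x y. A \<in> P \<Longrightarrow> x \<in> A \<Longrightarrow> y \<in> A \<Longrightarrow> dist x y < e"
      using small_partition[OF e(1)] by blast
    interpret mpt_partition M T P by standard (rule P(1))
    have "entropy_wrt M T P < h + t" using h[OF P(1)] t by simp
    then obtain g k where g: "block_law P g" and k: "k \<ge> 1" "(\<integral>x. code_length g k x \<partial>M) < real k * (h + t)"
      using exists_code_entropy by blast
    note [measurable] = subadd_processD(2)[OF code_length_process[OF g]]
    define D where "D n = S n \<inter> {x\<in>space M. code_length g n x \<le> real n * (h + t)}" for n
    show "\<exists>D. (\<forall>n. D n \<in> sets M) \<and> (AE x in M. \<forall>\<^sub>F n in sequentially. x \<in> D n) \<and>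
      (\<forall>\<^sub>F n in sequentially. \<exists>E. finite E \<and> E \<subseteq> X \<and> D n \<subseteq> (\<Union>x\<in>E. ball_B n x e) \<and>
         (\<Sum>x\<in>E. exp (sup_pot X T f n x e)) \<le> exp (real n * s))"
    proof (intro exI[of _ D] conjI allI)
      show "D n \<in> sets M" for n unfolding D_def using S(1) by measurable
      have "AE x in M. \<forall>\<^sub>F n in sequentially. code_length g n x \<le> real n * (h + t)"
        by (rule eventually_subadd_process_le[OF code_length_process[OF g] k])
      with S(2) AE_space show "AE x in M. \<forall>\<^sub>F n in sequentially. x \<in> D n"
      proof eventually_elim
        case (elim x)
        show ?case using elim(1,3) by eventually_elim (use elim(2) in \<open>simp add: D_def\<close>)
      qed
      show "\<forall>\<^sub>F n in sequentially. \<exists>E. finite E \<and> E \<subseteq> X \<and> D n \<subseteq> (\<Union>x\<in>E. ball_B n x e) \<and>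
         (\<Sum>x\<in>E. exp (sup_pot X T f n x e)) \<le> exp (real n * s)"
        using S(3)
      proof eventually_elim
        case (elim n)
        have DX: "D n \<subseteq> X" by (auto simp: D_def space_M)
        define V where "V = itin n ` D n"
        \<comment> \<open>The representatives are taken inside \<open>D n\<close>, so the bound on
          \<open>sup_pot\<close> holds at each centre.\<close>
        define E where "E = inv_into (D n) (itin n) ` V"
        have V: "V \<subseteq> words P n" using DX itin_words by (auto simp: V_def space_M)
        then have finV: "finite V" using finite_words[OF finite_P] finite_subset by blast
        have ED: "E \<subseteq> D n" unfolding E_def V_def by (auto intro: inv_into_into)
        have cover: "D n \<subseteq> (\<Union>x\<in>E. ball_B n x e)"
        proof
          fix x assume x: "x \<in> D n"
          define y where "y = inv_into (D n) (itin n) (itin n x)"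
          have y: "y \<in> E" using x by (auto simp: y_def E_def V_def)
          have same: "itin n y = itin n x" unfolding y_def by (rule f_inv_into_f) (use x in blast)
          have XY: "x \<in> X" "y \<in> X" using x y ED DX by auto
          have "dist ((T ^^ i) y) ((T ^^ i) x) < e" if i: "i < n" for i
          proof (rule P(2))
            have sp: "(T ^^ i) x \<in> space M" "(T ^^ i) y \<in> space M" using XY funpow_maps by (auto simp: space_M)
            show "cell ((T ^^ i) x) \<in> P" "(T ^^ i) x \<in> cell ((T ^^ i) x)"
              using sp by (auto intro: cell_in in_cell)
            have "cell ((T ^^ i) y) = cell ((T ^^ i) x)" using same itin_nth[OF i] by metis
            then show "(T ^^ i) y \<in> cell ((T ^^ i) x)" using in_cell[OF sp(2)] by simp
          qed
          then have "x \<in> ball_B n y e" using XY by (simp add: bowen_ball_def)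
          then show "x \<in> (\<Union>x\<in>E. ball_B n x e)" using y by blast
        qed
        \<comment> \<open>Each word of \<open>V\<close> has weight at least
          \<open>exp (- n * (h + t))\<close> under the code, so Kraft's inequality limits their
          number.\<close>
        have "real (card V) * exp (- (real n * (h + t))) = (\<Sum>w\<in>V. exp (- (real n * (h + t))))" by simp
        also have "\<dots> \<le> (\<Sum>w\<in>V. renew g w)"
        proof (rule sum_mono)
          fix w assume w: "w \<in> V"
          then obtain x where x: "x \<in> D n" "w = itin n x" by (auto simp: V_def)
          have pos: "renew g w > 0" using block_law_renew_pos[OF g] w V by (auto simp: words_def)
          have "- ln (renew g w) \<le> real n * (h + t)" using x by (simp add: D_def code_length_def)
          then have "exp (- (real n * (h + t))) \<le> exp (ln (renew g w))" by simp
          then show "exp (- (real n * (h + t))) \<le> renew g w" using pos by simp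
        qed
        also have "\<dots> \<le> (\<Sum>w\<in>words P n. renew g w)"
          using V g by (intro sum_mono2) (auto simp: finite_words block_law_def intro!: renew_nonneg)
        also have "\<dots> \<le> 1" using g by (intro sum_renew_le_1) (auto simp: block_law_def)
        finally have "real (card V) / exp (real n * (h + t)) \<le> 1"
          by (simp only: exp_minus divide_inverse)
        then have "real (card V) \<le> exp (real n * (h + t))"
          by (simp only: pos_divide_le_eq exp_gt_zero mult_1)
        moreover have "card E \<le> card V" unfolding E_def by (rule card_image_le[OF finV])
        ultimately have card: "real (card E) \<le> exp (real n * (h + t))" by linarith
        have "(\<Sum>x\<in>E. exp (sup_pot X T f n x e)) \<le> (\<Sum>x\<in>E. exp (real n * (Fr + t)))"
          using elim ED e by (intro sum_mono) (auto simp: D_def)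
        also have "\<dots> = real (card E) * exp (real n * (Fr + t))" by simp
        also have "\<dots> \<le> exp (real n * (h + t)) * exp (real n * (Fr + t))"
          using card by (intro mult_right_mono) auto
        also have "\<dots> = exp (real n * (h + t + (Fr + t)))" by (simp add: exp_add[symmetric] distrib_left)
        also have "h + t + (Fr + t) = s" unfolding t_def by argo
        finally have "(\<Sum>x\<in>E. exp (sup_pot X T f n x e)) \<le> exp (real n * s)" .
        moreover have "finite E" using finV by (simp add: E_def)
        ultimately show ?case using cover ED DX by blast
      qed
    qed
  qed
qed

text \<open>A ball that meets \<open>G\<close> can be recentred at a point \<open>y\<close> of
  \<open>G\<close>, where the local entropy bound and the lower bound for the potential both hold.
  This reaches every centre \<open>x\<close> in \<open>X\<close>, at the price of doubling the
  radius, whence \<open>e1 / 2\<close>.\<close>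

lemma pressure_lower_mass:
  assumes s: "ereal s < ks_entropy M T + Fstar M f"
  shows "\<exists>e0>0. \<exists>N. \<exists>G\<in>sets M. prob G > 0 \<and>
    (\<forall>n\<ge>N. \<forall>x\<in>X. \<forall>e. 0 < e \<longrightarrow> e \<le> e0 \<longrightarrow>
      prob (G \<inter> ball_B n x e) \<le> exp (- real n * s) * exp (sup_pot X T f n x e))"
proof -
  have "ereal (s - Fr) < ks_entropy M T"
    using s by (cases "ks_entropy M T") (simp_all add: Fstar_eq)
  then obtain P where P: "meas_partition M P" "s - Fr < entropy_wrt M T P"
    by (auto simp: ks_entropy_def less_SUP_iff)
  \<comment> \<open>\<open>h'\<close> stays \<open>t\<close> below the entropy and \<open>a\<close>
    stays \<open>t\<close> below \<open>Fr\<close>, with \<open>h' + a = s\<close>.\<close>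
  define t where "t = (entropy_wrt M T P - (s - Fr)) / 2"
  have t: "t > 0" using P by (simp add: t_def)
  define h' where "h' = s - Fr + t"
  define a where "a = Fr - t"
  have "entropy_wrt M T P = h' + t" unfolding h'_def t_def by argo
  then have "h' < entropy_wrt M T P" using t by simp
  from local_entropy_lower[OF P(1) this] obtain e1 N1 where e1: "e1 > 0"
    and N1: "{x\<in>X. \<forall>n\<ge>N1. prob (ball_B n x e1) \<le> exp (- real n * h')} \<in> sets M"
    "prob {x\<in>X. \<forall>n\<ge>N1. prob (ball_B n x e1) \<le> exp (- real n * h')} > 0"
    by (elim exE conjE) (rule that)
  define G1 where "G1 = {x\<in>X. \<forall>n\<ge>N1. prob (ball_B n x e1) \<le> exp (- real n * h')}"
  have G1 [measurable]: "G1 \<in> sets M" and G1_pos: "prob G1 > 0"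
    using N1 by (simp_all only: G1_def)
  define G2 where "G2 N = {x\<in>space M. \<forall>n\<ge>N. real n * a \<le> f0 n x}" for N
  note [measurable] = subadd_processD(2)[OF f0_process]
  have [measurable]: "G2 N \<in> sets M" for N unfolding G2_def by measurable
  have "AE x in M. \<forall>\<^sub>F n in sequentially. real n * a \<le> f0 n x"
    by (rule eventually_subadd_process_ge[OF f0_process, of Fr]) (use Fr_le t in \<open>auto simp: f0_eq a_def\<close>)
  with AE_space have ev: "AE x in M. x \<in> (\<Union>N. G2 N)"
    by eventually_elim (auto simp: G2_def eventually_sequentially)
  \<comment> \<open>The sets \<open>G2 N\<close> increase to a set of full measure, so some
    \<open>N2\<close> keeps positive mass inside \<open>G1\<close>.\<close>
  have "(\<lambda>N. prob (G1 \<inter> G2 N)) \<longlonglongrightarrow> prob (\<Union>N. G1 \<inter> G2 N)"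
    by (rule finite_Lim_measure_incseq) (auto simp: incseq_def G2_def)
  moreover have "prob (\<Union>N. G1 \<inter> G2 N) = prob G1"
    by (rule finite_measure_eq_AE) (use ev in auto)
  ultimately have "\<forall>\<^sub>F N in sequentially. 0 < prob (G1 \<inter> G2 N)"
    using G1_pos by (intro order_tendstoD(1)) auto
  then obtain N2 where N2: "0 < prob (G1 \<inter> G2 N2)" by (auto simp: eventually_sequentially)
  define G where "G = G1 \<inter> G2 N2"
  have G [measurable]: "G \<in> sets M" unfolding G_def by measurable
  show ?thesis
  proof (intro exI[of _ "e1 / 2"] exI[of _ "max 1 (max N1 N2)"] bexI[of _ G] conjI allI impI ballI)
    fix n x e assume n: "max 1 (max N1 N2) \<le> n" and x: "x \<in> X" and e: "0 < e" "e \<le> e1 / 2"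
    show "prob (G \<inter> ball_B n x e) \<le> exp (- real n * s) * exp (sup_pot X T f n x e)"
    proof (cases "G \<inter> ball_B n x e = {}")
      case False
      then obtain y where y: "y \<in> G" "y \<in> ball_B n x e" by blast
      have "ball_B n x e \<subseteq> ball_B n y e1"
        using bowen_ball_triangle[OF y(2), of _ e] bowen_ball_mono[of "e + e" e1 n y] e by fastforce
      then have "prob (G \<inter> ball_B n x e) \<le> prob (ball_B n y e1)"
        by (intro finite_measure_mono) auto
      also have "\<dots> \<le> exp (- real n * h')" using y(1) n by (simp add: G_def G1_def)
      also have "\<dots> = exp (- real n * s) * exp (real n * a)"
        by (simp add: exp_add[symmetric] h'_def a_def algebra_simps)
      also have "\<dots> \<le> exp (- real n * s) * exp (sup_pot X T f n x e)"
      proof -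
        have "real n * a \<le> f n y" using y(1) n by (auto simp: G_def G2_def f0_def)
        also have "\<dots> \<le> sup_pot X T f n x e" using n y(2) by (intro sup_pot_upper) auto
        finally show ?thesis by simp
      qed
      finally show ?thesis .
    qed simp
  qed (use e1 N2 G in \<open>auto simp: G_def\<close>)
qed

end

section \<open>The five pressures\<close>

lemma eln_mono:
  assumes "a \<le> b"
  shows "eln a \<le> eln b"
proof (cases "a = 0 \<or> b = \<infinity>")
  case False
  then have ab: "a \<noteq> 0" "a \<noteq> \<infinity>" "b \<noteq> 0" "b \<noteq> \<infinity>"
    using assms by (auto simp: top_unique)
  then have "enn2real a \<le> enn2real b" "enn2real a > 0"
    using assms by (auto simp: enn2real_mono enn2real_positive_iff zero_less_iff_neq_zero less_top)
  then show ?thesis using ab by (simp add: eln_def)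
qed (auto simp: eln_def)

lemma eln_ennreal_exp: "eln (ennreal (exp c)) = ereal c"
  by (simp add: eln_def)

lemma eln_divide_le:
  assumes "n \<ge> 1" "t \<le> ennreal (exp (real n * s))"
  shows "eln t / ereal (real n) \<le> ereal s"
  using eln_mono[OF assms(2)] assms(1) by (subst ereal_divide_le_pos) (auto simp: eln_ennreal_exp)

lemma eln_divide_ge:
  assumes "n \<ge> 1" "ennreal (exp (real n * s)) \<le> t"
  shows "ereal s \<le> eln t / ereal (real n)"
  using eln_mono[OF assms(2)] assms(1) by (subst ereal_le_divide_pos) (auto simp: eln_ennreal_exp)

text \<open>As a supremum, the limit in delta can be bounded from below at a single delta and from
  above at each delta separately.\<close>

lemma Lim_at_right_antimono:
  fixes \<phi> :: "real \<Rightarrow> ereal"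
  assumes "\<And>a b. 0 < a \<Longrightarrow> a \<le> b \<Longrightarrow> \<phi> b \<le> \<phi> a"
  shows "Lim (at_right 0) \<phi> = (SUP a\<in>{0<..}. \<phi> a)"
proof (rule tendsto_Lim[OF trivial_limit_at_right_real])
  show "(\<phi> \<longlongrightarrow> (SUP a\<in>{0<..}. \<phi> a)) (at_right 0)"
  proof (rule order_tendstoI)
    fix y assume "y < (SUP a\<in>{0<..}. \<phi> a)"
    then obtain b where b: "b > 0" "y < \<phi> b" by (auto simp: less_SUP_iff)
    show "\<forall>\<^sub>F x in at_right 0. y < \<phi> x"
      by (rule eventually_at_rightI[of 0 b]) (use b assms in \<open>auto intro: less_le_trans\<close>)
  next
    fix y assume y: "(SUP a\<in>{0<..}. \<phi> a) < y"
    show "\<forall>\<^sub>F x in at_right 0. \<phi> x < y"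
      by (rule eventually_at_rightI[of 0 1]) (use y in \<open>auto intro: le_less_trans[OF SUP_upper]\<close>)
  qed
qed

text \<open>Comparison with real numbers only also covers infinite entropy: for
  \<open>V = \<infinity>\<close> the second premise is vacuous.\<close>

lemma ereal_eq_by_cuts:
  fixes Q V :: ereal
  assumes "\<And>s. ereal s < V \<Longrightarrow> ereal s \<le> Q" "\<And>s. V < ereal s \<Longrightarrow> Q \<le> ereal s"
  shows "Q = V"
proof (rule antisym)
  show "Q \<le> V"
  proof (rule ccontr)
    assume "\<not> Q \<le> V"
    then obtain s where "V < ereal s" "ereal s < Q" using ereal_dense2[of V Q] by (metis not_le)
    then show False using assms(2)[of s] by simp
  qed
  show "V \<le> Q"
  proof (rule ccontr)
    assume "\<not> V \<le> Q"
    then obtain s where "Q < ereal s" "ereal s < V" using ereal_dense2[of Q V] by (metis not_le)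
    then show False using assms(1)[of s] by simp
  qed
qed

text \<open>Integrate the number of sets containing a point and exchange the integrals. The right
  side has the form of the sums that define the pressures.\<close>

lemma emeasure_countable_cover_le:
  assumes I: "countable I" and B: "\<And>p. p \<in> I \<Longrightarrow> B p \<in> sets M"
    and w: "\<And>p. p \<in> I \<Longrightarrow> emeasure M (B p) \<le> w p"
  shows "emeasure M (\<Union>p\<in>I. B p) \<le> (\<integral>\<^sup>+ p. w p \<partial>count_space I)"
proof -
  have U: "(\<Union>p\<in>I. B p) \<in> sets M" using I B by (rule sets.countable_UN''[where A=B])
  have "emeasure M (\<Union>p\<in>I. B p) = (\<integral>\<^sup>+ x. indicator (\<Union>p\<in>I. B p) x \<partial>M)" using U by simp
  also have "\<dots> \<le> (\<integral>\<^sup>+ x. \<integral>\<^sup>+ p. indicator (B p) x \<partial>count_space I \<partial>M)"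
  proof (rule nn_integral_mono)
    fix x
    show "indicator (\<Union>p\<in>I. B p) x \<le> (\<integral>\<^sup>+ p. indicator (B p) x \<partial>count_space I :: ennreal)"
    proof (cases "x \<in> (\<Union>p\<in>I. B p)")
      case True
      then obtain p where "p \<in> I" "x \<in> B p" by blast
      then show ?thesis using nn_integral_ge_point[of p I "\<lambda>p. indicator (B p) x :: ennreal"] True by simp
    qed simp
  qed
  also have "\<dots> = (\<integral>\<^sup>+ p. \<integral>\<^sup>+ x. indicator (B p) x \<partial>M \<partial>count_space I)"
    using B by (intro nn_integral_count_space_nn_integral I) auto
  also have "\<dots> \<le> (\<integral>\<^sup>+ p. w p \<partial>count_space I)"
    using B w by (intro nn_integral_mono) auto
  finally show ?thesis .
qed

text \<open>Tonelli for counting measures; it evaluates a cover of mixed lengths one length at a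
  time.\<close>

lemma nn_integral_count_space_Sigma:
  "(\<integral>\<^sup>+ p. F p \<partial>count_space (SIGMA n:A. E n)) = (\<integral>\<^sup>+ n. \<integral>\<^sup>+ x. F (n, x) \<partial>count_space (E n) \<partial>count_space A)"
proof -
  have "(\<integral>\<^sup>+ p. F p \<partial>count_space (SIGMA n:A. E n)) =
      (\<integral>\<^sup>+ p. F p * indicator (SIGMA n:A. E n) p \<partial>count_space UNIV)"
    by (rule nn_integral_count_space_indicator) simp
  also have "\<dots> = (\<integral>\<^sup>+ n. \<integral>\<^sup>+ x. F (n, x) * indicator (SIGMA n:A. E n) (n, x) \<partial>count_space UNIV \<partial>count_space UNIV)"
    by (rule nn_integral_fst_count_space[symmetric])
  also have "\<dots> = (\<integral>\<^sup>+ n. (\<integral>\<^sup>+ x. F (n, x) \<partial>count_space (E n)) * indicator A n \<partial>count_space UNIV)"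
  proof (rule nn_integral_cong)
    fix n
    show "(\<integral>\<^sup>+ x. F (n, x) * indicator (SIGMA n:A. E n) (n, x) \<partial>count_space UNIV) =
        (\<integral>\<^sup>+ x. F (n, x) \<partial>count_space (E n)) * indicator A n"
      by (cases "n \<in> A") (auto simp: nn_integral_count_space_indicator indicator_def intro!: nn_integral_cong)
  qed
  also have "\<dots> = (\<integral>\<^sup>+ n. \<integral>\<^sup>+ x. F (n, x) \<partial>count_space (E n) \<partial>count_space A)"
    by (rule nn_integral_count_space_indicator[symmetric]) simp
  finally show ?thesis .
qed

section \<open>Comparison of the pressures and the upper bounds\<close>

context potential_mpt
begin

abbreviation ball_sum :: "nat \<Rightarrow> real \<Rightarrow> 'a set \<Rightarrow> ennreal" where
  "ball_sum n e C \<equiv> \<integral>\<^sup>+ x. ennreal (exp (sup_pot X T f n x e)) \<partial>count_space C"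

lemma span_count_antimono: "a \<le> b \<Longrightarrow> span_count X T f M n e b \<le> span_count X T f M n e a"
  unfolding span_count_def by (intro INF_superset_mono) auto

lemma span_press_delta_antimono:
  assumes "a \<le> b"
  shows "span_press_delta X T f M b \<le> span_press_delta X T f M a"
  unfolding span_press_delta_def span_press_eps_def
proof (rule Liminf_mono, rule always_eventually, rule allI, rule Limsup_mono)
  fix e
  show "\<forall>\<^sub>F n in sequentially. eln (span_count X T f M n e b) / ereal (real n) \<le> eln (span_count X T f M n e a) / ereal (real n)"
    using eventually_ge_at_top[of 1]
    by eventually_elim (intro ereal_divide_right_mono eln_mono span_count_antimono assms, simp)
qed

lemma span_pressure_eq: "span_pressure X T f M = (SUP a\<in>{0<..}. span_press_delta X T f M a)"
  unfolding span_pressure_def by (rule Lim_at_right_antimono) (rule span_press_delta_antimono)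

lemma lower_cap_star_eps_eq: "lower_cap_star_eps X T f M e =
    (SUP a\<in>{0<..}. INF Z\<in>{Z\<in>sets M. prob Z \<ge> 1 - a}. lower_cap_Z X T f Z e)"
  unfolding lower_cap_star_eps_def by (rule Lim_at_right_antimono) (intro INF_superset_mono, auto)

lemma upper_cap_star_eps_eq: "upper_cap_star_eps X T f M e =
    (SUP a\<in>{0<..}. INF Z\<in>{Z\<in>sets M. prob Z \<ge> 1 - a}. upper_cap_Z X T f Z e)"
  unfolding upper_cap_star_eps_def by (rule Lim_at_right_antimono) (intro INF_superset_mono, auto)

lemma lower_cap_le_upper_cap: "lower_cap_Z X T f Z e \<le> upper_cap_Z X T f Z e"
  unfolding lower_cap_Z_def upper_cap_Z_def by (rule Liminf_le_Limsup) simp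

lemma lower_cap_star_le_upper: "lower_cap_star X T f M \<le> upper_cap_star X T f M"
  unfolding lower_cap_star_def upper_cap_star_def lower_cap_star_eps_eq upper_cap_star_eps_eq
  by (intro Liminf_mono always_eventually allI SUP_mono' INF_mono' lower_cap_le_upper_cap)

lemma span_count_le_cap_Lambda:
  assumes Z: "prob Z \<ge> 1 - a"
  shows "span_count X T f M n e a \<le> cap_Lambda X T f Z n e"
  unfolding span_count_def cap_Lambda_def
proof (rule INF_superset_mono)
  show "{C. countable C \<and> C \<subseteq> X \<and> Z \<subseteq> (\<Union>x\<in>C. ball_B n x e)} \<subseteq>
     {F. F \<subseteq> X \<and> 1 - a \<le> prob (\<Union>x\<in>F. ball_B n x e)}"
  proof safe
    fix C assume C: "countable C" "C \<subseteq> X" "Z \<subseteq> (\<Union>x\<in>C. ball_B n x e)"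
    have "prob Z \<le> prob (\<Union>x\<in>C. ball_B n x e)"
      using C by (intro finite_measure_mono sets.countable_UN'') auto
    then show "1 - a \<le> prob (\<Union>x\<in>C. ball_B n x e)" using Z by simp
  qed
qed simp

lemma span_press_eps_le_upper_cap:
  assumes "prob Z \<ge> 1 - a"
  shows "span_press_eps X T f M e a \<le> upper_cap_Z X T f Z e"
  unfolding span_press_eps_def upper_cap_Z_def
proof (rule Limsup_mono)
  show "\<forall>\<^sub>F n in sequentially. eln (span_count X T f M n e a) / ereal (real n) \<le> eln (cap_Lambda X T f Z n e) / ereal (real n)"
    using eventually_ge_at_top[of 1]
    by eventually_elim (intro ereal_divide_right_mono eln_mono span_count_le_cap_Lambda assms, simp)
qed

lemma span_pressure_le_upper_cap_star: "span_pressure X T f M \<le> upper_cap_star X T f M"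
  unfolding span_pressure_eq
proof (rule SUP_least)
  fix a :: real assume a: "a \<in> {0<..}"
  show "span_press_delta X T f M a \<le> upper_cap_star X T f M"
    unfolding span_press_delta_def upper_cap_star_def
  proof (intro Liminf_mono always_eventually allI)
    fix e
    have "span_press_eps X T f M e a \<le> (INF Z\<in>{Z\<in>sets M. prob Z \<ge> 1 - a}. upper_cap_Z X T f Z e)"
      by (intro INF_greatest span_press_eps_le_upper_cap) auto
    also have "\<dots> \<le> upper_cap_star_eps X T f M e"
      unfolding upper_cap_star_eps_eq by (rule SUP_upper[OF a])
    finally show "span_press_eps X T f M e a \<le> upper_cap_star_eps X T f M e" .
  qed
qed

lemma entropy_bounded:
  assumes "ks_entropy M T + Fstar M f < ereal s"
  obtains h where "\<And>P. meas_partition M P \<Longrightarrow> entropy_wrt M T P \<le> h" "h + Fr < s"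
proof -
  have le: "ereal (entropy_wrt M T P) \<le> ks_entropy M T" if "meas_partition M P" for P
    unfolding ks_entropy_def by (rule SUP_upper) (use that in simp)
  \<comment> \<open>The trivial partition excludes the value \<open>-\<infinity>\<close> for the
    supremum \<open>ks_entropy\<close>; the assumption excludes \<open>\<infinity>\<close>.\<close>
  have "meas_partition M {space M}" by (auto simp: meas_partition_def)
  from le[OF this] assms obtain h where "ks_entropy M T = ereal h"
    by (cases "ks_entropy M T") (auto simp: Fstar_eq)
  then show ?thesis using that[of h] le assms by (simp add: Fstar_eq)
qed

lemma upper_cap_Z_le:
  assumes ev: "\<forall>\<^sub>F n in sequentially. \<exists>E. finite E \<and> E \<subseteq> X \<and> Z \<subseteq> (\<Union>x\<in>E. ball_B n x e) \<and>
       (\<Sum>x\<in>E. exp (sup_pot X T f n x e)) \<le> exp (real n * s)"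
  shows "upper_cap_Z X T f Z e \<le> ereal s"
  unfolding upper_cap_Z_def
proof (rule Limsup_bounded)
  show "\<forall>\<^sub>F n in sequentially. eln (cap_Lambda X T f Z n e) / ereal (real n) \<le> ereal s"
    using ev eventually_ge_at_top[of 1]
  proof eventually_elim
    case (elim n)
    then obtain E where E: "finite E" "E \<subseteq> X" "Z \<subseteq> (\<Union>x\<in>E. ball_B n x e)"
       "(\<Sum>x\<in>E. exp (sup_pot X T f n x e)) \<le> exp (real n * s)" by blast
    have "cap_Lambda X T f Z n e \<le> ball_sum n e E"
      unfolding cap_Lambda_def by (rule INF_lower) (use E in \<open>auto intro: countable_finite\<close>)
    also have "\<dots> = ennreal (\<Sum>x\<in>E. exp (sup_pot X T f n x e))"
      using E(1) by (simp add: nn_integral_count_space_finite sum_ennreal)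
    also have "\<dots> \<le> ennreal (exp (real n * s))" using E(4) by (rule ennreal_leI)
    finally show ?case using elim(2) by (intro eln_divide_le)
  qed
qed

text \<open>The points that lie in \<open>D n\<close> for all \<open>n \<ge> m\<close> have measure
  above \<open>1 - a\<close> once \<open>m\<close> is large, and this one set is covered cheaply at
  every large length.\<close>

lemma upper_cap_star_le:
  assumes s: "ks_entropy M T + Fstar M f < ereal s"
  shows "upper_cap_star X T f M \<le> ereal s"
proof -
  obtain h where h: "\<And>P. meas_partition M P \<Longrightarrow> entropy_wrt M T P \<le> h" "h + Fr < s"
    by (rule entropy_bounded[OF s]) (rule that)
  obtain e0 where e0: "e0 > 0" and cov: "\<And>e. 0 < e \<Longrightarrow> e \<le> e0 \<Longrightarrow> \<exists>D. (\<forall>n. D n \<in> sets M) \<and>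
    (AE x in M. \<forall>\<^sub>F n in sequentially. x \<in> D n) \<and>
    (\<forall>\<^sub>F n in sequentially. \<exists>E. finite E \<and> E \<subseteq> X \<and> D n \<subseteq> (\<Union>x\<in>E. ball_B n x e) \<and>
       (\<Sum>x\<in>E. exp (sup_pot X T f n x e)) \<le> exp (real n * s))"
    using pressure_upper_cover[OF h] by blast
  have "upper_cap_star_eps X T f M e \<le> ereal s" if e: "0 < e" "e \<le> e0" for e
    unfolding upper_cap_star_eps_eq
  proof (rule SUP_least)
    fix a :: real assume a: "a \<in> {0<..}"
    obtain D where D: "\<And>n. D n \<in> sets M" "AE x in M. \<forall>\<^sub>F n in sequentially. x \<in> D n"
      "\<forall>\<^sub>F n in sequentially. \<exists>E. finite E \<and> E \<subseteq> X \<and> D n \<subseteq> (\<Union>x\<in>E. ball_B n x e) \<and>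
       (\<Sum>x\<in>E. exp (sup_pot X T f n x e)) \<le> exp (real n * s)"
      using cov[OF e] by blast
    note [measurable] = D(1)
    define Z where "Z m = {x\<in>space M. \<forall>n\<ge>m. x \<in> D n}" for m
    have Z [measurable]: "Z m \<in> sets M" for m unfolding Z_def by measurable
    have "(\<lambda>m. prob (Z m)) \<longlonglongrightarrow> prob (\<Union>m. Z m)"
      by (rule finite_Lim_measure_incseq) (auto simp: incseq_def Z_def)
    moreover have "prob (\<Union>m. Z m) = 1"
    proof -
      have "AE x in M. x \<in> (\<Union>m. Z m)"
        using AE_space D(2) by eventually_elim (auto simp: Z_def eventually_sequentially)
      then show ?thesis by (subst prob_eq_1) auto
    qed
    ultimately have "\<forall>\<^sub>F m in sequentially. 1 - a < prob (Z m)"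
      using a by (intro order_tendstoD(1)) auto
    then obtain m where m: "1 - a < prob (Z m)" by (auto simp: eventually_sequentially)
    have "upper_cap_Z X T f (Z m) e \<le> ereal s"
    proof (rule upper_cap_Z_le)
      show "\<forall>\<^sub>F n in sequentially. \<exists>E. finite E \<and> E \<subseteq> X \<and> Z m \<subseteq> (\<Union>x\<in>E. ball_B n x e) \<and>
         (\<Sum>x\<in>E. exp (sup_pot X T f n x e)) \<le> exp (real n * s)"
        using D(3) eventually_ge_at_top[of m]
      proof eventually_elim
        case (elim n)
        have "Z m \<subseteq> D n" using elim(2) by (auto simp: Z_def)
        then show ?case using elim(1) by (meson order_trans)
      qed
    qed
    then show "(INF Z\<in>{Z\<in>sets M. prob Z \<ge> 1 - a}. upper_cap_Z X T f Z e) \<le> ereal s"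
      using Z m by (intro INF_lower2[of "Z m"]) auto
  qed
  then have "\<forall>\<^sub>F e in at_right 0. upper_cap_star_eps X T f M e \<le> ereal s"
    using e0 by (intro eventually_at_rightI[of 0 e0]) auto
  then show ?thesis unfolding upper_cap_star_def by (intro Liminf_le) auto
qed

text \<open>The time after which a point stays in all \<open>D n\<close> is not bounded on a set of
  full measure. Covers of mixed lengths remedy this: all \<open>E n\<close> with
  \<open>n \<ge> K\<close> together cover \<open>Z\<close>, at the cost of the tail of a geometric
  series.\<close>

lemma car_Pstar_le:
  assumes s: "ks_entropy M T + Fstar M f < ereal s"
  shows "car_Pstar X T f M \<le> ereal s"
proof -
  obtain s1 where s1: "ks_entropy M T + Fstar M f < ereal s1" "s1 < s"
    using ereal_dense2[OF s] by auto
  \<comment> \<open>The series has ratio \<open>r * r\<close>: one factor \<open>r ^ n\<close> makes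
    it summable, the other is at most \<open>r ^ K\<close> and tends to 0.\<close>
  define r where "r = exp (- ((s - s1) / 2))"
  have r: "0 < r" "r < 1" using s1(2) by (auto simp: r_def)
  obtain h where h: "\<And>P. meas_partition M P \<Longrightarrow> entropy_wrt M T P \<le> h" "h + Fr < s1"
    by (rule entropy_bounded[OF s1(1)]) (rule that)
  obtain e0 where e0: "e0 > 0" and cov: "\<And>e. 0 < e \<Longrightarrow> e \<le> e0 \<Longrightarrow> \<exists>D. (\<forall>n. D n \<in> sets M) \<and>
    (AE x in M. \<forall>\<^sub>F n in sequentially. x \<in> D n) \<and>
    (\<forall>\<^sub>F n in sequentially. \<exists>E. finite E \<and> E \<subseteq> X \<and> D n \<subseteq> (\<Union>x\<in>E. ball_B n x e) \<and>
       (\<Sum>x\<in>E. exp (sup_pot X T f n x e)) \<le> exp (real n * s1))"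
    using pressure_upper_cover[OF h] by blast
  have "car_Pstar_eps X T f M e \<le> ereal s" if e: "0 < e" "e \<le> e0" for e
  proof -
    obtain D where D: "\<And>n. D n \<in> sets M" "AE x in M. \<forall>\<^sub>F n in sequentially. x \<in> D n"
      "\<forall>\<^sub>F n in sequentially. \<exists>E. finite E \<and> E \<subseteq> X \<and> D n \<subseteq> (\<Union>x\<in>E. ball_B n x e) \<and>
       (\<Sum>x\<in>E. exp (sup_pot X T f n x e)) \<le> exp (real n * s1)"
      using cov[OF e] by blast
    note [measurable] = D(1)
    define Z where "Z = {x\<in>space M. \<exists>m. \<forall>n\<ge>m. x \<in> D n}"
    have Z [measurable]: "Z \<in> sets M" unfolding Z_def by measurable
    have "AE x in M. x \<in> Z"
      using AE_space D(2) by eventually_elim (auto simp: Z_def eventually_sequentially)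
    then have Z1: "prob Z = 1" by (subst prob_eq_1) auto
    obtain N0 where "\<forall>n\<ge>N0. \<exists>E. finite E \<and> E \<subseteq> X \<and> D n \<subseteq> (\<Union>x\<in>E. ball_B n x e) \<and>
       (\<Sum>x\<in>E. exp (sup_pot X T f n x e)) \<le> exp (real n * s1)"
      using D(3) unfolding eventually_sequentially by blast
    then obtain E where E: "\<And>n. n \<ge> N0 \<Longrightarrow> finite (E n)" "\<And>n. n \<ge> N0 \<Longrightarrow> E n \<subseteq> X"
      "\<And>n. n \<ge> N0 \<Longrightarrow> D n \<subseteq> (\<Union>x\<in>E n. ball_B n x e)"
      "\<And>n. n \<ge> N0 \<Longrightarrow> (\<Sum>x\<in>E n. exp (sup_pot X T f n x e)) \<le> exp (real n * s1)" by metis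
    have bound: "car_M X T f Z s N e \<le> ennreal (r ^ K * (1 / (1 - r)))" if K: "K \<ge> max N N0" for N K
    proof -
      let ?G = "SIGMA n:{K..}. E n"
      have "car_cover X T e N Z ?G"
        unfolding car_cover_def
      proof (intro conjI)
        show "countable ?G" using E(1) K by (intro countable_SIGMA) (auto intro: countable_finite)
        show "?G \<subseteq> {N..} \<times> X"
        proof
          fix p assume "p \<in> ?G"
          then obtain n x where p: "p = (n, x)" "K \<le> n" "x \<in> E n" by auto
          then have "x \<in> X" using E(2)[of n] K by auto
          then show "p \<in> {N..} \<times> X" using p K by auto
        qed
        show "Z \<subseteq> (\<Union>p\<in>?G. ball_B (fst p) (snd p) e)"
        proof
          fix x assume "x \<in> Z"
          then obtain m where m: "\<forall>n\<ge>m. x \<in> D n" by (auto simp: Z_def)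
          then have "x \<in> D (max m K)" by simp
          moreover have "N0 \<le> max m K" using K by linarith
          ultimately have "x \<in> (\<Union>y\<in>E (max m K). ball_B (max m K) y e)" using E(3) by blast
          then show "x \<in> (\<Union>p\<in>?G. ball_B (fst p) (snd p) e)" by fastforce
        qed
      qed
      then have "car_M X T f Z s N e \<le>
         (\<integral>\<^sup>+ p. ennreal (exp (- s * real (fst p) + sup_pot X T f (fst p) (snd p) e)) \<partial>count_space ?G)"
        unfolding car_M_def by (intro INF_lower) simp
      also have "\<dots> = (\<integral>\<^sup>+ n. \<integral>\<^sup>+ x. ennreal (exp (- s * real n + sup_pot X T f n x e)) \<partial>count_space (E n) \<partial>count_space {K..})"
        by (subst nn_integral_count_space_Sigma) simp
      also have "\<dots> \<le> (\<integral>\<^sup>+ n. ennreal (r ^ K * r ^ n) \<partial>count_space {K..})"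
      proof (rule nn_integral_mono)
        fix n assume "n \<in> space (count_space {K..})"
        then have n: "n \<ge> K" "n \<ge> N0" using K by auto
        have "(\<integral>\<^sup>+ x. ennreal (exp (- s * real n + sup_pot X T f n x e)) \<partial>count_space (E n)) =
            ennreal (\<Sum>x\<in>E n. exp (- s * real n + sup_pot X T f n x e))"
          using E(1)[OF n(2)] by (simp add: nn_integral_count_space_finite sum_ennreal)
        also have "(\<Sum>x\<in>E n. exp (- s * real n + sup_pot X T f n x e)) =
            exp (- s * real n) * (\<Sum>x\<in>E n. exp (sup_pot X T f n x e))"
          by (simp only: exp_add sum_distrib_left)
        also have "\<dots> \<le> exp (- s * real n) * exp (real n * s1)"
          using E(4)[OF n(2)] by (intro mult_left_mono) auto
        also have "\<dots> = r ^ n * r ^ n"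
          unfolding r_def exp_of_nat_mult[symmetric] exp_add[symmetric]
          by (rule arg_cong[of _ _ exp]) (simp add: algebra_simps diff_divide_distrib)
        also have "\<dots> \<le> r ^ K * r ^ n"
          using r n(1) by (intro mult_right_mono power_decreasing) auto
        finally show "(\<integral>\<^sup>+ x. ennreal (exp (- s * real n + sup_pot X T f n x e)) \<partial>count_space (E n)) \<le> ennreal (r ^ K * r ^ n)"
          by (simp add: ennreal_leI)
      qed
      also have "\<dots> \<le> (\<integral>\<^sup>+ n. ennreal (r ^ K * r ^ n) \<partial>count_space UNIV)"
        by (subst nn_integral_count_space_indicator) (auto intro!: nn_integral_mono simp: indicator_def)
      also have "\<dots> = (\<Sum>n. ennreal (r ^ K * r ^ n))" by (rule nn_integral_count_space_nat)
      also have "\<dots> = ennreal (\<Sum>n. r ^ K * r ^ n)"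
        using r by (intro suminf_ennreal2 summable_mult summable_geometric) auto
      also have "(\<Sum>n. r ^ K * r ^ n) = r ^ K * (1 / (1 - r))"
        using r by (subst suminf_mult) (auto simp: suminf_geometric summable_geometric)
      finally show ?thesis .
    qed
    have "car_M X T f Z s N e = 0" for N
    proof -
      have "(\<lambda>K. ennreal (r ^ K * (1 / (1 - r)))) \<longlonglongrightarrow> ennreal (0 * (1 / (1 - r)))"
        using r by (intro tendsto_ennrealI tendsto_mult LIMSEQ_power_zero) auto
      then have "car_M X T f Z s N e \<le> ennreal (0 * (1 / (1 - r)))"
        by (rule LIMSEQ_le_const) (use bound in blast)
      then show ?thesis by simp
    qed
    then have "car_m X T f Z s e = 0" unfolding car_m_def by (simp add: limI)
    then have "car_P_eps X T f Z e \<le> ereal s" unfolding car_P_eps_def by (intro Inf_lower) blast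
    then show ?thesis unfolding car_Pstar_eps_def using Z Z1 by (intro INF_lower2[of Z]) auto
  qed
  then have "\<forall>\<^sub>F e in at_right 0. car_Pstar_eps X T f M e \<le> ereal s"
    using e0 by (intro eventually_at_rightI[of 0 e0]) auto
  then show ?thesis unfolding car_Pstar_def by (intro Liminf_le) auto
qed

section \<open>The mass distribution principle and the lower bounds\<close>

lemma prob_Int_ge:
  assumes [measurable]: "G \<in> sets M" "Z \<in> sets M" and "prob Z \<ge> 1 - a"
  shows "prob G - a \<le> prob (G \<inter> Z)"
proof -
  have "prob (G - Z) = prob G - prob (G \<inter> Z)" by (rule finite_measure_Diff') auto
  moreover have "prob (G - Z) \<le> prob (space M - Z)"
    using sets.sets_into_space[of G M] by (intro finite_measure_mono) auto
  moreover have "prob (space M - Z) = 1 - prob Z" by (rule prob_compl) simp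
  ultimately show ?thesis using assms(3) by linarith
qed

text \<open>The balls together carry mass at least \<open>m\<close> of \<open>G\<close>, and each
  carries at most \<open>exp (- n * s)\<close> times its weight.\<close>

lemma mass_le_ball_sum:
  assumes C: "countable C" "C \<subseteq> X" and [measurable]: "G \<in> sets M"
    and mass: "\<And>x. x \<in> X \<Longrightarrow> prob (G \<inter> ball_B n x e) \<le> exp (- real n * s) * exp (sup_pot X T f n x e)"
    and m: "m \<le> prob (G \<inter> (\<Union>x\<in>C. ball_B n x e))"
  shows "ennreal (exp (real n * s) * m) \<le> ball_sum n e C"
proof -
  have "ennreal m \<le> emeasure M (G \<inter> (\<Union>x\<in>C. ball_B n x e))"
    using m by (simp add: emeasure_eq_measure ennreal_leI)
  also have "G \<inter> (\<Union>x\<in>C. ball_B n x e) = (\<Union>x\<in>C. G \<inter> ball_B n x e)" by auto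
  also have "emeasure M \<dots> \<le> (\<integral>\<^sup>+ x. ennreal (exp (- real n * s)) * ennreal (exp (sup_pot X T f n x e)) \<partial>count_space C)"
    using C mass
    by (intro emeasure_countable_cover_le) (auto simp: emeasure_eq_measure ennreal_mult[symmetric] intro!: ennreal_leI)
  also have "\<dots> = ennreal (exp (- real n * s)) * ball_sum n e C" by (rule nn_integral_cmult) simp
  finally have "ennreal (exp (real n * s)) * ennreal m \<le>
      ennreal (exp (real n * s)) * (ennreal (exp (- real n * s)) * ball_sum n e C)"
    by (rule mult_left_mono) simp
  also have "\<dots> = ennreal (exp (real n * s) * exp (- real n * s)) * ball_sum n e C"
    by (simp only: ennreal_mult[OF exp_ge_zero exp_ge_zero] mult.assoc)
  also have "exp (real n * s) * exp (- real n * s) = 1" by (simp flip: exp_add)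
  finally show ?thesis by (simp add: ennreal_mult')
qed

text \<open>Spanning sets may be arbitrary, even uncountable, subsets of \<open>X\<close>. All
  weights are at least \<open>exp (- B)\<close>, so infinite sets have infinite sums and only finite
  ones compete.\<close>

lemma ball_sum_infinite:
  assumes C: "C \<subseteq> X" "infinite C" and n: "n \<ge> 1" and e: "e > 0"
  shows "ball_sum n e C = \<infinity>"
proof -
  obtain B where B: "\<And>x. x \<in> X \<Longrightarrow> \<bar>f n x\<bar> \<le> B" using f_bound[OF n] by blast
  have "(\<integral>\<^sup>+ x. ennreal (exp (- B)) \<partial>count_space C) \<le> ball_sum n e C"
  proof (rule nn_integral_mono)
    fix x assume "x \<in> space (count_space C)"
    then have x: "x \<in> X" using C by auto
    have "- B \<le> f n x" using B[OF x] by (simp add: abs_le_iff)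
    also have "\<dots> \<le> sup_pot X T f n x e" by (rule sup_pot_upper[OF n bowen_ball_self[OF x e]])
    finally show "ennreal (exp (- B)) \<le> ennreal (exp (sup_pot X T f n x e))" by (simp add: ennreal_leI)
  qed
  moreover have "(\<integral>\<^sup>+ x. ennreal (exp (- B)) \<partial>count_space C) = \<infinity>"
    using C(2) by (simp add: ennreal_mult_eq_top_iff)
  ultimately show ?thesis by (simp add: top_unique)
qed

lemma eventually_eln_ge:
  assumes g: "g > 0" and s: "s' < s"
    and ev: "\<forall>\<^sub>F n in sequentially. ennreal (exp (real n * s) * g) \<le> t n"
  shows "\<forall>\<^sub>F n in sequentially. ereal s' \<le> eln (t n) / ereal (real n)"
proof -
  obtain N :: nat where N: "- ln g / (s - s') < real N" using reals_Archimedean2 by blast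
  show ?thesis
    using ev eventually_ge_at_top[of "max 1 N"]
  proof eventually_elim
    case (elim n)
    have "- ln g / (s - s') \<le> real n" using N elim(2) by simp
    then have "- ln g \<le> real n * (s - s')" using s by (subst (asm) pos_divide_le_eq) auto
    then have "real n * s' \<le> real n * s + ln g" by (simp add: algebra_simps)
    then have "exp (real n * s') \<le> exp (real n * s + ln g)" by simp
    then have "exp (real n * s') \<le> exp (real n * s) * g" using g by (simp add: exp_add)
    then have "ennreal (exp (real n * s')) \<le> t n" using elim(1) ennreal_leI order_trans by blast
    then show ?case using elim(2) by (intro eln_divide_ge) auto
  qed
qed

lemma pressure_lower_bounds:
  assumes s': "ereal s' < ks_entropy M T + Fstar M f"
  shows "ereal s' \<le> car_Pstar X T f M" "ereal s' \<le> lower_cap_star X T f M" "ereal s' \<le> span_pressure X T f M"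
proof -
  obtain s where s: "s' < s" "ereal s < ks_entropy M T + Fstar M f"
    using ereal_dense2[OF s'] by auto
  obtain e0 N G where e0: "e0 > 0" and G [measurable]: "G \<in> sets M" and G_pos: "prob G > 0"
    and mass: "\<And>n x e. n \<ge> N \<Longrightarrow> x \<in> X \<Longrightarrow> 0 < e \<Longrightarrow> e \<le> e0 \<Longrightarrow>
      prob (G \<inter> ball_B n x e) \<le> exp (- real n * s) * exp (sup_pot X T f n x e)"
    using pressure_lower_mass[OF s(2)] by blast
  \<comment> \<open>Half of the mass serves as tolerance: a set of measure at least
    \<open>1 - g\<close> still contains mass at least \<open>g\<close> of \<open>G\<close>.\<close>
  define g where "g = prob G / 2"
  have g: "g > 0" using G_pos by (simp add: g_def)
  have small: "g \<le> prob (G \<inter> Z)" if "Z \<in> sets M" "prob Z \<ge> 1 - a" "a \<le> g" for Z a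
    using prob_Int_ge[OF G that(1,2)] that(3) by (simp add: g_def)

  have "ereal s' \<le> car_Pstar_eps X T f M e" if e: "0 < e" "e \<le> e0" for e
    unfolding car_Pstar_eps_def car_P_eps_def
  proof (intro INF_greatest Inf_greatest)
    fix Z y assume Z: "Z \<in> {Z \<in> sets M. prob Z = 1}" and "y \<in> {ereal t |t. car_m X T f Z t e = 0}"
    then obtain t where t: "y = ereal t" "car_m X T f Z t e = 0" by blast
    have [measurable]: "Z \<in> sets M" using Z by simp
    show "ereal s' \<le> y"
    proof (rule ccontr)
      assume "\<not> ereal s' \<le> y"
      \<comment> \<open>For an exponent \<open>t \<le> s\<close> every admissible cover of
        \<open>Z\<close> by long balls costs at least \<open>prob G\<close>, so \<open>car_m\<close>
        cannot vanish.\<close>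
      then have ts: "t \<le> s" using t(1) s(1) by simp
      have lower: "ennreal (prob G) \<le> car_M X T f Z t n e" if n: "n \<ge> N" for n
        unfolding car_M_def
      proof (rule INF_greatest)
        fix \<Gamma> assume "\<Gamma> \<in> {\<Gamma>. car_cover X T e n Z \<Gamma>}"
        then have \<Gamma>: "countable \<Gamma>" "\<Gamma> \<subseteq> {n..} \<times> X" "Z \<subseteq> (\<Union>p\<in>\<Gamma>. ball_B (fst p) (snd p) e)"
          by (auto simp: car_cover_def)
        have "prob G - 0 \<le> prob (G \<inter> Z)" using Z by (intro prob_Int_ge G) auto
        also have "\<dots> \<le> prob (\<Union>p\<in>\<Gamma>. G \<inter> ball_B (fst p) (snd p) e)"
          using \<Gamma> by (intro finite_measure_mono sets.countable_UN'') auto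
        finally have "ennreal (prob G) \<le> emeasure M (\<Union>p\<in>\<Gamma>. G \<inter> ball_B (fst p) (snd p) e)"
          by (simp add: emeasure_eq_measure ennreal_leI)
        also have "\<dots> \<le> (\<integral>\<^sup>+ p. ennreal (exp (- t * real (fst p) + sup_pot X T f (fst p) (snd p) e)) \<partial>count_space \<Gamma>)"
        proof (rule emeasure_countable_cover_le[OF \<Gamma>(1)])
          fix p assume p: "p \<in> \<Gamma>"
          have "prob (G \<inter> ball_B (fst p) (snd p) e) \<le>
              exp (- real (fst p) * s) * exp (sup_pot X T f (fst p) (snd p) e)"
            using \<Gamma>(2) p n e by (intro mass) auto
          also have "\<dots> \<le> exp (- t * real (fst p)) * exp (sup_pot X T f (fst p) (snd p) e)"
            using ts by (intro mult_right_mono) (auto simp: mult.commute intro: mult_right_mono)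
          also have "\<dots> = exp (- t * real (fst p) + sup_pot X T f (fst p) (snd p) e)"
            by (rule exp_add[symmetric])
          finally show "emeasure M (G \<inter> ball_B (fst p) (snd p) e) \<le>
              ennreal (exp (- t * real (fst p) + sup_pot X T f (fst p) (snd p) e))"
            by (simp only: emeasure_eq_measure ennreal_leI)
        qed simp
        finally show "ennreal (prob G) \<le> (\<integral>\<^sup>+ p. ennreal (exp (- t * real (fst p) + sup_pot X T f (fst p) (snd p) e)) \<partial>count_space \<Gamma>)" .
      qed
      \<comment> \<open>Fewer covers are admissible as \<open>n\<close> grows, so the limit defining
        \<open>car_m\<close> exists and is a supremum.\<close>
      have "incseq (\<lambda>n. car_M X T f Z t n e)"
        unfolding incseq_def car_M_def car_cover_def by (intro allI impI INF_superset_mono) auto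
      then have "(\<lambda>n. car_M X T f Z t n e) \<longlonglongrightarrow> (SUP n. car_M X T f Z t n e)" by (rule LIMSEQ_SUP)
      then have "car_m X T f Z t e = (SUP n. car_M X T f Z t n e)" unfolding car_m_def by (rule limI)
      also have "\<dots> \<ge> ennreal (prob G)" using lower[of N] by (intro SUP_upper2[of N]) auto
      finally show False using t(2) G_pos by simp
    qed
  qed
  then have "\<forall>\<^sub>F e in at_right 0. ereal s' \<le> car_Pstar_eps X T f M e"
    using e0 by (intro eventually_at_rightI[of 0 e0]) auto
  then show "ereal s' \<le> car_Pstar X T f M" unfolding car_Pstar_def by (rule Liminf_bounded)

  have "ereal s' \<le> lower_cap_star_eps X T f M e" if e: "0 < e" "e \<le> e0" for e
  proof -
    have "ereal s' \<le> lower_cap_Z X T f Z e" if Z: "Z \<in> sets M" "prob Z \<ge> 1 - g" for Z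
      unfolding lower_cap_Z_def
    proof (rule Liminf_bounded, rule eventually_eln_ge[OF g s(1)])
      show "\<forall>\<^sub>F n in sequentially. ennreal (exp (real n * s) * g) \<le> cap_Lambda X T f Z n e"
        using eventually_ge_at_top[of N]
      proof eventually_elim
        case (elim n)
        show ?case
          unfolding cap_Lambda_def
        proof (rule INF_greatest)
          fix C assume "C \<in> {C. countable C \<and> C \<subseteq> X \<and> Z \<subseteq> (\<Union>x\<in>C. ball_B n x e)}"
          then have C: "countable C" "C \<subseteq> X" "Z \<subseteq> (\<Union>x\<in>C. ball_B n x e)" by auto
          have "g \<le> prob (G \<inter> Z)" using Z by (intro small) auto
          also have "\<dots> \<le> prob (G \<inter> (\<Union>x\<in>C. ball_B n x e))"
            using C by (intro finite_measure_mono sets.Int G sets.countable_UN'') auto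
          finally show "ennreal (exp (real n * s) * g) \<le> ball_sum n e C"
            using mass[OF elim _ e] by (intro mass_le_ball_sum[OF C(1,2) G]) auto
        qed
      qed
    qed
    then have "ereal s' \<le> (INF Z\<in>{Z\<in>sets M. prob Z \<ge> 1 - g}. lower_cap_Z X T f Z e)"
      by (intro INF_greatest) auto
    then show ?thesis unfolding lower_cap_star_eps_eq using g by (intro SUP_upper2[of g]) auto
  qed
  then have "\<forall>\<^sub>F e in at_right 0. ereal s' \<le> lower_cap_star_eps X T f M e"
    using e0 by (intro eventually_at_rightI[of 0 e0]) auto
  then show "ereal s' \<le> lower_cap_star X T f M" unfolding lower_cap_star_def by (rule Liminf_bounded)

  have "ereal s' \<le> span_press_eps X T f M e g" if e: "0 < e" "e \<le> e0" for e
  proof -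
    have "\<forall>\<^sub>F n in sequentially. ereal s' \<le> eln (span_count X T f M n e g) / ereal (real n)"
    proof (rule eventually_eln_ge[OF g s(1)])
      show "\<forall>\<^sub>F n in sequentially. ennreal (exp (real n * s) * g) \<le> span_count X T f M n e g"
        using eventually_ge_at_top[of "max 1 N"]
      proof eventually_elim
        case (elim n)
        show ?case
          unfolding span_count_def
        proof (rule INF_greatest)
          fix C assume "C \<in> {F. F \<subseteq> X \<and> 1 - g \<le> prob (\<Union>x\<in>F. ball_B n x e)}"
          then have C: "C \<subseteq> X" "1 - g \<le> prob (\<Union>x\<in>C. ball_B n x e)" by auto
          show "ennreal (exp (real n * s) * g) \<le> ball_sum n e C"
          proof (cases "finite C")
            case True
            then have "g \<le> prob (G \<inter> (\<Union>x\<in>C. ball_B n x e))"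
              using C(2) by (intro small) auto
            then show ?thesis
              using mass[OF _ _ e, of n] elim True C(1) by (intro mass_le_ball_sum[OF _ _ G]) (auto intro: countable_finite)
          next
            case False
            then show ?thesis using ball_sum_infinite[OF C(1) False _ e(1), of n] elim by simp
          qed
        qed
      qed
    qed
    then have "ereal s' \<le> liminf (\<lambda>n. eln (span_count X T f M n e g) / ereal (real n))"
      by (rule Liminf_bounded)
    also have "\<dots> \<le> span_press_eps X T f M e g"
      unfolding span_press_eps_def by (rule Liminf_le_Limsup) simp
    finally show ?thesis .
  qed
  then have "\<forall>\<^sub>F e in at_right 0. ereal s' \<le> span_press_eps X T f M e g"
    using e0 by (intro eventually_at_rightI[of 0 e0]) auto
  then have "ereal s' \<le> span_press_delta X T f M g" unfolding span_press_delta_def by (rule Liminf_bounded)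
  then show "ereal s' \<le> span_pressure X T f M"
    unfolding span_pressure_eq using g by (intro SUP_upper2[of g]) auto
qed

end

theorem theoremA:
  fixes X :: "'a::metric_space set" and T :: "'a \<Rightarrow> 'a"
    and f :: "nat \<Rightarrow> 'a \<Rightarrow> real" and M :: "'a measure"
  assumes "compact X" and "continuous_on X T" and "T ` X \<subseteq> X"
    and "subadditive_potential X T f"
    and "ergodic_measure X T M"
    and "Fstar M f \<noteq> -\<infinity>"
  shows "car_Pstar X T f M = lower_cap_star X T f M
       \<and> lower_cap_star X T f M = upper_cap_star X T f M
       \<and> upper_cap_star X T f M = span_pressure X T f M
       \<and> span_pressure X T f M = ks_entropy M T + Fstar M f"
proof -
  have inv: "prob_space M" "sets M = sets (restrict_space borel X)" "T \<in> M \<rightarrow>\<^sub>M M" "distr M M T = M"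
    and erg: "\<And>A. A \<in> sets M \<Longrightarrow> T -` A \<inter> space M = A \<Longrightarrow> measure M A = 0 \<or> measure M A = 1"
    using assms(5) by (auto simp: ergodic_measure_def invariant_measure_def)
  interpret prob_space M by (rule inv(1))
  interpret potential_mpt M T X f
    by unfold_locales (use assms inv erg in auto)
  let ?V = "ks_entropy M T + Fstar M f"
  have up: "upper_cap_star X T f M \<le> ereal s" if "?V < ereal s" for s
    using upper_cap_star_le[OF that] .
  \<comment> \<open>Both cuts are direct here. The upper capacity dominates the lower capacity and
    the spanning pressure, which gives their upper bounds, and inherits its own lower bound from the
    lower capacity.\<close>
  have "car_Pstar X T f M = ?V"
    by (rule ereal_eq_by_cuts) (auto intro: pressure_lower_bounds car_Pstar_le)
  moreover have "lower_cap_star X T f M = ?V"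
    by (rule ereal_eq_by_cuts) (auto intro: pressure_lower_bounds order_trans[OF lower_cap_star_le_upper up])
  moreover have "upper_cap_star X T f M = ?V"
    by (rule ereal_eq_by_cuts)
      (auto intro: up order_trans[OF pressure_lower_bounds(2) lower_cap_star_le_upper])
  moreover have "span_pressure X T f M = ?V"
    by (rule ereal_eq_by_cuts)
      (auto intro: pressure_lower_bounds order_trans[OF span_pressure_le_upper_cap_star up])
  ultimately show ?thesis by simp
qed

end
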